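(* Let $A=(c_{ij}x^{\alpha_{ij}})$ be a squarefree multigraded $s\times l$ matrix over $R=\Bbbk[x_1,\ldots,x_n]$, let $T=(\gamma_1,\ldots,\gamma_l,\beta_1,\ldots,\beta_s)$ be a squarefree solution of $E_A$, $M_A=\mathrm{Coker}\,\phi_T$, and let $\alpha\in\mathbb Z^n$. Then for every $i$, $$b_{i,\alpha}(M_A)=\dim_\Bbbk H^{|\sigma_{\alpha_1}|-i-1}(C^\bullet(A,\alpha)),$$ where $b_{i,\alpha}(M_A)=\dim_\Bbbk\mathrm{Tor}_i^R(M_A,\Bbbk)_\alpha$ is the $\alpha$-graded $i$-th Betti number of $M_A$.
   Context: $\Bbbk$ is a field of characteristic $0$, $R=\Bbbk[x_1,\ldots,x_n]$, $[t]=\{1,\ldots,t\}$. For $\alpha=(a_i)\in\mathbb Z^n$, $x^\alpha=\prod x_i^{a_i}$ and $\sigma_\alpha=\mathrm{supp}(\alpha)=\{i:a_i\ne0\}$; for $\alpha\in\mathbb N^n$, $q_\alpha\in\{0,1\}^n$ is the vector with the same support as $\alpha$. For $L\subset[n]$, $\underline L\in\{0,1\}^n$ is its indicator vector. Juxtaposition $\tau t$ means $\tau\cup\{t\}$. Multigraded squarefree matrices: $A=(c_{ij}x^{\alpha_{ij}})$ ($c_{ij}\in\Bbbk$, $\alpha_{ij}\in\mathbb N^n$) is multigraded if every minor equals $c\,x^\alpha$ for some $c\in\Bbbk$ (possibly $0$) and $\alpha\in\mathbb N^n$. $E_A$ is the system of equations $\gamma_j-\beta_i=\alpha_{ij}$,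 for all $(i,j)$ with $c_{ij}\neq0$, in unknown vectors $\gamma_j$ ($j\in[l]$), $\beta_i$ ($i\in[s]$); $A$ is squarefree if $E_A$ has a squarefree solution, i.e. one with all $\gamma_j,\beta_i\in\{0,1\}^n$. For such $T$: $F_1,F_0$ are the free multigraded modules with bases $w_j$ of degree $\gamma_j$ and $v_i$ of degree $\beta_i$, $\phi_T:F_1\to F_0$, $\phi_T(w_j)=\sum_i c_{ij}x^{\alpha_{ij}}v_i$, and $\overline g=g+\mathrm{Im}\,\phi_T$. Ideals, complexes and coefficients: fix a monomial order on $R$ and order monomials of $F_0$ by $uv_i>u'v_j$ if $v_i>v_j$, or $i=j$ and $u>u'$, where $v_s>\cdots>v_1$. Then $\mathrm{in}(\mathrm{Im}\,\phi_T)=I_1v_1\oplus\cdots\oplus I_sv_s$ with $I_j$ squarefree monomial ideals; put $\Delta_{I_j}=\{\sigma\subset[n]:\prod_{i\in\sigma}x_i\notin I_j\}$. The elements $\overline{x^\beta v_j}$ with $\beta\in\mathbb N^n$, $\sigma_\beta\in\Delta_{I_j}$, $j\in[s]$, form a $\Bbbk$-basis of $M_A$. For $\beta\in\mathbb N^n$ with $\sigma_\beta\notin\Delta_{I_j}$, the scalars $r_{j,i,\beta}\in\Bbbk$ ($i<j$) are the unique ones with $\overline{x^\beta v_j}=\sum_{i<j}r_{j,i,\beta}\overline{x^{\beta+\beta_j-\beta_i}v_i}$ and $r_{j,i,\beta}=0$ unless $\beta+\beta_j-\beta_i\in\mathbb N^n$ and $\sigma_{\beta+\beta_j-\beta_i}\in\Delta_{I_i}$.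 Signs: for $L=\{i_1<\cdots<i_t\}$, $\mathrm{sgn}[i_r,L]=(-1)^{r+1}$, and for $W\subset L$, $\mathrm{sgn}[W,L]=\prod_{w\in W}\mathrm{sgn}[w,L]$. Cochains: for a simplicial complex $\Delta$ on a vertex set $V$ (not every element of $V$ need be a face; the void complex $\{\}$ is allowed), $C^j(\Delta)$ is the $\Bbbk$-vector space with basis $\{\tau^*:\tau\in\Delta,|\tau|=j+1\}$ (so $C^{-1}(\Delta)$ is spanned by $\emptyset^*$ if $\Delta\ne\{\}$). For $\tau\in\Delta$, $V_{\tau,\Delta,1}=\{t\in V\setminus\tau:\tau t\in\Delta\}$ and $V_{\tau,\Delta,2}=\{t\in V\setminus\tau:\tau t\notin\Delta\}$. The augmented cochain complex $(C^\bullet(\Delta),d)$ has $d(\tau^* )=\sum_{t\in V_{\tau,\Delta,1}}\mathrm{sgn}[t,\tau t](\tau t)^*$. The construction: for $\alpha\in\mathbb Z^n$ put $\alpha_j=\alpha-\beta_j$. If $\alpha_j\in\mathbb N^n$, $\Delta_{j,\alpha}=\{\sigma\subset\sigma_{\alpha_j}:\sigma\cup\sigma_{\alpha_j-q_{\alpha_j}}\in\Delta_{I_j}\}$, regarded as a simplicial complex on the vertex set $V=\sigma_{\alpha_j}$; otherwise $\Delta_{j,\alpha}=\{\}$. Let $(C^\bullet(j,\alpha),d_j)=(C^\bullet(\Delta_{j,\alpha}),d)$. For $\rho\subset[n]$ with $\sigma_{\beta_i}\subset\rho\cup\sigma_{\beta_j}$, define $f(\rho,j,i)=(\sigma_{\beta_j}\cup\rho)\setminus\sigma_{\beta_i}$.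 For $\tau\in\Delta_{j,\alpha}$ and $w\in V_{\tau,\Delta_{j,\alpha},2}$, define $$\chi_j(\tau^*,w)=\sum_{i<j}\mathrm{sgn}[w,\tau w]\; r_{j,i,\underline{\tau w}+\alpha_j-q_{\alpha_j}}\;\frac{\mathrm{sgn}[\tau w,\sigma_{\alpha_j}]}{\mathrm{sgn}[f(\tau w,j,i),\sigma_{\alpha_i}]}\;(f(\tau w,j,i))^*,$$ the sum being over those $i<j$ for which the coefficient $r$ is nonzero. (The construction asserts that whenever this coefficient is nonzero, $\sigma_{\beta_i}\subset\tau w\cup\sigma_{\beta_j}$ and $f(\tau w,j,i)\in\Delta_{i,\alpha}$, so that for $\tau^*\in C^r(j,\alpha)$ the element $\chi_j(\tau^*,w)$ lies in $\sum_{i<j}C^{r+1+(|\sigma_{\alpha_i}|-|\sigma_{\alpha_j}|)}(i,\alpha)$.) Put $\chi_j(\tau^* )=\sum_{w\in V_{\tau,\Delta_{j,\alpha},2}}\chi_j(\tau^*,w)$. Let $l_j=|\sigma_{\alpha_j}|-|\sigma_{\alpha_1}|$, $C^t(A,\alpha)=\bigoplus_{j=1}^sC^{t+l_j}(j,\alpha)$, and let $\delta^t:C^t(A,\alpha)\to C^{t+1}(A,\alpha)$ be the linear map with $\delta^t(\tau^* )=d_j(\tau^* )+\chi_j(\tau^* )$ for $\tau^*\in C^{t+l_j}(j,\alpha)$. The cochain complex $C^\bullet(A,\alpha)$ has differential $\delta^\bullet$. *)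

theory Defs
  imports "HOL-Library.Poly_Mapping" "HOL-Algebra.Module" "Jordan_Normal_Form.Determinant"
begin

text \<open>
  The variables \<open>x_1 < \<dots> < x_n\<close> are the elements of a finite linearly ordered type \<open>'n\<close>; monomials
  are vectors \<open>'n \<Rightarrow>\<^sub>0 nat\<close>, multidegrees are vectors \<open>'n \<Rightarrow>\<^sub>0 int\<close>, and the support of a vector
  is \<^const>\<open>Poly_Mapping.keys\<close>.  The free module on a set \<open>B\<close> over a commutative ring consists of the finitely
  supported functions with support in \<open>B\<close>; this is used over the polynomial ring as well as over
  the field.
\<close>

type_synonym 'n expo = "'n \<Rightarrow>\<^sub>0 nat"
type_synonym 'n mdeg = "'n \<Rightarrow>\<^sub>0 int"
type_synonym ('n, 'k) mpoly = "('n \<Rightarrow>\<^sub>0 nat) \<Rightarrow>\<^sub>0 'k"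


section \<open>Vectors\<close>

definition int_vec :: "'n expo \<Rightarrow> 'n mdeg" where
  "int_vec u = Poly_Mapping.map int u"

definition nat_vec :: "'n mdeg \<Rightarrow> 'n expo" where
  "nat_vec a = Poly_Mapping.map nat a"

definition nonneg_vec :: "'n mdeg \<Rightarrow> bool" where
  "nonneg_vec a \<longleftrightarrow> (\<forall>i. 0 \<le> Poly_Mapping.lookup a i)"

definition squarefree_vec :: "'n mdeg \<Rightarrow> bool" where
  "squarefree_vec a \<longleftrightarrow> (\<forall>i. Poly_Mapping.lookup a i \<in> {0, 1})"

definition ind_vec :: "'n set \<Rightarrow> 'n mdeg" where
  "ind_vec L = (\<Sum>i\<in>L. Poly_Mapping.single i 1)"


section \<open>Free modules\<close>

definition fscale :: "'r::comm_ring_1 \<Rightarrow> ('b \<Rightarrow>\<^sub>0 'r) \<Rightarrow> ('b \<Rightarrow>\<^sub>0 'r)" where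
  "fscale r f = Poly_Mapping.map ((*) r) f"

definition free_module :: "'b set \<Rightarrow> ('b \<Rightarrow>\<^sub>0 'r::zero) set" where
  "free_module B = {f. Poly_Mapping.keys f \<subseteq> B}"

definition lin_ext :: "('b \<Rightarrow> ('c \<Rightarrow>\<^sub>0 'r::comm_ring_1)) \<Rightarrow> ('b \<Rightarrow>\<^sub>0 'r) \<Rightarrow> ('c \<Rightarrow>\<^sub>0 'r)" where
  "lin_ext g f = (\<Sum>b\<in>Poly_Mapping.keys f. fscale (Poly_Mapping.lookup f b) (g b))"

lemma lookup_fscale: "Poly_Mapping.lookup (fscale r f) b = r * Poly_Mapping.lookup f b"
  by (simp add: fscale_def map.rep_eq when_def)

lemma module_fscale: "Modules.module (fscale :: 'r::comm_ring_1 \<Rightarrow> ('b \<Rightarrow>\<^sub>0 'r) \<Rightarrow> _)"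
  by unfold_locales
    (auto intro!: poly_mapping_eqI simp: lookup_fscale lookup_add algebra_simps)

lemma vector_space_fscale: "vector_space (fscale :: 'k::field \<Rightarrow> ('b \<Rightarrow>\<^sub>0 'k) \<Rightarrow> _)"
  by unfold_locales
    (auto intro!: poly_mapping_eqI simp: lookup_fscale lookup_add algebra_simps)

text \<open>
  Degree \<open>\<alpha>\<close> part of the free multigraded module with basis \<open>B\<close>, where \<open>b \<in> B\<close> has degree \<open>g b\<close>.
\<close>

definition free_comp ::
  "'b set \<Rightarrow> ('b \<Rightarrow> 'n mdeg) \<Rightarrow> 'n mdeg \<Rightarrow> ('b \<Rightarrow>\<^sub>0 ('n, 'k::zero) mpoly) set" where
  "free_comp B g \<alpha> =
     {f \<in> free_module B. \<forall>b u. Poly_Mapping.lookup (Poly_Mapping.lookup f b) u \<noteq> 0 \<longrightarrow> int_vec u + g b = \<alpha>}"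

text \<open>
  Dimension of the homology at \<open>C\<close> of \<open>C' \<rightarrow> C \<rightarrow> C''\<close>, the maps being \<open>g\<close> and \<open>f\<close>, for
  finite-dimensional spaces: \<open>dim (ker f) - dim (im g)\<close>.
\<close>

definition homology_dim ::
  "('b \<Rightarrow>\<^sub>0 'k::field) set \<Rightarrow> (('b \<Rightarrow>\<^sub>0 'k) \<Rightarrow> ('c \<Rightarrow>\<^sub>0 'k)) \<Rightarrow>
   ('a \<Rightarrow>\<^sub>0 'k) set \<Rightarrow> (('a \<Rightarrow>\<^sub>0 'k) \<Rightarrow> ('b \<Rightarrow>\<^sub>0 'k)) \<Rightarrow> nat" where
  "homology_dim C f C' g =
     vector_space.dim fscale {x \<in> C. f x = 0} - vector_space.dim fscale (g ` C')"


section \<open>Multigraded modules and Betti numbers\<close>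

record ('r, 'm, 'd) graded_module = "('r, 'm) module" +
  hcomp :: "'d \<Rightarrow> 'm set"

text \<open>
  Data of a complex of free modules of finite rank with an augmentation.  The \<open>i\<close>-th module
  \<open>F_i\<close> has basis \<open>{..<rk i}\<close>, the basis element \<open>b\<close> has degree \<open>bdeg i b\<close>, the map
  \<open>F_{i+1} \<rightarrow> F_i\<close> sends it to \<open>bdry i b\<close>, and \<open>aug\<close> is a map from \<open>F_0\<close>.
\<close>

record (overloaded) ('n, 'k::zero, 'm) free_complex =
  rk :: "nat \<Rightarrow> nat"
  bdeg :: "nat \<Rightarrow> nat \<Rightarrow> 'n mdeg"
  bdry :: "nat \<Rightarrow> nat \<Rightarrow> (nat \<Rightarrow>\<^sub>0 ('n, 'k) mpoly)"
  aug :: "(nat \<Rightarrow>\<^sub>0 ('n, 'k) mpoly) \<Rightarrow> 'm"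

abbreviation fterm :: "('n, 'k::field, 'm) free_complex \<Rightarrow> nat \<Rightarrow> (nat \<Rightarrow>\<^sub>0 ('n, 'k) mpoly) set" where
  "fterm F i \<equiv> free_module {..<rk F i}"

definition is_free_resolution ::
  "(('n, 'k::field) mpoly, 'm, 'n mdeg) graded_module \<Rightarrow> ('n, 'k, 'm) free_complex \<Rightarrow> bool" where
  "is_free_resolution M F \<longleftrightarrow>
     (\<forall>i. \<forall>b < rk F (Suc i).
        bdry F i b \<in> free_comp {..<rk F i} (bdeg F i) (bdeg F (Suc i) b)) \<and>
     (\<forall>f \<in> fterm F 0. \<forall>g \<in> fterm F 0. aug F (f + g) = aug F f \<oplus>\<^bsub>M\<^esub> aug F g) \<and>
     (\<forall>p. \<forall>f \<in> fterm F 0. aug F (fscale p f) = p \<odot>\<^bsub>M\<^esub> aug F f) \<and>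
     (\<forall>\<alpha>. aug F ` free_comp {..<rk F 0} (bdeg F 0) \<alpha> \<subseteq> hcomp M \<alpha>) \<and>
     aug F ` fterm F 0 = carrier M \<and>
     {f \<in> fterm F 0. aug F f = \<zero>\<^bsub>M\<^esub>} = lin_ext (bdry F 0) ` fterm F 1 \<and>
     (\<forall>i. {f \<in> fterm F (Suc i). lin_ext (bdry F i) f = 0} =
           lin_ext (bdry F (Suc i)) ` fterm F (Suc (Suc i)))"

text \<open>
  The complex \<open>F \<otimes> k\<close> in degree \<open>\<alpha>\<close>: as \<open>F_i \<otimes> k = F_i / (x_1, \<dots>, x_n) F_i\<close>, its \<open>i\<close>-th term has
  as basis the basis elements of \<open>F_i\<close> of degree \<open>\<alpha>\<close>, and the entries of the maps are replaced by
  their constant coefficients.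
\<close>

definition tensor_term :: "('n, 'k::field, 'm) free_complex \<Rightarrow> nat \<Rightarrow> 'n mdeg \<Rightarrow> (nat \<Rightarrow>\<^sub>0 'k) set" where
  "tensor_term F i \<alpha> = free_module {b. b < rk F i \<and> bdeg F i b = \<alpha>}"

definition tensor_diff ::
  "('n, 'k::field, 'm) free_complex \<Rightarrow> nat \<Rightarrow> (nat \<Rightarrow>\<^sub>0 'k) \<Rightarrow> (nat \<Rightarrow>\<^sub>0 'k)" where
  "tensor_diff F i =
     (case i of 0 \<Rightarrow> (\<lambda>_. 0)
      | Suc j \<Rightarrow> lin_ext (\<lambda>b. Poly_Mapping.map (\<lambda>p. Poly_Mapping.lookup p 0) (bdry F j b)))"

text \<open>
  \<open>b_{i,\<alpha>}(M) = dim Tor_i(M, k)_\<alpha>\<close> for a finitely generated multigraded module \<open>M\<close>, computed from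
  an (arbitrarily chosen) multigraded free resolution of \<open>M\<close> by modules of finite rank.
\<close>

definition betti ::
  "(('n, 'k::field) mpoly, 'm, 'n mdeg) graded_module \<Rightarrow> nat \<Rightarrow> 'n mdeg \<Rightarrow> nat" where
  "betti M i \<alpha> =
     (let F = (SOME F. is_free_resolution M F)
      in homology_dim (tensor_term F i \<alpha>) (tensor_diff F i)
           (tensor_term F (Suc i) \<alpha>) (tensor_diff F (Suc i)))"


section \<open>Squarefree multigraded matrices\<close>

text \<open>
  The matrix \<open>(c_{ij} x^{\<alpha>_{ij}})\<close> with \<open>c_{ij} = coef i j\<close> and \<open>\<alpha>_{ij} = expn i j\<close>, for
  \<open>1 \<le> i \<le> nrows\<close> and \<open>1 \<le> j \<le> ncols\<close>.
\<close>

record ('n, 'k) term_matrix =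
  nrows :: nat
  ncols :: nat
  coef :: "nat \<Rightarrow> nat \<Rightarrow> 'k"
  expn :: "nat \<Rightarrow> nat \<Rightarrow> 'n expo"

definition entry :: "('n, 'k::field) term_matrix \<Rightarrow> nat \<Rightarrow> nat \<Rightarrow> ('n, 'k) mpoly" where
  "entry A i j = Poly_Mapping.single (expn A i j) (coef A i j)"

definition multigraded :: "('n, 'k::field) term_matrix \<Rightarrow> bool" where
  "multigraded A \<longleftrightarrow>
     (\<forall>m \<rho> \<kappa>. strict_mono_on {..<m} \<rho> \<and> \<rho> ` {..<m} \<subseteq> {1..nrows A} \<and>
             strict_mono_on {..<m} \<kappa> \<and> \<kappa> ` {..<m} \<subseteq> {1..ncols A} \<longrightarrow>
        (\<exists>u c. det (mat m m (\<lambda>(p, q). entry A (\<rho> p) (\<kappa> q))) = Poly_Mapping.single u c))"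

definition is_solution ::
  "('n, 'k::field) term_matrix \<Rightarrow> (nat \<Rightarrow> 'n mdeg) \<Rightarrow> (nat \<Rightarrow> 'n mdeg) \<Rightarrow> bool" where
  "is_solution A \<gamma> \<beta> \<longleftrightarrow>
     (\<forall>i\<in>{1..nrows A}. \<forall>j\<in>{1..ncols A}. coef A i j \<noteq> 0 \<longrightarrow> \<gamma> j - \<beta> i = int_vec (expn A i j))"

definition squarefree_solution ::
  "('n, 'k::field) term_matrix \<Rightarrow> (nat \<Rightarrow> 'n mdeg) \<Rightarrow> (nat \<Rightarrow> 'n mdeg) \<Rightarrow> bool" where
  "squarefree_solution A \<gamma> \<beta> \<longleftrightarrow> is_solution A \<gamma> \<beta> \<and>
     (\<forall>j\<in>{1..ncols A}. squarefree_vec (\<gamma> j)) \<and> (\<forall>i\<in>{1..nrows A}. squarefree_vec (\<beta> i))"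

definition squarefree_matrix :: "('n, 'k::field) term_matrix \<Rightarrow> bool" where
  "squarefree_matrix A \<longleftrightarrow> (\<exists>\<gamma> \<beta>. squarefree_solution A \<gamma> \<beta>)"

definition phi ::
  "('n, 'k::field) term_matrix \<Rightarrow> (nat \<Rightarrow>\<^sub>0 ('n, 'k) mpoly) \<Rightarrow> (nat \<Rightarrow>\<^sub>0 ('n, 'k) mpoly)" where
  "phi A = lin_ext (\<lambda>j. \<Sum>i=1..nrows A. Poly_Mapping.single i (entry A i j))"

definition im_phi :: "('n, 'k::field) term_matrix \<Rightarrow> (nat \<Rightarrow>\<^sub>0 ('n, 'k) mpoly) set" where
  "im_phi A = phi A ` free_module {1..ncols A}"

definition coset :: "'a::ab_group_add set \<Rightarrow> 'a \<Rightarrow> 'a set" where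
  "coset N g = (\<lambda>v. g + v) ` N"

text \<open>
  The cokernel of \<open>phi A\<close>, with the grading for which \<open>v_i\<close> has degree \<open>\<beta> i\<close>.  As usual for module
  records, the ring multiplication and unit are left unspecified.
\<close>

definition coker_module ::
  "('n, 'k::field) term_matrix \<Rightarrow> (nat \<Rightarrow> 'n mdeg) \<Rightarrow>
   (('n, 'k) mpoly, (nat \<Rightarrow>\<^sub>0 ('n, 'k) mpoly) set, 'n mdeg) graded_module" where
  "coker_module A \<beta> =
     \<lparr>carrier = coset (im_phi A) ` free_module {1..nrows A},
      monoid.mult = undefined, one = undefined,
      zero = im_phi A,
      add = (\<lambda>X Y. {x + y |x y. x \<in> X \<and> y \<in> Y}),
      module.smult = (\<lambda>p X. {fscale p x + v |x v. x \<in> X \<and> v \<in> im_phi A}),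
      hcomp = (\<lambda>\<alpha>. coset (im_phi A) ` free_comp {1..nrows A} \<beta> \<alpha>)\<rparr>"


section \<open>Initial ideals and reduction coefficients\<close>

definition monomial_order :: "('n expo \<Rightarrow> 'n expo \<Rightarrow> bool) \<Rightarrow> bool" where
  "monomial_order mle \<longleftrightarrow> reflp mle \<and> antisymp mle \<and> transp mle \<and> totalp mle \<and>
     (\<forall>u. mle 0 u) \<and> (\<forall>u v w. mle u v \<longrightarrow> mle (u + w) (v + w))"

definition is_leading ::
  "('n expo \<Rightarrow> 'n expo \<Rightarrow> bool) \<Rightarrow> (nat \<Rightarrow>\<^sub>0 ('n, 'k::field) mpoly) \<Rightarrow> 'n expo \<Rightarrow> nat \<Rightarrow> bool" where
  "is_leading mle f u j \<longleftrightarrow> Poly_Mapping.lookup (Poly_Mapping.lookup f j) u \<noteq> 0 \<and>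
     (\<forall>i v. Poly_Mapping.lookup (Poly_Mapping.lookup f i) v \<noteq> 0 \<longrightarrow> i < j \<or> i = j \<and> mle v u)"

definition mono_vec :: "nat \<Rightarrow> 'n expo \<Rightarrow> (nat \<Rightarrow>\<^sub>0 ('n, 'k::field) mpoly)" where
  "mono_vec j u = Poly_Mapping.single j (Poly_Mapping.single u 1)"

definition initial_module ::
  "('n expo \<Rightarrow> 'n expo \<Rightarrow> bool) \<Rightarrow> (nat \<Rightarrow>\<^sub>0 ('n, 'k::field) mpoly) set \<Rightarrow>
   (nat \<Rightarrow>\<^sub>0 ('n, 'k) mpoly) set" where
  "initial_module mle N =
     Modules.module.span fscale {mono_vec j u |j u. \<exists>f\<in>N. is_leading mle f u j}"

definition initial_ideal ::
  "('n expo \<Rightarrow> 'n expo \<Rightarrow> bool) \<Rightarrow> ('n, 'k::field) term_matrix \<Rightarrow> nat \<Rightarrow> ('n, 'k) mpoly set" where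
  "initial_ideal mle A j = {p. Poly_Mapping.single j p \<in> initial_module mle (im_phi A)}"

definition ideal_complex :: "('n, 'k::field) mpoly set \<Rightarrow> 'n set set" where
  "ideal_complex I =
     {\<sigma>. (\<Prod>i\<in>\<sigma>. Poly_Mapping.single (Poly_Mapping.single i 1) 1) \<notin> I}"

text \<open>
  The scalars \<open>r_{j,i,b}\<close> with \<open>x^b v_j = \<Sum>_{i<j} r_{j,i,b} x^{b + \<beta>_j - \<beta>_i} v_i\<close> modulo the image of
  \<open>phi A\<close>, as a function of \<open>i\<close> that is extended by \<open>0\<close>.  They are meaningful only if the support
  of \<open>b\<close> is not in the complex of the \<open>j\<close>-th initial ideal.
\<close>

definition red_coeff ::
  "('n expo \<Rightarrow> 'n expo \<Rightarrow> bool) \<Rightarrow> ('n, 'k::field) term_matrix \<Rightarrow> (nat \<Rightarrow> 'n mdeg) \<Rightarrow>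
   nat \<Rightarrow> 'n mdeg \<Rightarrow> nat \<Rightarrow> 'k" where
  "red_coeff mle A \<beta> j b =
     (THE r. (\<forall>i. r i \<noteq> 0 \<longrightarrow> i \<in> {1..<j} \<and> nonneg_vec (b + \<beta> j - \<beta> i) \<and>
                 Poly_Mapping.keys (b + \<beta> j - \<beta> i) \<in> ideal_complex (initial_ideal mle A i)) \<and>
             coset (im_phi A) (mono_vec j (nat_vec b)) =
             coset (im_phi A)
               (\<Sum>i\<in>{1..<j}. Poly_Mapping.single i
                  (Poly_Mapping.single (nat_vec (b + \<beta> j - \<beta> i)) (r i))))"


section \<open>The cochain complex\<close>

definition elt_sign :: "'n::linorder \<Rightarrow> 'n set \<Rightarrow> 'k::field" where
  "elt_sign w L = (- 1) ^ (card {v \<in> L. v \<le> w} + 1)"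

definition set_sign :: "'n::linorder set \<Rightarrow> 'n set \<Rightarrow> 'k::field" where
  "set_sign W L = (\<Prod>w\<in>W. elt_sign w L)"

text \<open>The complex \<open>\<Delta>_{j,\<alpha>}\<close>, on the vertex set \<open>Poly_Mapping.keys (\<alpha> - \<beta> j)\<close>.\<close>

definition delta_complex ::
  "('n expo \<Rightarrow> 'n expo \<Rightarrow> bool) \<Rightarrow> ('n, 'k::field) term_matrix \<Rightarrow> (nat \<Rightarrow> 'n mdeg) \<Rightarrow>
   'n mdeg \<Rightarrow> nat \<Rightarrow> 'n set set" where
  "delta_complex mle A \<beta> \<alpha> j =
     (if nonneg_vec (\<alpha> - \<beta> j) then
        {\<sigma>. \<sigma> \<subseteq> Poly_Mapping.keys (\<alpha> - \<beta> j) \<and>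
            \<sigma> \<union> Poly_Mapping.keys (\<alpha> - \<beta> j - ind_vec (Poly_Mapping.keys (\<alpha> - \<beta> j)))
              \<in> ideal_complex (initial_ideal mle A j)}
      else {})"

definition face_shift :: "(nat \<Rightarrow> 'n mdeg) \<Rightarrow> 'n set \<Rightarrow> nat \<Rightarrow> nat \<Rightarrow> 'n set" where
  "face_shift \<beta> \<rho> j i = (Poly_Mapping.keys (\<beta> j) \<union> \<rho>) - Poly_Mapping.keys (\<beta> i)"

text \<open>
  In the following, the basis element \<open>\<tau>*\<close> of the cochains of \<open>\<Delta>_{j,\<alpha>}\<close> is the pair \<open>(j, \<tau>)\<close>, so
  that direct sums over \<open>j\<close> are spaces of finitely supported functions on such pairs.
\<close>

definition simp_diff ::
  "('n expo \<Rightarrow> 'n expo \<Rightarrow> bool) \<Rightarrow> ('n::linorder, 'k::field) term_matrix \<Rightarrow> (nat \<Rightarrow> 'n mdeg) \<Rightarrow>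
   'n mdeg \<Rightarrow> nat \<Rightarrow> 'n set \<Rightarrow> (nat \<times> 'n set \<Rightarrow>\<^sub>0 'k)" where
  "simp_diff mle A \<beta> \<alpha> j \<tau> =
     (\<Sum>t \<in> {t \<in> Poly_Mapping.keys (\<alpha> - \<beta> j) - \<tau>. insert t \<tau> \<in> delta_complex mle A \<beta> \<alpha> j}.
        Poly_Mapping.single (j, insert t \<tau>) (elt_sign t (insert t \<tau>)))"

definition chi_at ::
  "('n expo \<Rightarrow> 'n expo \<Rightarrow> bool) \<Rightarrow> ('n::linorder, 'k::field) term_matrix \<Rightarrow> (nat \<Rightarrow> 'n mdeg) \<Rightarrow>
   'n mdeg \<Rightarrow> nat \<Rightarrow> 'n set \<Rightarrow> 'n \<Rightarrow> (nat \<times> 'n set \<Rightarrow>\<^sub>0 'k)" where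
  "chi_at mle A \<beta> \<alpha> j \<tau> w =
     (let r = red_coeff mle A \<beta> j
                (ind_vec (insert w \<tau>) + (\<alpha> - \<beta> j) - ind_vec (Poly_Mapping.keys (\<alpha> - \<beta> j)))
      in \<Sum>i \<in> {i \<in> {1..<j}. r i \<noteq> 0}.
           Poly_Mapping.single (i, face_shift \<beta> (insert w \<tau>) j i)
             (elt_sign w (insert w \<tau>) * r i *
              (set_sign (insert w \<tau>) (Poly_Mapping.keys (\<alpha> - \<beta> j)) /
               set_sign (face_shift \<beta> (insert w \<tau>) j i) (Poly_Mapping.keys (\<alpha> - \<beta> i)))))"

definition chi ::
  "('n expo \<Rightarrow> 'n expo \<Rightarrow> bool) \<Rightarrow> ('n::linorder, 'k::field) term_matrix \<Rightarrow> (nat \<Rightarrow> 'n mdeg) \<Rightarrow>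
   'n mdeg \<Rightarrow> nat \<Rightarrow> 'n set \<Rightarrow> (nat \<times> 'n set \<Rightarrow>\<^sub>0 'k)" where
  "chi mle A \<beta> \<alpha> j \<tau> =
     (\<Sum>w \<in> {w \<in> Poly_Mapping.keys (\<alpha> - \<beta> j) - \<tau>. insert w \<tau> \<notin> delta_complex mle A \<beta> \<alpha> j}.
        chi_at mle A \<beta> \<alpha> j \<tau> w)"

definition shift_len :: "(nat \<Rightarrow> 'n mdeg) \<Rightarrow> 'n mdeg \<Rightarrow> nat \<Rightarrow> int" where
  "shift_len \<beta> \<alpha> j = int (card (Poly_Mapping.keys (\<alpha> - \<beta> j))) - int (card (Poly_Mapping.keys (\<alpha> - \<beta> 1)))"

definition cochains ::
  "('n expo \<Rightarrow> 'n expo \<Rightarrow> bool) \<Rightarrow> ('n, 'k::field) term_matrix \<Rightarrow> (nat \<Rightarrow> 'n mdeg) \<Rightarrow>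
   'n mdeg \<Rightarrow> int \<Rightarrow> (nat \<times> 'n set \<Rightarrow>\<^sub>0 'k) set" where
  "cochains mle A \<beta> \<alpha> t =
     free_module {(j, \<tau>). j \<in> {1..nrows A} \<and> \<tau> \<in> delta_complex mle A \<beta> \<alpha> j \<and>
                          int (card \<tau>) = (t + shift_len \<beta> \<alpha> j) + 1}"

definition codiff ::
  "('n expo \<Rightarrow> 'n expo \<Rightarrow> bool) \<Rightarrow> ('n::linorder, 'k::field) term_matrix \<Rightarrow> (nat \<Rightarrow> 'n mdeg) \<Rightarrow>
   'n mdeg \<Rightarrow> (nat \<times> 'n set \<Rightarrow>\<^sub>0 'k) \<Rightarrow> (nat \<times> 'n set \<Rightarrow>\<^sub>0 'k)" where
  "codiff mle A \<beta> \<alpha> = lin_ext (\<lambda>(j, \<tau>). simp_diff mle A \<beta> \<alpha> j \<tau> + chi mle A \<beta> \<alpha> j \<tau>)"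

text \<open>
  Dimension of \<open>H^t\<close>.  If all entries of \<open>\<alpha>\<close> are at most \<open>1\<close>, \<^const>\<open>codiff\<close> maps the \<open>t\<close>-th cochains to
  the \<open>(t+1)\<close>-st ones and squares to \<open>0\<close>.  If some entry of \<open>\<alpha>\<close> exceeds \<open>1\<close>, the sets
  \<^const>\<open>face_shift\<close> occurring in \<^const>\<open>chi\<close> need not be faces of the target complexes, and
  this can fail; the defining formulas are nevertheless kept for all \<open>\<alpha>\<close>, the right-hand side then
  being the truncated difference of the dimensions of kernel and image.
\<close>

definition cohomology_dim ::
  "('n expo \<Rightarrow> 'n expo \<Rightarrow> bool) \<Rightarrow> ('n::linorder, 'k::field) term_matrix \<Rightarrow> (nat \<Rightarrow> 'n mdeg) \<Rightarrow>
   'n mdeg \<Rightarrow> int \<Rightarrow> nat" where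
  "cohomology_dim mle A \<beta> \<alpha> t =
     homology_dim (cochains mle A \<beta> \<alpha> t) (codiff mle A \<beta> \<alpha>)
       (cochains mle A \<beta> \<alpha> (t - 1)) (codiff mle A \<beta> \<alpha>)"

end

theory Submission
  imports Defs
begin

text \<open>
  Tensoring a free resolution of \<open>M\<close> with \<open>k\<close> and taking the Koszul complex of \<open>M\<close> give the two edges of
  the double complex formed by the Koszul complexes of the terms of the resolution; its other rows
  and columns are exact, so a dimension count along a staircase shows that the edges have the same
  homology.  Such a resolution by modules of finite rank exists because all degrees involved are
  squarefree.

  In degree \<open>\<alpha>\<close> the Koszul complex of \<open>M\<close> has the basis \<open>e_L \<otimes> x^u v_j\<close> with \<open>u = \<alpha> - L - \<beta>_j\<close>, over the pairs \<open>(L, j)\<close>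
  such that \<open>x^u v_j\<close> is standard; the pair corresponds to the face \<open>\<sigma>_{\<alpha>_j} - L\<close> of \<open>\<Delta>_{j,\<alpha>}\<close>.  The
  product of \<open>x_w\<close> and \<open>x^u v_j\<close> is standard, which gives the simplicial differential, or its normal
  form gives \<open>\<chi>_j\<close>.  The standard monomials are found by linear algebra in one degree at a time, and
  they only depend on the support of the degree, as the degrees \<open>\<gamma>_j\<close> and \<open>\<beta>_i\<close> are squarefree.

  The faces match in this way if all entries of \<open>\<alpha>\<close> are at most \<open>1\<close>.  Otherwise both sides are \<open>0\<close>.
\<close>

section \<open>Free modules\<close>

text \<open>\<open>betti\<close> evaluates one resolution picked by \<open>SOME\<close>, so the
  count must work for an arbitrary resolution, and some resolution must exist for the choice to mean
  anything. Both become feasible once polynomials are dropped: in degree \<open>a\<close> a basis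
  element of degree \<open>g b\<close> carries one monomial, with exponent \<open>a - g b\<close>,
  or none unless \<open>g b \<le> a\<close>. So the degree \<open>a\<close> part of a free module is
  a coordinate space over the field, multiplication by a monomial is an inclusion of coordinate
  spaces, and a homogeneous map is one scalar matrix valid in all degrees. The bound on the entries
  of \<alpha> matters for \<open>face_shift\<close>: under it the support of
  \<open>\<beta> j\<close> and the set \<open>verts j - L\<close> together form the support of
  \<alpha> without L. This set is the same for every j, and removing the support of
  \<open>\<beta> i\<close> from it leaves \<open>verts i - L\<close>. If the entry at k is at least
  2, being standard does not depend on whether k lies in L; pairing the sets with and without k then
  kills both homologies. As \<open>codiff\<close> need not square to 0 in that case, the vanishing
  is argued by ranks.\<close>

abbreviation lkp where "lkp \<equiv> Poly_Mapping.lookup"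
abbreviation supp where "supp \<equiv> Poly_Mapping.keys"
abbreviation sng where "sng \<equiv> Poly_Mapping.single"

global_interpretation fs: vector_space "fscale :: 'k::field \<Rightarrow> ('b \<Rightarrow>\<^sub>0 'k) \<Rightarrow> _"
  by (rule vector_space_fscale)

lemma fscale_simps [simp]:
  "fscale 0 f = 0" "fscale r 0 = 0" "fscale 1 f = f"
  by (auto intro!: poly_mapping_eqI simp: lookup_fscale)

lemma fscale_distrib:
  "fscale r (f + g) = fscale r f + fscale r g"
  "fscale (r + s) f = fscale r f + fscale s f"
  "fscale r (f - g) = fscale r f - fscale r g"
  "fscale r (fscale s f) = fscale (r * s) f"
  by (auto intro!: poly_mapping_eqI simp: lookup_fscale lookup_add lookup_minus algebra_simps)

lemma fscale_single: "fscale r (sng b c) = sng b (r * c)"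
  by (auto intro!: poly_mapping_eqI simp: lookup_fscale lookup_single when_def)

lemma fscale_sum: "fscale r (sum f I) = (\<Sum>i\<in>I. fscale r (f i))"
  by (auto intro!: poly_mapping_eqI simp: lookup_fscale lookup_sum sum_distrib_left)

lemma lin_ext_superset:
  assumes "finite S" "supp f \<subseteq> S"
  shows "lin_ext g f = (\<Sum>b\<in>S. fscale (lkp f b) (g b))"
  unfolding lin_ext_def using assms
  by (intro sum.mono_neutral_left) (auto simp: in_keys_iff)

lemma lookup_lin_ext:
  assumes "finite S" "supp f \<subseteq> S"
  shows "lkp (lin_ext g f) c = (\<Sum>b\<in>S. lkp f b * lkp (g b) c)"
  by (simp add: lin_ext_superset[OF assms] lookup_sum lookup_fscale)

lemma lin_ext_zero [simp]: "lin_ext g 0 = 0"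
  by (simp add: lin_ext_def)

lemma lin_ext_add: "lin_ext g (f + h) = lin_ext g f + lin_ext g h"
proof -
  let ?S = "supp f \<union> supp h"
  have "supp (f + h) \<subseteq> ?S" by (rule keys_add)
  then show ?thesis
    using lin_ext_superset[of ?S "f + h" g] lin_ext_superset[of ?S f g] lin_ext_superset[of ?S h g]
    by (simp add: lookup_add fscale_distrib sum.distrib)
qed

lemma lin_ext_fscale: "lin_ext g (fscale r f) = fscale r (lin_ext g f)"
proof -
  have "supp (fscale r f) \<subseteq> supp f"
    by (auto simp: in_keys_iff lookup_fscale)
  then show ?thesis
    using lin_ext_superset[of "supp f" "fscale r f" g]
    by (simp add: lin_ext_def fscale_sum fscale_distrib lookup_fscale)
qed

lemma lin_ext_single [simp]: "lin_ext g (sng b c) = fscale c (g b)"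
  by (simp add: lin_ext_def)

lemma lin_ext_sum: "lin_ext g (sum f I) = (\<Sum>i\<in>I. lin_ext g (f i))"
  by (induction I rule: infinite_finite_induct) (auto simp: lin_ext_add)

lemma lin_ext_diff: "lin_ext g (f - h) = lin_ext g f - lin_ext g h"
  by (metis add_diff_cancel diff_add_cancel lin_ext_add)

lemma lin_ext_cong:
  assumes "\<And>b. b \<in> supp f \<Longrightarrow> g b = h b"
  shows "lin_ext g f = lin_ext h f"
  using assms by (simp add: lin_ext_def)

lemma lin_ext_lin_ext: "lin_ext f (lin_ext g x) = lin_ext (\<lambda>b. lin_ext f (g b)) x"
  by (simp add: lin_ext_def[of g] lin_ext_def[of "\<lambda>b. lin_ext f (g b)"] lin_ext_sum lin_ext_fscale)

lemma lin_ext_in: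
  assumes "Modules.module.subspace fscale V" "\<And>b. b \<in> supp x \<Longrightarrow> g b \<in> V"
  shows "lin_ext g x \<in> (V :: ('b \<Rightarrow>\<^sub>0 'r::comm_ring_1) set)"
  unfolding lin_ext_def using assms
  by (intro Modules.module.subspace_sum[OF module_fscale])
    (auto intro: Modules.module.subspace_scale[OF module_fscale])

lemma subspace_free_module: "Modules.module.subspace fscale (free_module B :: ('b \<Rightarrow>\<^sub>0 'r::comm_ring_1) set)"
proof (rule Modules.module.subspaceI[OF module_fscale])
  fix x y :: "'b \<Rightarrow>\<^sub>0 'r" and c
  assume "x \<in> free_module B"
  then show "fscale c x \<in> free_module B"
    unfolding free_module_def subset_iff in_keys_iff lookup_fscale mem_Collect_eq
    by (metis mult_zero_right)
  assume "y \<in> free_module B"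
  with \<open>x \<in> free_module B\<close> show "x + y \<in> free_module B"
    using keys_add[of x y] by (auto simp: free_module_def)
qed (simp add: free_module_def)

lemma in_free_moduleD: "x \<in> free_module B \<Longrightarrow> lkp x b \<noteq> 0 \<Longrightarrow> b \<in> B"
  by (auto simp: free_module_def in_keys_iff)

lemma in_free_moduleI: "(\<And>b. lkp x b \<noteq> 0 \<Longrightarrow> b \<in> B) \<Longrightarrow> x \<in> free_module B"
  by (auto simp: free_module_def in_keys_iff)

lemma free_module_mono: "B \<subseteq> C \<Longrightarrow> free_module B \<subseteq> free_module C"
  by (auto simp: free_module_def)

lemma single_in_free_module: "b \<in> B \<Longrightarrow> sng b c \<in> free_module B"
  by (auto simp: free_module_def)

lemmas free_module_add = Modules.module.subspace_add[OF module_fscale subspace_free_module]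
lemmas free_module_diff = Modules.module.subspace_diff[OF module_fscale subspace_free_module]
lemmas free_module_scale = Modules.module.subspace_scale[OF module_fscale subspace_free_module]
lemmas free_module_sum = Modules.module.subspace_sum[OF module_fscale subspace_free_module]
lemmas free_module_zero = Modules.module.subspace_0[OF module_fscale subspace_free_module]
lemmas lin_ext_in_free_module = lin_ext_in[OF subspace_free_module]

lemma sum_single: "(\<Sum>b\<in>supp x. sng b (lkp x b)) = x"
  by (rule poly_mapping_eqI) (auto simp: lookup_sum lookup_single when_def in_keys_iff)

lemma lin_ext_single_id:
  "lin_ext (\<lambda>b. sng b 1) x = x"
  using sum_single[of x] by (simp add: lin_ext_def fscale_single)

lemma sum_single_superset:
  assumes "finite S" "supp x \<subseteq> S"
  shows "(\<Sum>b\<in>S. sng b (lkp x b)) = x"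
proof -
  have "(\<Sum>b\<in>S. sng b (lkp x b)) = (\<Sum>b\<in>supp x. sng b (lkp x b))"
    using assms by (intro sum.mono_neutral_right) (auto simp: in_keys_iff)
  then show ?thesis by (simp add: sum_single)
qed

abbreviation linear_map :: "(('b \<Rightarrow>\<^sub>0 'k::field) \<Rightarrow> ('c \<Rightarrow>\<^sub>0 'k)) \<Rightarrow> bool" where
  "linear_map \<equiv> Vector_Spaces.linear fscale fscale"

lemma linear_lin_ext: "linear_map (lin_ext g :: ('b \<Rightarrow>\<^sub>0 'k::field) \<Rightarrow> _)"
  unfolding Vector_Spaces.linear_iff
  by (simp add: lin_ext_add lin_ext_fscale vector_space_fscale)

lemma free_module_eq_span:
  "free_module B = fs.span ((\<lambda>b. sng b (1::'k::field)) ` B)"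
proof
  show "free_module B \<subseteq> fs.span ((\<lambda>b. sng b (1::'k)) ` B)"
  proof
    fix x :: "'a \<Rightarrow>\<^sub>0 'k" assume "x \<in> free_module B"
    then have "lin_ext (\<lambda>b. sng b 1) x \<in> fs.span ((\<lambda>b. sng b (1::'k)) ` B)"
      by (intro lin_ext_in) (auto intro: fs.span_base simp: free_module_def)
    then show "x \<in> fs.span ((\<lambda>b. sng b (1::'k)) ` B)" by (simp add: lin_ext_single_id)
  qed
  show "fs.span ((\<lambda>b. sng b (1::'k)) ` B) \<subseteq> free_module B"
    by (intro fs.span_minimal) (auto simp: subspace_free_module single_in_free_module)
qed

section \<open>Dimension counting\<close>

text \<open>The ambient space of finitely supported functions may be infinite-dimensional, so
  finiteness is recorded for each subspace separately.\<close>

definition fin_sub :: "('b \<Rightarrow>\<^sub>0 'k::field) set \<Rightarrow> bool" where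
  "fin_sub X \<longleftrightarrow> fs.subspace X \<and> (\<exists>W. finite W \<and> X \<subseteq> fs.span W)"

lemma fin_sub_subset: "fin_sub X \<Longrightarrow> fs.subspace Y \<Longrightarrow> Y \<subseteq> X \<Longrightarrow> fin_sub Y"
  by (auto simp: fin_sub_def)

lemma fin_sub_free_module: "finite B \<Longrightarrow> fin_sub (free_module B)"
  unfolding fin_sub_def
  by (auto intro!: exI[of _ "(\<lambda>b. sng b 1) ` B"] simp: subspace_free_module free_module_eq_span)

lemma fin_sub_basis:
  assumes "fin_sub X"
  obtains b where "finite b" "b \<subseteq> X" "fs.independent b" "X = fs.span b" "card b = fs.dim X"
proof -
  obtain W where W: "finite W" "X \<subseteq> fs.span W" "fs.subspace X"
    using assms by (auto simp: fin_sub_def)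
  obtain b where b: "b \<subseteq> X" "fs.independent b" "X \<subseteq> fs.span b" "card b = fs.dim X"
    using fs.basis_exists[of X] by blast
  moreover have "finite b" using fs.independent_span_bound[OF W(1) b(2)] b W by auto
  moreover have "X = fs.span b" using fs.span_subspace[OF b(1,3) W(3)] by simp
  ultimately show ?thesis using that by blast
qed

lemma dim_mono_fin:
  assumes "fin_sub Y" "X \<subseteq> Y"
  shows "fs.dim X \<le> fs.dim Y"
proof -
  obtain b where "finite b" "Y = fs.span b" "card b = fs.dim Y"
    using fin_sub_basis[OF assms(1)] by blast
  then show ?thesis using fs.dim_le_card[of X b] assms(2) by simp
qed

text \<open>Rank and nullity relative to a finite-dimensional subspace: a basis \<open>c\<close> of
  the kernel is extended to a basis \<open>b\<close> of \<open>X\<close>, and \<open>f\<close> maps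
  the added vectors injectively to a basis of the image.\<close>

lemma dim_image_ker:
  fixes f :: "('b \<Rightarrow>\<^sub>0 'k::field) \<Rightarrow> ('c \<Rightarrow>\<^sub>0 'k)"
  assumes X: "fin_sub X" and f: "linear_map f"
  shows "fs.dim X = fs.dim (f ` X) + fs.dim {x \<in> X. f x = 0}"
proof -
  interpret f: Vector_Spaces.linear "fscale :: 'k \<Rightarrow> ('b \<Rightarrow>\<^sub>0 'k) \<Rightarrow> _" "fscale :: 'k \<Rightarrow> ('c \<Rightarrow>\<^sub>0 'k) \<Rightarrow> _" f
    by (rule f)
  define K where "K = {x \<in> X. f x = 0}"
  have subX: "fs.subspace X" using X by (simp add: fin_sub_def)
  have "K = X \<inter> {x. f x = 0}" by (auto simp: K_def)
  then have subK: "fs.subspace K" using subX f.subspace_kernel fs.subspace_inter by metis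
  then have "fin_sub K" using X by (auto intro: fin_sub_subset simp: K_def)
  then obtain c where c: "finite c" "c \<subseteq> K" "fs.independent c" "K = fs.span c" "card c = fs.dim K"
    by (rule fin_sub_basis)
  have "c \<subseteq> X" using c by (auto simp: K_def)
  then obtain b where b: "c \<subseteq> b" "b \<subseteq> X" "fs.independent b" "X \<subseteq> fs.span b"
    using fs.maximal_independent_subset_extend[of c X] c by blast
  obtain W where W: "finite W" "X \<subseteq> fs.span W" using X by (auto simp: fin_sub_def)
  have finb: "finite b" using fs.independent_span_bound[OF W(1) b(3)] b W by auto
  have inj0: "x = 0" if x: "x \<in> fs.span (b - c)" "f x = 0" for x
  proof -
    have "fs.span (b - c) \<subseteq> X" using b subX by (intro fs.span_minimal) auto
    then have xX: "x \<in> X" using x by blast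
    then have xc: "x \<in> fs.span c" using x c(4) by (auto simp: K_def)
    have ind: "fs.independent (b - c)" using b(3) fs.independent_mono by blast
    \<comment> \<open>\<open>x\<close> lies in the spans of both \<open>b - c\<close> and
      \<open>c\<close>; the first makes its coordinates vanish on \<open>c\<close>, the second off
      \<open>c\<close>.\<close>
    have "fs.representation b x v = 0" for v
    proof (cases "v \<in> c")
      case True
      have "fs.representation b x = fs.representation (b - c) x"
        using fs.representation_extend[of b x "b - c"] b x by auto
      then show ?thesis using True fs.representation_ne_zero[of "b - c" x v] by auto
    next
      case False
      have "fs.representation b x = fs.representation c x"
        using fs.representation_extend[of b x c] b xc by auto
      then show ?thesis using False fs.representation_ne_zero[of c x v] by auto
    qed
    then show ?thesis
      using fs.sum_representation_eq[of b x b] b finb xX by auto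
  qed
  then have inj: "inj_on f (fs.span (b - c))"
    using f.inj_on_iff_eq_0[of "fs.span (b - c)"] by auto
  have ind: "fs.independent (f ` (b - c))"
    using f.independent_injective_image[OF fs.independent_mono[OF b(3)], of "b - c"] inj by auto
  have span: "f ` X \<subseteq> fs.span (f ` (b - c))"
  proof -
    have "f v \<in> fs.span (f ` (b - c))" if "v \<in> b" for v
    proof (cases "v \<in> c")
      case True
      then have "f v = 0" using c by (auto simp: K_def)
      then show ?thesis by (simp add: fs.span_zero)
    qed (use that in \<open>auto intro: fs.span_base\<close>)
    then have "fs.span (f ` b) \<subseteq> fs.span (f ` (b - c))"
      by (intro fs.span_minimal) auto
    moreover have "f ` X \<subseteq> fs.span (f ` b)" using b by (intro f.spans_image) auto
    ultimately show ?thesis by blast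
  qed
  have "fs.dim (f ` X) = card (f ` (b - c))"
    using fs.basis_card_eq_dim[OF _ span ind] b(2) by (metis Diff_subset image_mono order_trans)
  also have "\<dots> = card (b - c)"
    using inj by (intro card_image) (meson inj_on_subset fs.span_superset)
  also have "\<dots> = card b - card c" using b c by (intro card_Diff_subset) auto
  finally have "fs.dim (f ` X) = card b - card c" .
  moreover have "card b = fs.dim X" using fs.basis_card_eq_dim b by blast
  moreover have "card c \<le> card b" using b finb by (intro card_mono) auto
  ultimately show ?thesis using c(5) by (simp add: K_def)
qed

lemma subspace_image_lin:
  fixes f :: "('b \<Rightarrow>\<^sub>0 'k::field) \<Rightarrow> ('c \<Rightarrow>\<^sub>0 'k)"
  assumes "linear_map f" "fs.subspace X"
  shows "fs.subspace (f ` X)"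
proof -
  interpret f: Vector_Spaces.linear "fscale :: 'k \<Rightarrow> ('b \<Rightarrow>\<^sub>0 'k) \<Rightarrow> _" "fscale :: 'k \<Rightarrow> ('c \<Rightarrow>\<^sub>0 'k) \<Rightarrow> _" f
    by (rule assms(1))
  show ?thesis using assms(2) by (rule f.subspace_image)
qed

lemma subspace_ker_lin:
  fixes f :: "('b \<Rightarrow>\<^sub>0 'k::field) \<Rightarrow> ('c \<Rightarrow>\<^sub>0 'k)"
  assumes "linear_map f" "fs.subspace X"
  shows "fs.subspace {x \<in> X. f x = 0}"
proof -
  interpret f: Vector_Spaces.linear "fscale :: 'k \<Rightarrow> ('b \<Rightarrow>\<^sub>0 'k) \<Rightarrow> _" "fscale :: 'k \<Rightarrow> ('c \<Rightarrow>\<^sub>0 'k) \<Rightarrow> _" f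
    by (rule assms(1))
  have "{x \<in> X. f x = 0} = X \<inter> {x. f x = 0}" by auto
  then show ?thesis using fs.subspace_inter[OF assms(2) f.subspace_kernel] by simp
qed

lemma fin_sub_image:
  fixes f :: "('b \<Rightarrow>\<^sub>0 'k::field) \<Rightarrow> ('c \<Rightarrow>\<^sub>0 'k)"
  assumes "fin_sub X" "linear_map f"
  shows "fin_sub (f ` X)"
proof -
  interpret f: Vector_Spaces.linear "fscale :: 'k \<Rightarrow> ('b \<Rightarrow>\<^sub>0 'k) \<Rightarrow> _" "fscale :: 'k \<Rightarrow> ('c \<Rightarrow>\<^sub>0 'k) \<Rightarrow> _" f
    by fact
  obtain W where "finite W" "X \<subseteq> fs.span W" using assms by (auto simp: fin_sub_def)
  then have "finite (f ` W)" "f ` X \<subseteq> fs.span (f ` W)" by (auto intro!: f.spans_image)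
  then show ?thesis using assms by (auto simp: fin_sub_def intro!: f.subspace_image)
qed

lemma fin_sub_ker:
  assumes "fin_sub X" "linear_map f"
  shows "fin_sub {x \<in> X. f x = 0}"
  using assms subspace_ker_lin by (intro fin_sub_subset[OF assms(1)]) (auto simp: fin_sub_def)

text \<open>Both sides are \<open>dim X - dim (ker f + ker g)\<close>: this is one step of the zigzag that
  identifies the homologies of the two edges of a double complex.\<close>

lemma zigzag_step:
  fixes f :: "('b \<Rightarrow>\<^sub>0 'k::field) \<Rightarrow> ('c \<Rightarrow>\<^sub>0 'k)" and g :: "('b \<Rightarrow>\<^sub>0 'k) \<Rightarrow> ('d \<Rightarrow>\<^sub>0 'k)"
  assumes X: "fin_sub X" and f: "linear_map f"
    and g: "linear_map g"
  shows "fs.dim (f ` X) - fs.dim (f ` {x \<in> X. g x = 0}) =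
         fs.dim (g ` X) - fs.dim (g ` {x \<in> X. f x = 0})"
proof -
  define a where "a = fs.dim {x \<in> {x \<in> X. g x = 0}. f x = 0}"
  have a: "a = fs.dim {x \<in> {x \<in> X. f x = 0}. g x = 0}"
    unfolding a_def by (intro arg_cong[where f = fs.dim]) auto
  show ?thesis
    using dim_image_ker[OF X f] dim_image_ker[OF X g]
      dim_image_ker[OF fin_sub_ker[OF X g] f, folded a_def]
      dim_image_ker[OF fin_sub_ker[OF X f] g, folded a]
    by linarith
qed

lemma dim_image_inj:
  assumes "fin_sub X" "linear_map f" "\<And>x. x \<in> X \<Longrightarrow> f x = 0 \<Longrightarrow> x = 0"
  shows "fs.dim (f ` X) = fs.dim X"
proof -
  have "{x \<in> X. f x = 0} \<subseteq> fs.span {}" using assms(3) by auto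
  then have "fs.dim {x \<in> X. f x = 0} = 0" using fs.dim_le_card[of "{x \<in> X. f x = 0}" "{}"] by auto
  then show ?thesis using dim_image_ker[OF assms(1,2)] by simp
qed

lemma dim_free_module: 
  assumes "finite B" shows "fs.dim (free_module B :: ('b \<Rightarrow>\<^sub>0 'k::field) set) = card B"
proof -
  let ?e = "\<lambda>b. sng b (1::'k)"
  have inj: "inj_on ?e B" 
    by (rule inj_onI) (metis lookup_single_eq lookup_single_not_eq zero_neq_one)
  have "fs.independent (?e ` B)"
    unfolding fs.independent_explicit_module
  proof (intro allI impI)
    fix t u v assume t: "finite t" "t \<subseteq> ?e ` B" "(\<Sum>v\<in>t. fscale (u v) v) = 0" "v \<in> t"
    then obtain b where b: "v = ?e b" by auto
    have "0 = lkp (\<Sum>v\<in>t. fscale (u v) v) b" using t by simp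
    also have "\<dots> = (\<Sum>w\<in>t. if w = v then u v else 0)"
      unfolding lookup_sum lookup_fscale
    proof (intro sum.cong refl)
      fix w assume "w \<in> t"
      then obtain c where "w = ?e c" using t(2) by auto
      then show "u w * lkp w b = (if w = v then u v else 0)"
        by (cases "c = b") (auto simp: b lookup_single_not_eq dest: arg_cong[of _ _ "\<lambda>z. lkp z b"])
    qed
    finally show "u v = 0" using t by simp
  qed
  then show ?thesis
    unfolding free_module_eq_span using fs.dim_span_eq_card_independent card_image[OF inj] by metis
qed

text \<open>Pure rank count: injectivity gives \<open>f\<close> rank at least \<open>card A\<close>
  and \<open>g\<close> rank at least \<open>card (B - A)\<close>. Hence the kernel of
  \<open>f\<close> is no larger than the image of \<open>g\<close>, and the truncated difference is
  0.\<close>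

lemma homology_dim_eq_0:
  fixes f :: "('b \<Rightarrow>\<^sub>0 'k::field) \<Rightarrow> ('c \<Rightarrow>\<^sub>0 'k)" and g :: "('a \<Rightarrow>\<^sub>0 'k) \<Rightarrow> ('b \<Rightarrow>\<^sub>0 'k)"
  assumes fin: "finite B" "finite B'" and sub: "A \<subseteq> B" "A' \<subseteq> B'"
    and card: "card A' = card (B - A)"
    and lin: "linear_map f" "linear_map g"
    and inj: "\<And>x. x \<in> free_module A \<Longrightarrow> f x = 0 \<Longrightarrow> x = 0"
      "\<And>x. x \<in> free_module A' \<Longrightarrow> g x = 0 \<Longrightarrow> x = 0"
  shows "homology_dim (free_module B) f (free_module B') g = 0"
proof -
  have finA: "finite A" "finite A'" using fin sub finite_subset by auto
  have "card A = fs.dim (f ` free_module A)"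
    using dim_image_inj[OF fin_sub_free_module lin(1) inj(1)] finA by (simp add: dim_free_module)
  also have "\<dots> \<le> fs.dim (f ` free_module B)"
    using fin_sub_image[OF fin_sub_free_module lin(1)] fin sub free_module_mono[of A B]
    by (intro dim_mono_fin) auto
  finally have 1: "card A \<le> fs.dim (f ` free_module B)" .
  have "card A' = fs.dim (g ` free_module A')"
    using dim_image_inj[OF fin_sub_free_module lin(2) inj(2)] finA by (simp add: dim_free_module)
  also have "\<dots> \<le> fs.dim (g ` free_module B')"
    using fin_sub_image[OF fin_sub_free_module lin(2)] fin sub free_module_mono[of A' B']
    by (intro dim_mono_fin) auto
  finally have 2: "card A' \<le> fs.dim (g ` free_module B')" .
  have "card (B - A) = card B - card A" using finA sub by (simp add: card_Diff_subset)
  then show ?thesis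
    using dim_image_ker[OF fin_sub_free_module[OF fin(1)] lin(1)] 1 2 card
    by (simp add: homology_dim_def dim_free_module fin)
qed

section \<open>Homogeneous elements\<close>

abbreviation vle :: "'n mdeg \<Rightarrow> 'n mdeg \<Rightarrow> bool" where "vle a b \<equiv> nonneg_vec (b - a)"

lemma lookup_int_vec: "lkp (int_vec u) i = int (lkp u i)"
  by (simp add: int_vec_def map.rep_eq when_def)

lemma lookup_nat_vec: "lkp (nat_vec a) i = nat (lkp a i)"
  by (simp add: nat_vec_def map.rep_eq when_def)

lemma nat_int_vec [simp]: "nat_vec (int_vec u) = u"
  by (rule poly_mapping_eqI) (simp add: lookup_int_vec lookup_nat_vec)

lemma int_nat_vec [simp]: "nonneg_vec a \<Longrightarrow> int_vec (nat_vec a) = a"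
  by (rule poly_mapping_eqI) (simp add: lookup_int_vec lookup_nat_vec nonneg_vec_def)

lemma nonneg_int_vec [simp]: "nonneg_vec (int_vec u)"
  by (simp add: nonneg_vec_def lookup_int_vec)

lemma int_vec_add: "int_vec (u + v) = int_vec u + int_vec v"
  by (rule poly_mapping_eqI) (simp add: lookup_int_vec lookup_add)

lemma int_vec_0 [simp]: "int_vec 0 = 0"
  by (rule poly_mapping_eqI) (simp add: lookup_int_vec)

lemma nat_vec_0 [simp]: "nat_vec 0 = 0"
  by (rule poly_mapping_eqI) (simp add: lookup_nat_vec)

lemma vle_iff: "vle a b \<longleftrightarrow> (\<forall>i. lkp a i \<le> lkp b i)"
  by (simp add: nonneg_vec_def lookup_minus)

lemma vle_refl [simp]: "vle a a" unfolding vle_iff by simp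

lemma vle_trans: "vle a b \<Longrightarrow> vle b c \<Longrightarrow> vle a c"
  unfolding vle_iff using order_trans by blast

lemma vle_antisym: "vle a b \<Longrightarrow> vle b a \<Longrightarrow> a = b"
  unfolding vle_iff by (rule poly_mapping_eqI) (simp add: order_antisym)

text \<open>Passage from coordinates in degree \<open>a\<close> to a homogeneous polynomial vector.
  Since \<open>nat_vec\<close> truncates negative entries, the result has degree \<open>a\<close>
  only for vectors supported where \<open>g b \<le> a\<close>; this is the recurring side condition
  below.\<close>

definition homog :: "('b \<Rightarrow> 'n mdeg) \<Rightarrow> 'n mdeg \<Rightarrow> ('b \<Rightarrow>\<^sub>0 'k::comm_ring_1) \<Rightarrow> ('b \<Rightarrow>\<^sub>0 ('n, 'k) mpoly)" where
  "homog g a x = Poly_Mapping.mapp (\<lambda>b c. sng (nat_vec (a - g b)) c) x"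

text \<open>The coordinates of the homogeneous component of degree \<open>a\<close>. The guard
  prevents a truncated exponent from picking up a coefficient of another degree.\<close>

definition gcomp :: "('b \<Rightarrow> 'n mdeg) \<Rightarrow> 'n mdeg \<Rightarrow> ('b \<Rightarrow>\<^sub>0 ('n, 'k::comm_ring_1) mpoly) \<Rightarrow> ('b \<Rightarrow>\<^sub>0 'k)" where
  "gcomp g a p = Poly_Mapping.mapp (\<lambda>b q. lkp q (nat_vec (a - g b)) when vle (g b) a) p"

lemma lookup_homog: "lkp (homog g a x) b = sng (nat_vec (a - g b)) (lkp x b)"
  by (auto simp: homog_def Poly_Mapping.lookup_mapp when_def in_keys_iff)

lemma lookup_gcomp: "lkp (gcomp g a p) b = (lkp (lkp p b) (nat_vec (a - g b)) when vle (g b) a)"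
  by (auto simp: gcomp_def Poly_Mapping.lookup_mapp when_def in_keys_iff)

lemma homog_0 [simp]: "homog g a 0 = 0"
  by (rule poly_mapping_eqI) (simp add: lookup_homog)

lemma homog_add: "homog g a (x + y) = homog g a x + homog g a y"
  by (rule poly_mapping_eqI) (simp add: lookup_homog lookup_add single_add)

lemma homog_diff: "homog g a (x - y) = homog g a x - homog g a y"
  by (rule poly_mapping_eqI) (simp add: lookup_homog lookup_minus single_diff)

lemma homog_sum: "homog g a (sum f I) = (\<Sum>i\<in>I. homog g a (f i))"
  by (induction I rule: infinite_finite_induct) (auto simp: homog_add)

lemma homog_single: "homog g a (sng b c) = sng b (sng (nat_vec (a - g b)) c)"
  by (rule poly_mapping_eqI) (auto simp: lookup_homog lookup_single when_def)

lemma gcomp_0 [simp]: "gcomp g a 0 = 0"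
  by (rule poly_mapping_eqI) (simp add: lookup_gcomp)

lemma gcomp_add: "gcomp g a (x + y) = gcomp g a x + gcomp g a y"
  by (rule poly_mapping_eqI) (simp add: lookup_gcomp lookup_add when_add_distrib)

lemma gcomp_diff: "gcomp g a (x - y) = gcomp g a x - gcomp g a y"
  by (rule poly_mapping_eqI) (simp add: lookup_gcomp lookup_minus when_diff_distrib)

lemma gcomp_single:
  "gcomp g a (sng b (sng u c)) = (sng b c when a = int_vec u + g b)"
proof (rule poly_mapping_eqI)
  fix b'
  have "u = nat_vec (a - g b) \<longleftrightarrow> a = int_vec u + g b" if "vle (g b) a"
    using that by (metis add_diff_cancel_right' diff_add_cancel int_nat_vec nat_int_vec)
  moreover have "vle (g b) a" if "a = int_vec u + g b" using that by simp
  ultimately show "lkp (gcomp g a (sng b (sng u c))) b' = lkp (sng b c when a = int_vec u + g b) b'"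
    by (auto simp: lookup_gcomp lookup_single when_def)
qed

lemma gcomp_homog:
  assumes "x \<in> free_module {b. vle (g b) a}"
  shows "gcomp g a' (homog g a x) = (x when a' = a)"
proof (rule poly_mapping_eqI)
  fix b
  show "lkp (gcomp g a' (homog g a x)) b = lkp (x when a' = a) b"
  proof (cases "lkp x b = 0")
    case False
    then have "vle (g b) a" using in_free_moduleD[OF assms] by blast
    then have "nat_vec (a - g b) = nat_vec (a' - g b) \<longleftrightarrow> a' = a" if "vle (g b) a'"
      using that by (metis diff_add_cancel int_nat_vec)
    then show ?thesis using \<open>vle (g b) a\<close>
      by (auto simp: lookup_gcomp lookup_homog lookup_single when_def)
  qed (auto simp: lookup_gcomp lookup_homog when_def)
qed

lemma homog_in_free_comp:
  assumes "x \<in> free_module {b \<in> B. vle (g b) a}"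
  shows "homog g a x \<in> free_comp B g a"
proof -
  have "homog g a x \<in> free_module B"
  proof (rule in_free_moduleI)
    fix b assume "lkp (homog g a x) b \<noteq> 0"
    then have "lkp x b \<noteq> 0" unfolding lookup_homog by (metis single_zero)
    then show "b \<in> B" using in_free_moduleD[OF assms] by blast
  qed
  moreover have "int_vec u + g b = a" if "lkp (lkp (homog g a x) b) u \<noteq> 0" for b u
    using that in_free_moduleD[OF assms, of b]
    by (auto simp: lookup_homog lookup_single when_def split: if_splits)
  ultimately show ?thesis by (auto simp: free_comp_def)
qed

lemma gcomp_in:
  assumes "f \<in> free_module B"
  shows "gcomp g a f \<in> free_module {b \<in> B. vle (g b) a}"
proof (rule in_free_moduleI)
  fix b assume *: "lkp (gcomp g a f) b \<noteq> 0"
  then have "vle (g b) a" "lkp f b \<noteq> 0" by (auto simp: lookup_gcomp)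
  then show "b \<in> {b \<in> B. vle (g b) a}" using in_free_moduleD[OF assms] by blast
qed

lemma homog_gcomp:
  assumes "f \<in> free_comp B g a"
  shows "homog g a (gcomp g a f) = f"
proof (rule poly_mapping_eqI, rule poly_mapping_eqI)
  fix b u
  have *: "int_vec v + g b = a" if "lkp (lkp f b) v \<noteq> 0" for v
    using assms that by (auto simp: free_comp_def)
  show "lkp (lkp (homog g a (gcomp g a f)) b) u = lkp (lkp f b) u"
  proof (cases "lkp (lkp f b) u = 0")
    case True
    then show ?thesis by (auto simp: lookup_homog lookup_gcomp lookup_single when_def)
  next
    case False
    then have "a - g b = int_vec u" using *[of u] by (metis add_diff_cancel_right')
    then show ?thesis by (auto simp: lookup_homog lookup_gcomp)
  qed
qed

lemma poly_vector_induct [consumes 1, case_names zero add single]: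
  assumes "p \<in> free_module B"
    and "P 0" "\<And>x y. P x \<Longrightarrow> P y \<Longrightarrow> P (x + y)" "\<And>b u c. b \<in> B \<Longrightarrow> P (sng b (sng u c))"
  shows "P (p :: 'b \<Rightarrow>\<^sub>0 ('v \<Rightarrow>\<^sub>0 'k::comm_ring_1))"
proof -
  have sum1: "P (sum f I)" if "\<And>i. i \<in> I \<Longrightarrow> P (f i)" for I :: "'b set" and f
    using that by (induction I rule: infinite_finite_induct) (auto intro: assms)
  have sum2: "P (sum f I)" if "\<And>i. i \<in> I \<Longrightarrow> P (f i)" for I :: "'v set" and f
    using that by (induction I rule: infinite_finite_induct) (auto intro: assms)
  have single_sum: "sng b (sum f I) = (\<Sum>i\<in>I. sng b (f i))" for b :: 'b and f :: "'v \<Rightarrow> ('v \<Rightarrow>\<^sub>0 'k)" and I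
    by (induction I rule: infinite_finite_induct) (auto simp: single_add)
  have "P (\<Sum>b\<in>supp p. \<Sum>u\<in>supp (lkp p b). sng b (sng u (lkp (lkp p b) u)))"
    using assms(1) by (auto intro!: sum1 sum2 assms(4) simp: free_module_def)
  then show ?thesis by (simp flip: single_sum add: sum_single)
qed

text \<open>Homogeneous maps between graded free modules are encoded by scalar matrices that do not depend
  on the degree: \<open>m\<close> encodes the map given by \<open>D\<close>.\<close>

definition encodes :: "'b set \<Rightarrow> ('b \<Rightarrow> 'n mdeg) \<Rightarrow> ('c \<Rightarrow> 'n mdeg) \<Rightarrow>
    ('b \<Rightarrow> ('c \<Rightarrow>\<^sub>0 'k::comm_ring_1)) \<Rightarrow> ('b \<Rightarrow> ('c \<Rightarrow>\<^sub>0 ('n, 'k) mpoly)) \<Rightarrow> bool" where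
  "encodes B g h m D \<longleftrightarrow>
     (\<forall>b\<in>B. D b = homog h (g b) (m b) \<and> m b \<in> free_module {c. vle (h c) (g b)})"

text \<open>In coordinates, multiplication by a monomial changes the degree and leaves the vector
  alone. This is why one scalar matrix describes a homogeneous map in all degrees.\<close>

lemma fscale_homog:
  assumes "x \<in> free_module {b. vle (g b) a}"
  shows "fscale (sng u c) (homog g a x) = homog g (int_vec u + a) (fscale c x)"
proof (rule poly_mapping_eqI)
  fix b
  have *: "u + nat_vec (a - g b) = nat_vec (int_vec u + a - g b)" if "vle (g b) a"
  proof -
    have "int_vec (u + nat_vec (a - g b)) = int_vec u + a - g b"
      using that by (simp add: int_vec_add)
    then show ?thesis by (metis nat_int_vec)
  qed
  show "lkp (fscale (sng u c) (homog g a x)) b = lkp (homog g (int_vec u + a) (fscale c x)) b"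
    using * in_free_moduleD[OF assms, of b]
    by (cases "lkp x b = 0") (auto simp: lookup_fscale lookup_homog mult_single)
qed

lemma encodes_single:
  assumes "encodes B g h m D" "b \<in> B"
  shows "lin_ext D (sng b (sng u c)) = homog h (int_vec u + g b) (fscale c (m b))"
  using assms by (simp add: encodes_def fscale_homog)

lemma encodes_homog:
  assumes "encodes B g h m D" "x \<in> free_module {b \<in> B. vle (g b) a}"
  shows "lin_ext D (homog g a x) = homog h a (lin_ext m x)"
proof -
  have "lin_ext D (homog g a x) = (\<Sum>b\<in>supp x. lin_ext D (homog g a (sng b (lkp x b))))"
    using arg_cong[OF sum_single[of x], of "\<lambda>x. lin_ext D (homog g a x)"]
    by (simp add: homog_sum lin_ext_sum)
  also have "\<dots> = (\<Sum>b\<in>supp x. homog h a (fscale (lkp x b) (m b)))"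
  proof (rule sum.cong)
    fix b assume "b \<in> supp x"
    then have "b \<in> B" "vle (g b) a" using assms(2) by (auto simp: free_module_def)
    then show "lin_ext D (homog g a (sng b (lkp x b))) = homog h a (fscale (lkp x b) (m b))"
      unfolding homog_single encodes_single[OF assms(1) \<open>b \<in> B\<close>] by simp
  qed simp
  finally show ?thesis by (simp add: lin_ext_def homog_sum)
qed

lemma encodes_gcomp:
  assumes "encodes B g h m D" "p \<in> free_module B"
  shows "gcomp h a (lin_ext D p) = lin_ext m (gcomp g a p)"
  using assms(2)
proof (induction p rule: poly_vector_induct)
  case (single b u c)
  have "m b \<in> free_module {c. vle (h c) (g b)}" using assms(1) single by (auto simp: encodes_def)
  have **: "vle (h d) (int_vec u + g b)" if "vle (h d) (g b)" for d
    using vle_trans[OF that, of "int_vec u + g b"] by simp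
  have *: "fscale c (m b) \<in> free_module {c. vle (h c) (int_vec u + g b)}"
    using \<open>m b \<in> free_module {c. vle (h c) (g b)}\<close> **
    by (intro free_module_scale) (auto simp only: free_module_def)
  show ?case
    unfolding encodes_single[OF assms(1) single] gcomp_homog[OF *] gcomp_single
    by (simp add: when_def)
qed (auto simp: gcomp_add lin_ext_add)

lemma lin_ext_matrix_in:
  assumes "encodes B g h m D" "x \<in> free_module {b \<in> B. vle (g b) a}"
  shows "lin_ext m x \<in> free_module {c. vle (h c) a}"
proof (rule lin_ext_in_free_module)
  fix b assume "b \<in> supp x"
  then have b: "b \<in> B" "vle (g b) a" using assms(2) by (auto simp: free_module_def)
  then have "m b \<in> free_module {c. vle (h c) (g b)}" using assms(1) by (simp add: encodes_def)
  then show "m b \<in> free_module {c. vle (h c) a}"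
    using free_module_mono[of "{c. vle (h c) (g b)}" "{c. vle (h c) a}"] vle_trans[OF _ b(2)] by blast
qed

lemma encodes_free_comp:
  assumes "\<And>b. b \<in> B \<Longrightarrow> D b \<in> free_comp C h (g b)"
  shows "encodes B g h (\<lambda>b. gcomp h (g b) (D b)) D"
    and "b \<in> B \<Longrightarrow> gcomp h (g b) (D b) \<in> free_module {c \<in> C. vle (h c) (g b)}"
proof -
  show *: "gcomp h (g b) (D b) \<in> free_module {c \<in> C. vle (h c) (g b)}" if "b \<in> B" for b
    using assms[OF that] by (intro gcomp_in) (auto simp: free_comp_def)
  show "encodes B g h (\<lambda>b. gcomp h (g b) (D b)) D"
    unfolding encodes_def
  proof (intro ballI conjI)
    fix b assume "b \<in> B"
    show "gcomp h (g b) (D b) \<in> free_module {c. vle (h c) (g b)}"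
      using *[OF \<open>b \<in> B\<close>] free_module_mono[of "{c \<in> C. vle (h c) (g b)}" "{c. vle (h c) (g b)}"] by blast
  qed (simp add: homog_gcomp[OF assms])
qed

lemma homog_expansion:
  fixes p :: "'b \<Rightarrow>\<^sub>0 ('n, 'k::comm_ring_1) mpoly" and g :: "'b \<Rightarrow> 'n mdeg"
  defines "S \<equiv> (\<lambda>(b, u). int_vec u + g b) ` (SIGMA b:supp p. supp (lkp p b))"
  shows "finite S" "p = (\<Sum>a\<in>S. homog g a (gcomp g a p))"
proof -
  show fin: "finite S" by (simp add: S_def)
  show "p = (\<Sum>a\<in>S. homog g a (gcomp g a p))"
  proof (rule poly_mapping_eqI, rule poly_mapping_eqI)
    fix b v
    have "lkp (lkp (homog g a (gcomp g a p)) b) v = (if a = int_vec v + g b then lkp (lkp p b) v else 0)" for a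
    proof (cases "vle (g b) a")
      case True
      then have "nat_vec (a - g b) = v \<longleftrightarrow> a = int_vec v + g b"
        by (metis add_diff_cancel_right' diff_add_cancel int_nat_vec nat_int_vec)
      with True show ?thesis by (auto simp: lookup_homog lookup_gcomp lookup_single when_def)
    next
      case False
      then have "a \<noteq> int_vec v + g b" by auto
      with False show ?thesis by (auto simp: lookup_homog lookup_gcomp)
    qed
    then have "lkp (lkp (\<Sum>a\<in>S. homog g a (gcomp g a p)) b) v =
        (if int_vec v + g b \<in> S then lkp (lkp p b) v else 0)"
      using fin by (simp add: lookup_sum)
    also have "\<dots> = lkp (lkp p b) v"
      by (force simp: S_def in_keys_iff)
    finally show "lkp (lkp p b) v = lkp (lkp (\<Sum>a\<in>S. homog g a (gcomp g a p)) b) v" ..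
  qed
qed

text \<open>Homogeneous maps commute with taking components, which gives the direction from
  polynomials to degrees. Conversely, the finitely many components of \<open>f\<close> get preimages
  one by one, and these are added up.\<close>

lemma exact_iff_degreewise:
  assumes D: "encodes B g h m D" and E: "encodes C e g m' E"
    and sub: "\<And>c. c \<in> C \<Longrightarrow> E c \<in> free_module B" "\<And>c. c \<in> C \<Longrightarrow> m' c \<in> free_module B"
  shows "{f \<in> free_module B. lin_ext D f = 0} = lin_ext E ` free_module C \<longleftrightarrow>
    (\<forall>a. {x \<in> free_module {b \<in> B. vle (g b) a}. lin_ext m x = 0} =
          lin_ext m' ` free_module {c \<in> C. vle (e c) a})" (is "?P \<longleftrightarrow> ?Q")
proof -
  have into: "lin_ext m' y \<in> free_module {b \<in> B. vle (g b) a}"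
    if "y \<in> free_module {c \<in> C. vle (e c) a}" for y a
  proof -
    have "lin_ext m' y \<in> free_module B"
      using that by (intro lin_ext_in_free_module sub(2)) (auto simp: free_module_def)
    with lin_ext_matrix_in[OF E that] show ?thesis by (auto simp: free_module_def)
  qed
  have homog_in: "homog g a x \<in> free_module B" if "x \<in> free_module {b \<in> B. vle (g b) a}" for a x
    using homog_in_free_comp[OF that] by (simp add: free_comp_def)
  have homog_in_C: "homog e a x \<in> free_module C" if "x \<in> free_module {b \<in> C. vle (e b) a}" for a x
    using homog_in_free_comp[OF that] by (simp add: free_comp_def)
  have gh: "gcomp h a (homog h a (lin_ext m x)) = lin_ext m x"
    if "x \<in> free_module {b \<in> B. vle (g b) a}" for a x
    using gcomp_homog[OF lin_ext_matrix_in[OF D that]] by simp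
  have 1: ?Q if ?P
    proof (intro allI Set.set_eqI iffI)
      fix a x assume x: "x \<in> {x \<in> free_module {b \<in> B. vle (g b) a}. lin_ext m x = 0}"
      then have "lin_ext D (homog g a x) = 0"
        using encodes_homog[OF D, of x a] by simp
      then obtain z where z: "z \<in> free_module C" "homog g a x = lin_ext E z"
        using \<open>?P\<close> homog_in[of x a] x by blast
      have "x \<in> free_module {b. vle (g b) a}" using x by (auto simp: free_module_def)
      then have "x = gcomp g a (homog g a x)" by (simp add: gcomp_homog)
      also have "\<dots> = lin_ext m' (gcomp e a z)"
        unfolding z(2) by (rule encodes_gcomp[OF E z(1)])
      finally show "x \<in> lin_ext m' ` free_module {c \<in> C. vle (e c) a}"
        using gcomp_in[OF z(1)] by blast
    next
      fix a x assume "x \<in> lin_ext m' ` free_module {c \<in> C. vle (e c) a}"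
      then obtain y where y: "y \<in> free_module {c \<in> C. vle (e c) a}" "x = lin_ext m' y" by blast
      have "lin_ext E (homog e a y) \<in> {f \<in> free_module B. lin_ext D f = 0}"
        using \<open>?P\<close> homog_in_C[OF y(1)] by blast
      then have "homog h a (lin_ext m x) = 0"
        using encodes_homog[OF D into[OF y(1)]] encodes_homog[OF E y(1)] y(2) by simp
      then have "lin_ext m x = 0" using gh[OF into[OF y(1)]] y(2) by simp
      then show "x \<in> {x \<in> free_module {b \<in> B. vle (g b) a}. lin_ext m x = 0}"
        using into[OF y(1)] y(2) by simp
    qed
  have 2: ?P if Q: ?Q
  proof (intro Set.set_eqI iffI)
    fix f assume "f \<in> {f \<in> free_module B. lin_ext D f = 0}"
    then have f: "f \<in> free_module B" "lin_ext D f = 0" by auto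
    have "\<exists>y \<in> free_module {c \<in> C. vle (e c) a}. gcomp g a f = lin_ext m' y" for a
    proof -
      have "lin_ext m (gcomp g a f) = 0" using encodes_gcomp[OF D f(1), of a] f(2) by simp
      then show ?thesis using Q gcomp_in[OF f(1)] by blast
    qed
    then obtain y where y: "\<And>a. y a \<in> free_module {c \<in> C. vle (e c) a}" "\<And>a. gcomp g a f = lin_ext m' (y a)"
      by metis
    obtain S where S: "f = (\<Sum>a\<in>S. homog g a (gcomp g a f))" using homog_expansion(2) by blast
    also have "\<dots> = (\<Sum>a\<in>S. lin_ext E (homog e a (y a)))"
      by (intro sum.cong refl) (simp only: encodes_homog[OF E y(1)] y(2))
    also have "\<dots> = lin_ext E (\<Sum>a\<in>S. homog e a (y a))" by (simp add: lin_ext_sum)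
    finally have "f = lin_ext E (\<Sum>a\<in>S. homog e a (y a))" .
    then show "f \<in> lin_ext E ` free_module C"
      by (rule image_eqI) (intro free_module_sum homog_in_C y)
  next
    fix f assume "f \<in> lin_ext E ` free_module C"
    then obtain z where z: "z \<in> free_module C" "f = lin_ext E z" by blast
    have fB: "f \<in> free_module B" unfolding z(2)
      using z(1) by (intro lin_ext_in_free_module sub) (auto simp: free_module_def)
    have "gcomp h a (lin_ext D f) = 0" for a
    proof -
      have "gcomp g a f = lin_ext m' (gcomp e a z)" unfolding z(2) by (rule encodes_gcomp[OF E z(1)])
      moreover have "lin_ext m (lin_ext m' (gcomp e a z)) = 0" using Q gcomp_in[OF z(1)] by blast
      ultimately show ?thesis using encodes_gcomp[OF D fB, of a] by simp
    qed
    then have "lin_ext D f = 0" using homog_expansion(2)[of "lin_ext D f" h] by simp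
    then show "f \<in> {f \<in> free_module B. lin_ext D f = 0}" using fB by simp
  qed
  show ?thesis using 1 2 by (rule iffI)
qed

section \<open>Double complexes with exact rows and columns\<close>

text \<open>\<open>h\<close> lowers the first index and \<open>v q\<close> takes the second index
  from \<open>q + 1\<close> to \<open>q\<close>. Up to isomorphism \<open>T q\<close> is the
  cokernel of \<open>h\<close> at first index 0, and \<open>K p\<close> the cokernel of
  \<open>v 0\<close> at second index 0. Squares commute without signs, since only kernels and images
  are compared and no total complex is formed.\<close>

locale double_complex =
  fixes dbl :: "nat \<Rightarrow> nat \<Rightarrow> ('x \<Rightarrow>\<^sub>0 'k::field) set"
    and h :: "('x \<Rightarrow>\<^sub>0 'k) \<Rightarrow> ('x \<Rightarrow>\<^sub>0 'k)" and v :: "nat \<Rightarrow> ('x \<Rightarrow>\<^sub>0 'k) \<Rightarrow> ('x \<Rightarrow>\<^sub>0 'k)"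
    and e :: "nat \<Rightarrow> ('x \<Rightarrow>\<^sub>0 'k) \<Rightarrow> ('y \<Rightarrow>\<^sub>0 'k)" and T :: "nat \<Rightarrow> ('y \<Rightarrow>\<^sub>0 'k) set"
    and \<delta> :: "nat \<Rightarrow> ('y \<Rightarrow>\<^sub>0 'k) \<Rightarrow> ('y \<Rightarrow>\<^sub>0 'k)"
    and \<theta> :: "('x \<Rightarrow>\<^sub>0 'k) \<Rightarrow> ('z \<Rightarrow>\<^sub>0 'k)" and K :: "nat \<Rightarrow> ('z \<Rightarrow>\<^sub>0 'k) set"
    and D :: "('z \<Rightarrow>\<^sub>0 'k) \<Rightarrow> ('z \<Rightarrow>\<^sub>0 'k)"
  assumes fin: "\<And>p q. fin_sub (dbl p q)"
    and lin_h: "linear_map h"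
    and lin_v: "\<And>q. linear_map (v q)"
    and lin_e: "\<And>q. linear_map (e q)"
    and lin_\<theta>: "linear_map \<theta>"
    and h_in: "\<And>p q x. x \<in> dbl (Suc p) q \<Longrightarrow> h x \<in> dbl p q"
    and v_in: "\<And>p q x. x \<in> dbl p (Suc q) \<Longrightarrow> v q x \<in> dbl p q"
    and row: "\<And>p q. {x \<in> dbl (Suc p) q. h x = 0} = h ` dbl (Suc (Suc p)) q"
    and col: "\<And>p q. {x \<in> dbl p (Suc q). v q x = 0} = v (Suc q) ` dbl p (Suc (Suc q))"
    and row0: "\<And>q. {x \<in> dbl 0 q. e q x = 0} = h ` dbl (Suc 0) q"
    and col0: "\<And>p. {x \<in> dbl p 0. \<theta> x = 0} = v 0 ` dbl p (Suc 0)"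
    and e_onto: "\<And>q. e q ` dbl 0 q = T q"
    and \<theta>_onto: "\<And>p. \<theta> ` dbl p 0 = K p"
    and comm: "\<And>p q x. x \<in> dbl (Suc p) (Suc q) \<Longrightarrow> v q (h x) = h (v q x)"
    and comm_e: "\<And>q x. x \<in> dbl 0 (Suc q) \<Longrightarrow> e q (v q x) = \<delta> (Suc q) (e (Suc q) x)"
    and comm_\<theta>: "\<And>p x. x \<in> dbl (Suc p) 0 \<Longrightarrow> \<theta> (h x) = D (\<theta> x)"
    and \<delta>_0: "\<And>y. y \<in> T 0 \<Longrightarrow> \<delta> 0 y = 0"
    and D_0: "\<And>y. y \<in> K 0 \<Longrightarrow> D y = 0"
begin

text \<open>The dimension of the receptor in the sense of Bergman's salamander lemma: elements
  killed by both outgoing maps, modulo the image of the incoming diagonal map. By exactness the two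
  kernels are written as images.\<close>

definition receptor :: "nat \<Rightarrow> nat \<Rightarrow> nat" where
  "receptor p q = fs.dim (h ` dbl (Suc p) q \<inter> v q ` dbl p (Suc q)) - fs.dim (v q ` h ` dbl (Suc p) (Suc q))"

lemma fin_sub_ker_comp:
  fixes f :: "('a \<Rightarrow>\<^sub>0 'k) \<Rightarrow> ('b \<Rightarrow>\<^sub>0 'k)"
  assumes "fin_sub X" "linear_map f" "linear_map g"
  shows "fin_sub {x \<in> X. g (f x) = (0 :: 'c \<Rightarrow>\<^sub>0 'k)}"
  using fin_sub_ker[OF assms(1) Vector_Spaces.linear_compose[OF assms(2,3)]] by (simp add: o_def)

lemma zero_map:
  fixes f :: "('a \<Rightarrow>\<^sub>0 'k) \<Rightarrow> ('b \<Rightarrow>\<^sub>0 'k)"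
  shows "linear_map f \<Longrightarrow> f 0 = 0"
  by (rule module_hom.zero[OF Vector_Spaces.linear.axioms(3)])

text \<open>\<open>zigzag_step\<close> is applied to the kernel of the outgoing diagonal map at
  \<open>(Suc p, Suc q)\<close>. Its images under \<open>h\<close> and \<open>v q\<close> are the
  two intersections, and the images of the two kernels inside it are the two diagonal images. So the
  receptor moves along an antidiagonal.\<close>

lemma receptor_step: "receptor p (Suc q) = receptor (Suc p) q"
proof -
  let ?X = "{x \<in> dbl (Suc p) (Suc q). h (v q x) = 0}"
  have X: "fin_sub ?X" by (rule fin_sub_ker_comp[OF fin lin_v lin_h])
  have 1: "h ` ?X = h ` dbl (Suc p) (Suc q) \<inter> v (Suc q) ` dbl p (Suc (Suc q))"
    unfolding col[symmetric] using comm h_in by auto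
  have 2: "v q ` ?X = h ` dbl (Suc (Suc p)) q \<inter> v q ` dbl (Suc p) (Suc q)"
    unfolding row[symmetric] using v_in by auto
  have 3: "{x \<in> ?X. v q x = 0} = v (Suc q) ` dbl (Suc p) (Suc (Suc q))"
    unfolding col[symmetric] using zero_map[OF lin_h] by auto
  have 4: "{x \<in> ?X. h x = 0} = h ` dbl (Suc (Suc p)) (Suc q)"
    unfolding row[symmetric] using zero_map[OF lin_v] comm by force
  have 5: "h ` v (Suc q) ` dbl (Suc p) (Suc (Suc q)) = v (Suc q) ` h ` dbl (Suc p) (Suc (Suc q))"
    unfolding image_image using comm by (intro image_cong) auto
  show ?thesis
    using zigzag_step[OF X lin_h lin_v[of q]] unfolding 3 4 unfolding 1 2 5 receptor_def .
qed

lemma receptor_shift: "receptor p q = receptor (p + q) 0"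
  by (induction q arbitrary: p) (simp_all add: receptor_step)

text \<open>The same argument at the edge, with \<open>e\<close> in place of \<open>h\<close>: the
  diagonal now ends in \<open>T q\<close>, so one of the two quotients is the homology of
  \<open>T\<close>.\<close>

lemma left_edge:
  "fs.dim {y \<in> T (Suc q). \<delta> (Suc q) y = 0} - fs.dim (\<delta> (Suc (Suc q)) ` T (Suc (Suc q))) = receptor 0 q"
proof -
  let ?X = "{x \<in> dbl 0 (Suc q). e q (v q x) = 0}"
  have X: "fin_sub ?X" by (rule fin_sub_ker_comp[OF fin lin_v lin_e])
  have 1: "e (Suc q) ` ?X = {y \<in> T (Suc q). \<delta> (Suc q) y = 0}"
    unfolding e_onto[symmetric] using comm_e by auto
  have 2: "v q ` ?X = h ` dbl (Suc 0) q \<inter> v q ` dbl 0 (Suc q)"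
    unfolding row0[symmetric] using v_in by auto
  have 3: "{x \<in> ?X. v q x = 0} = v (Suc q) ` dbl 0 (Suc (Suc q))"
    unfolding col[symmetric] using zero_map[OF lin_e] by auto
  have 4: "{x \<in> ?X. e (Suc q) x = 0} = h ` dbl (Suc 0) (Suc q)"
  proof -
    have "e q (v q x) = 0" if "x \<in> h ` dbl (Suc 0) (Suc q)" for x
    proof -
      obtain z where z: "z \<in> dbl (Suc 0) (Suc q)" "x = h z" using \<open>x \<in> h ` dbl (Suc 0) (Suc q)\<close> by blast
      then have "v q x \<in> h ` dbl (Suc 0) q" using comm v_in by auto
      then show ?thesis unfolding row0[symmetric] by simp
    qed
    then show ?thesis using row0[of "Suc q"] by blast
  qed
  have 5: "e (Suc q) ` v (Suc q) ` dbl 0 (Suc (Suc q)) = \<delta> (Suc (Suc q)) ` T (Suc (Suc q))"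
    unfolding image_image e_onto[symmetric] using comm_e by (intro image_cong) auto
  show ?thesis
    using zigzag_step[OF X lin_e[of "Suc q"] lin_v[of q]] unfolding 3 4 unfolding 1 2 5 receptor_def .
qed

lemma bottom_edge:
  "fs.dim {y \<in> K (Suc p). D y = 0} - fs.dim (D ` K (Suc (Suc p))) = receptor p 0"
proof -
  let ?X = "{x \<in> dbl (Suc p) 0. \<theta> (h x) = 0}"
  have X: "fin_sub ?X" by (rule fin_sub_ker_comp[OF fin lin_h lin_\<theta>])
  have 1: "\<theta> ` ?X = {y \<in> K (Suc p). D y = 0}"
    unfolding \<theta>_onto[symmetric] using comm_\<theta> by auto
  have 2: "h ` ?X = h ` dbl (Suc p) 0 \<inter> v 0 ` dbl p (Suc 0)"
    unfolding col0[symmetric] using h_in by auto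
  have 3: "{x \<in> ?X. h x = 0} = h ` dbl (Suc (Suc p)) 0"
    unfolding row[symmetric] using zero_map[OF lin_\<theta>] by auto
  have 4: "{x \<in> ?X. \<theta> x = 0} = v 0 ` dbl (Suc p) (Suc 0)"
  proof -
    have "\<theta> (h x) = 0" if "x \<in> v 0 ` dbl (Suc p) (Suc 0)" for x
    proof -
      obtain z where z: "z \<in> dbl (Suc p) (Suc 0)" "x = v 0 z" using \<open>x \<in> v 0 ` dbl (Suc p) (Suc 0)\<close> by blast
      then have "h x = v 0 (h z)" "h z \<in> dbl p (Suc 0)" using comm h_in by auto
      then have "h x \<in> v 0 ` dbl p (Suc 0)" by blast
      then show ?thesis unfolding col0[symmetric] by simp
    qed
    then show ?thesis using col0[of "Suc p"] by blast
  qed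
  have 5: "\<theta> ` h ` dbl (Suc (Suc p)) 0 = D ` K (Suc (Suc p))"
    unfolding image_image \<theta>_onto[symmetric] using comm_\<theta> by (intro image_cong) auto
  have 6: "h ` v 0 ` dbl (Suc p) (Suc 0) = v 0 ` h ` dbl (Suc p) (Suc 0)"
    unfolding image_image using comm by (intro image_cong) auto
  show ?thesis
    using zigzag_step[OF X lin_\<theta> lin_h] unfolding 3 4 unfolding 1 2 5 6 receptor_def .
qed

theorem edges_homology_eq:
  "fs.dim {y \<in> T q. \<delta> q y = 0} - fs.dim (\<delta> (Suc q) ` T (Suc q)) =
   fs.dim {y \<in> K q. D y = 0} - fs.dim (D ` K (Suc q))"
proof (cases q)
  \<comment> \<open>At the corner there is no receptor to pass through; one zigzag at
    \<open>dbl 0 0\<close>, with both augmentations, compares the edges directly.\<close>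
  case 0
  have 1: "{x \<in> dbl 0 0. \<theta> x = 0} = v 0 ` dbl 0 (Suc 0)" "{x \<in> dbl 0 0. e 0 x = 0} = h ` dbl (Suc 0) 0"
    by (rule col0, rule row0)
  have 2: "e 0 ` v 0 ` dbl 0 (Suc 0) = \<delta> (Suc 0) ` T (Suc 0)"
    unfolding image_image e_onto[symmetric] using comm_e by (intro image_cong) auto
  have 3: "\<theta> ` h ` dbl (Suc 0) 0 = D ` K (Suc 0)"
    unfolding image_image \<theta>_onto[symmetric] using comm_\<theta> by (intro image_cong) auto
  have 4: "{y \<in> T 0. \<delta> 0 y = 0} = T 0" "{y \<in> K 0. D y = 0} = K 0" using \<delta>_0 D_0 by auto
  show ?thesis
    using zigzag_step[OF fin[of 0 0] lin_e[of 0] lin_\<theta>] unfolding 0 1 2 3 4 e_onto \<theta>_onto .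
next
  case (Suc p)
  then show ?thesis using left_edge[of p] bottom_edge[of p] receptor_shift[of 0 p] by simp
qed

end

section \<open>Normal forms\<close>

text \<open>Families of quotients \<open>V a / N a\<close>: \<open>N a\<close> plays the role of the degree \<open>a\<close> part of the relations,
  written in coordinates.\<close>

locale graded_relations =
  fixes J :: "nat set" and \<beta> :: "nat \<Rightarrow> 'n mdeg" and N :: "'n mdeg \<Rightarrow> (nat \<Rightarrow>\<^sub>0 'k::field) set"
  assumes finite_J: "finite J"
    and subspace_N: "fs.subspace (N a)"
    and N_sub: "N a \<subseteq> free_module {i \<in> J. vle (\<beta> i) a}"
    and N_mono: "vle a b \<Longrightarrow> N a \<subseteq> N b"
begin

definition V :: "'n mdeg \<Rightarrow> (nat \<Rightarrow>\<^sub>0 'k) set" where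
  "V a = free_module {i \<in> J. vle (\<beta> i) a}"

definition leads :: "'n mdeg \<Rightarrow> nat set" where
  "leads a = {j. \<exists>y\<in>N a. lkp y j \<noteq> 0 \<and> (\<forall>i>j. lkp y i = 0)}"

definition std :: "'n mdeg \<Rightarrow> nat set" where
  "std a = {i \<in> J. vle (\<beta> i) a} - leads a"

definition nf :: "'n mdeg \<Rightarrow> (nat \<Rightarrow>\<^sub>0 'k) \<Rightarrow> (nat \<Rightarrow>\<^sub>0 'k)" where
  "nf a x = (THE y. y \<in> free_module (std a) \<and> x - y \<in> N a)"

lemma subspace_V: "fs.subspace (V a)"
  by (simp add: V_def subspace_free_module)

lemma V_mono: "vle a b \<Longrightarrow> V a \<subseteq> V b"
  unfolding V_def by (intro free_module_mono) (auto intro: vle_trans)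

lemma std_V: "free_module (std a) \<subseteq> V a"
  unfolding V_def std_def by (intro free_module_mono) auto

text \<open>The largest index in the support of a nonzero relation is a lead, hence not standard.
  This gives uniqueness of normal forms.\<close>

lemma std_N_zero:
  assumes "y \<in> free_module (std a)" "y \<in> N a"
  shows "y = 0"
proof (rule ccontr)
  assume "y \<noteq> 0"
  then have ne: "supp y \<noteq> {}" by (metis keys_zero poly_mapping_eqI in_keys_iff ex_in_conv lookup_zero)
  define j where "j = Max (supp y)"
  have j: "j \<in> supp y" using ne by (simp add: j_def)
  have "lkp y i = 0" if "i > j" for i
    using that Max_ge[of "supp y" i] unfolding j_def in_keys_iff by force
  then have "j \<in> leads a" using assms(2) j by (auto simp: leads_def in_keys_iff)
  then show False using assms(1) j by (auto simp: free_module_def std_def)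
qed

text \<open>Elimination from the top position: the last coordinate is cancelled by a relation
  leading there, or split off as standard if there is none. The bound \<open>m\<close> is kept in
  the conclusion because the reduction of the j-th basis element must later involve only positions
  below j.\<close>

lemma nf_exists:
  assumes "x \<in> free_module ({i \<in> J. vle (\<beta> i) a} \<inter> {..<m})"
  shows "\<exists>y \<in> free_module (std a \<inter> {..<m}). x - y \<in> N a"
  using assms
proof (induction m arbitrary: x)
  case 0
  then have "x = 0" by (intro poly_mapping_eqI) (auto dest: in_free_moduleD)
  then show ?case
    by (intro bexI[of _ 0]) (simp_all add: free_module_zero fs.subspace_0[OF subspace_N])
next
  case (Suc m)
  let ?V = "\<lambda>m. {i \<in> J. vle (\<beta> i) a} \<inter> {..<m}"
  have shrink: "z \<in> free_module (?V m)" if "z \<in> free_module (?V (Suc m))" "lkp z m = 0" for z :: "nat \<Rightarrow>\<^sub>0 'k"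
  proof (rule in_free_moduleI)
    fix b assume "lkp z b \<noteq> 0"
    then have "b \<in> ?V (Suc m)" "b \<noteq> m" using that(2) in_free_moduleD[OF that(1)] by blast+
    then show "b \<in> ?V m" by auto
  qed
  have mono: "free_module (std a \<inter> {..<m}) \<subseteq> free_module (std a \<inter> {..<Suc m})"
    by (intro free_module_mono) auto
  show ?case
  proof (cases "m \<in> leads a")
    case True
    then obtain z where z: "z \<in> N a" "lkp z m \<noteq> 0" "\<And>i. i > m \<Longrightarrow> lkp z i = 0"
      by (auto simp: leads_def)
    define c where "c = lkp x m / lkp z m"
    have cz: "fscale c z \<in> N a" by (rule fs.subspace_scale[OF subspace_N z(1)])
    have "z \<in> free_module {i \<in> J. vle (\<beta> i) a}" using z(1) N_sub by blast
    then have "z \<in> free_module (?V (Suc m))"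
      using z(3) by (intro in_free_moduleI) (metis (mono_tags, lifting) IntI in_free_moduleD lessThan_iff not_less_eq)
    then have "x - fscale c z \<in> free_module (?V (Suc m))"
      using Suc.prems by (intro free_module_diff free_module_scale)
    moreover have "lkp (x - fscale c z) m = 0" using z(2) by (simp add: lookup_minus lookup_fscale c_def)
    ultimately obtain y where y: "y \<in> free_module (std a \<inter> {..<m})" "x - fscale c z - y \<in> N a"
      using Suc.IH shrink by blast
    have "x - y = (x - fscale c z - y) + fscale c z" by simp
    then have "x - y \<in> N a" using fs.subspace_add[OF subspace_N y(2) cz] by simp
    then show ?thesis using y(1) mono by blast
  next
    case False
    let ?s = "sng m (lkp x m)"
    have s: "?s \<in> free_module (std a \<inter> {..<Suc m})"
    proof (cases "lkp x m = 0")
      case True then show ?thesis by (simp add: free_module_zero)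
    next
      case c: False
      then have "m \<in> ?V (Suc m)" using in_free_moduleD[OF Suc.prems c] by simp
      then show ?thesis using False by (intro single_in_free_module) (auto simp: std_def)
    qed
    have "std a \<inter> {..<Suc m} \<subseteq> ?V (Suc m)" by (auto simp: std_def)
    then have "x - ?s \<in> free_module (?V (Suc m))"
      using Suc.prems s free_module_mono by (intro free_module_diff) blast+
    moreover have "lkp (x - ?s) m = 0" by (simp add: lookup_minus)
    ultimately obtain y where y: "y \<in> free_module (std a \<inter> {..<m})" "x - ?s - y \<in> N a"
      using Suc.IH shrink by blast
    have "?s + y \<in> free_module (std a \<inter> {..<Suc m})" using s y(1) mono free_module_add by blast
    moreover have "x - (?s + y) \<in> N a" using y(2) by (simp add: algebra_simps)
    ultimately show ?thesis by blast
  qed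
qed

lemma nf_eqI:
  assumes "y \<in> free_module (std a)" "x - y \<in> N a"
  shows "nf a x = y"
  unfolding nf_def
proof (rule the_equality)
  fix z assume z: "z \<in> free_module (std a) \<and> x - z \<in> N a"
  have "(x - y) - (x - z) \<in> N a" using fs.subspace_diff[OF subspace_N, of "x - y" a "x - z"] z assms by blast
  then have "z - y \<in> N a" by simp
  moreover have "z - y \<in> free_module (std a)" using z assms free_module_diff by blast
  ultimately have "z - y = 0" by (intro std_N_zero)
  then show "z = y" by simp
qed (use assms in auto)

lemma nf_less:
  assumes "x \<in> V a" "\<And>i. i \<ge> m \<Longrightarrow> lkp x i = 0"
  shows "nf a x \<in> free_module (std a \<inter> {..<m})"
proof -
  have "x \<in> free_module ({i \<in> J. vle (\<beta> i) a} \<inter> {..<m})"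
    using assms by (intro in_free_moduleI) (metis (mono_tags, lifting) IntI V_def in_free_moduleD lessThan_iff not_less)
  then obtain y where y: "y \<in> free_module (std a \<inter> {..<m})" "x - y \<in> N a"
    using nf_exists by blast
  moreover have "y \<in> free_module (std a)" using y(1) free_module_mono[of "std a \<inter> {..<m}" "std a"] by blast
  ultimately show ?thesis using nf_eqI by metis
qed

lemma nf_props:
  assumes "x \<in> V a"
  shows "nf a x \<in> free_module (std a)" "x - nf a x \<in> N a"
proof -
  obtain m where "\<forall>i\<in>J. i < m" using finite_J by (metis finite_nat_set_iff_bounded)
  then have "{i \<in> J. vle (\<beta> i) a} = {i \<in> J. vle (\<beta> i) a} \<inter> {..<m}" by auto
  then obtain y where y: "y \<in> free_module (std a \<inter> {..<m})" "x - y \<in> N a"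
    using nf_exists[of x a m] assms unfolding V_def by metis
  have "y \<in> free_module (std a)" using y(1) free_module_mono[of "std a \<inter> {..<m}" "std a"] by blast
  then show "nf a x \<in> free_module (std a)" "x - nf a x \<in> N a" using nf_eqI y(2) by metis+
qed

lemma nf_std: "y \<in> free_module (std a) \<Longrightarrow> nf a y = y"
  by (rule nf_eqI) (simp_all add: fs.subspace_0[OF subspace_N])

lemma nf_add:
  assumes "x \<in> V a" "y \<in> V a"
  shows "nf a (x + y) = nf a x + nf a y"
proof (rule nf_eqI)
  show "nf a x + nf a y \<in> free_module (std a)" using nf_props assms free_module_add by blast
  have "x + y - (nf a x + nf a y) = (x - nf a x) + (y - nf a y)" by simp
  then show "x + y - (nf a x + nf a y) \<in> N a"
    using nf_props assms fs.subspace_add[OF subspace_N] by metis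
qed

lemma nf_fscale:
  assumes "x \<in> V a"
  shows "nf a (fscale c x) = fscale c (nf a x)"
proof (rule nf_eqI)
  show "fscale c (nf a x) \<in> free_module (std a)" using nf_props assms free_module_scale by blast
  have "fscale c x - fscale c (nf a x) = fscale c (x - nf a x)" by (simp add: fscale_distrib)
  then show "fscale c x - fscale c (nf a x) \<in> N a"
    using nf_props assms fs.subspace_scale[OF subspace_N] by metis
qed

lemma nf_0 [simp]: "nf a 0 = 0"
  by (rule nf_std) (rule free_module_zero)

lemma nf_eq_0_iff: "x \<in> V a \<Longrightarrow> nf a x = 0 \<longleftrightarrow> x \<in> N a"
  using nf_props[of x a] nf_eqI[of 0 a x] by (auto simp: free_module_zero)

text \<open>As relations persist in larger degrees, an early reduction is harmless. In coordinates
  this says that multiplication by a monomial is well defined on the quotients.\<close>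

lemma nf_nf:
  assumes "vle a b" "x \<in> V a"
  shows "nf b (nf a x) = nf b x"
proof -
  have xb: "x \<in> V b" "nf a x \<in> V b" using assms V_mono nf_props(1) std_V by blast+
  show ?thesis
  proof (rule nf_eqI)
    show "nf b x \<in> free_module (std b)" using nf_props(1) xb by blast
    have "x - nf a x \<in> N b" using nf_props(2) assms N_mono by blast
    then have "(x - nf b x) - (x - nf a x) \<in> N b"
      using nf_props(2)[OF xb(1)] fs.subspace_diff[OF subspace_N] by blast
    then show "nf a x - nf b x \<in> N b" by simp
  qed
qed

lemma nf_sum:
  assumes "\<And>i. i \<in> I \<Longrightarrow> f i \<in> V a"
  shows "nf a (sum f I) = (\<Sum>i\<in>I. nf a (f i))"
  using assms
proof (induction I rule: infinite_finite_induct)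
  case (insert i I)
  then have "sum f I \<in> V a" by (intro fs.subspace_sum[OF subspace_V]) auto
  then show ?case using insert by (simp add: nf_add)
qed auto

lemma nf_lin_ext:
  assumes "\<And>b. b \<in> supp x \<Longrightarrow> f b \<in> V a"
  shows "nf a (lin_ext f x) = lin_ext (\<lambda>b. nf a (f b)) x"
  unfolding lin_ext_def using assms
  by (subst nf_sum) (auto simp: nf_fscale intro!: fs.subspace_scale[OF subspace_V])

lemma nf_basis: 
  assumes "x \<in> V a"
  shows "nf a x = lin_ext (\<lambda>j. nf a (sng j 1)) x"
proof -
  have "sng b 1 \<in> V a" if "b \<in> supp x" for b
    using that assms by (auto simp: V_def free_module_def)
  then show ?thesis using nf_lin_ext[of x "\<lambda>b. sng b 1" a] by (simp add: lin_ext_single_id)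
qed

end

section \<open>Koszul complexes\<close>

text \<open>The Koszul sign. For w in L it agrees with \<open>elt_sign\<close>; counting strictly
  smaller elements makes it independent of whether w belongs to L, which is convenient when elements
  are inserted and removed.\<close>

definition ksgn :: "'n::linorder set \<Rightarrow> 'n \<Rightarrow> 'k::field" where
  "ksgn L w = (- 1) ^ card {v \<in> L. v < w}"

lemma ksgn_square [simp]: "ksgn L w * ksgn L w = (1 :: 'k::field)"
  by (simp add: ksgn_def flip: power_mult_distrib)

lemma ksgn_nonzero [simp]: "ksgn L w \<noteq> (0 :: 'k::field)"
  by (simp add: ksgn_def)

lemma ksgn_insert:
  assumes "finite L" "k \<notin> L"
  shows "ksgn (insert k L) w = (if k < w then - ksgn L w else (ksgn L w :: 'k::field))"
proof -
  have "{v \<in> insert k L. v < w} = (if k < w then insert k {v \<in> L. v < w} else {v \<in> L. v < w})" by auto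
  then show ?thesis using assms by (simp add: ksgn_def)
qed

lemma ksgn_remove:
  assumes "finite L" "k \<in> L"
  shows "ksgn (L - {k}) w = (if k < w then - ksgn L w else (ksgn L w :: 'k::field))"
  using ksgn_insert[of "L - {k}" k w, where 'k = 'k] assms by (cases "k < w") (simp_all add: insert_absorb)

text \<open>\<open>emb L y\<close> stands for \<open>e_L\<close> tensored with \<open>y\<close>:
  pairs \<open>(L, b)\<close> index the basis of an exterior algebra tensored with a free module.
  \<open>slice L\<close> reads off the component at \<open>e_L\<close>.\<close>

definition emb :: "'l \<Rightarrow> ('b \<Rightarrow>\<^sub>0 'k::comm_ring_1) \<Rightarrow> ('l \<times> 'b \<Rightarrow>\<^sub>0 'k)" where
  "emb L = lin_ext (\<lambda>b. sng (L, b) 1)"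

definition slice :: "'l \<Rightarrow> ('l \<times> 'b \<Rightarrow>\<^sub>0 'k::comm_ring_1) \<Rightarrow> ('b \<Rightarrow>\<^sub>0 'k)" where
  "slice L = lin_ext (\<lambda>(L', b). if L' = L then sng b 1 else 0)"

lemma lookup_emb: "lkp (emb L y) (L', b) = (lkp y b when L' = L)"
proof -
  have "lkp (emb L y) (L', b) = (\<Sum>b'\<in>supp y. if b' = b then (lkp y b when L' = L) else 0)"
    unfolding emb_def lookup_lin_ext[OF finite_keys order_refl]
    by (intro sum.cong) (auto simp: lookup_single when_def)
  then show ?thesis by (auto simp: in_keys_iff)
qed

lemma lookup_slice: "lkp (slice L x) b = lkp x (L, b)"
proof -
  have "lkp (slice L x) b = (\<Sum>z\<in>supp x. if z = (L, b) then lkp x (L, b) else 0)"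
    unfolding slice_def lookup_lin_ext[OF finite_keys order_refl]
    by (intro sum.cong) (auto simp: lookup_single when_def split: if_splits prod.splits)
  then show ?thesis by (auto simp: in_keys_iff)
qed

lemma emb_simps [simp]: "emb L 0 = 0" "emb L (fscale c y) = fscale c (emb L y)"
  "emb L (sng b c) = sng (L, b) c"
  by (simp_all add: emb_def lin_ext_fscale fscale_single)

lemma emb_in_free_module: "y \<in> free_module B \<Longrightarrow> emb L y \<in> free_module ({L} \<times> B)"
  by (intro in_free_moduleI) (auto simp: lookup_emb when_def dest: in_free_moduleD split: if_splits)

definition fibrewise :: "('l \<Rightarrow> 'b \<Rightarrow> ('c \<Rightarrow>\<^sub>0 'k::comm_ring_1)) \<Rightarrow> ('l \<times> 'b \<Rightarrow>\<^sub>0 'k) \<Rightarrow> ('l \<times> 'c \<Rightarrow>\<^sub>0 'k)" where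
  "fibrewise m = lin_ext (\<lambda>(L, b). emb L (m L b))"

lemma slice_fibrewise:
  fixes m :: "'l \<Rightarrow> 'b \<Rightarrow> ('c \<Rightarrow>\<^sub>0 'k::comm_ring_1)"
  shows "slice L (fibrewise m x) = lin_ext (m L) (slice L x)"
proof -
  have "slice L (emb L' y) = (if L' = L then y else 0)" for L' and y :: "'c \<Rightarrow>\<^sub>0 'k"
    by (rule poly_mapping_eqI) (auto simp: lookup_slice lookup_emb)
  then show ?thesis
    unfolding fibrewise_def slice_def[of L] lin_ext_lin_ext
    unfolding slice_def[symmetric]
    by (intro lin_ext_cong) (auto simp: split_def)
qed

lemma slice_eqI: "(\<And>L. slice L x = slice L y) \<Longrightarrow> x = y"
  by (rule poly_mapping_eqI) (metis lookup_slice surj_pair)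

lemma slice_0 [simp]: "slice L 0 = 0"
  by (simp add: slice_def)

lemma in_cells_iff: "x \<in> free_module {(L, b). P L \<and> b \<in> B L} \<longleftrightarrow>
    (\<forall>L. slice L x \<in> free_module (B L) \<and> (\<not> P L \<longrightarrow> slice L x = 0))"
proof safe
  fix L assume x: "x \<in> free_module {(L, b). P L \<and> b \<in> B L}"
  show "slice L x \<in> free_module (B L)"
    using in_free_moduleD[OF x] by (intro in_free_moduleI) (auto simp: lookup_slice)
  assume "\<not> P L"
  then show "slice L x = 0"
    using in_free_moduleD[OF x] by (intro poly_mapping_eqI) (auto simp: lookup_slice)
next
  assume *: "\<forall>L. slice L x \<in> free_module (B L) \<and> (\<not> P L \<longrightarrow> slice L x = 0)"
  show "x \<in> free_module {(L, b). P L \<and> b \<in> B L}"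
  proof (rule in_free_moduleI, clarify)
    fix L b assume "lkp x (L, b) \<noteq> 0"
    then have "lkp (slice L x) b \<noteq> 0" by (simp add: lookup_slice)
    then show "P L \<and> b \<in> B L" using * in_free_moduleD by (metis lookup_zero)
  qed
qed

text \<open>There are finitely many L, so preimages chosen for each L separately can be assembled.
  Together with \<open>fibrewise_kernel\<close> this reduces exactness of the columns to a single
  L.\<close>

lemma fibrewise_image:
  fixes m :: "'l::finite \<Rightarrow> 'b \<Rightarrow> ('c \<Rightarrow>\<^sub>0 'k::comm_ring_1)"
  assumes "\<And>L. P L \<Longrightarrow> lin_ext (m L) ` free_module (B L) = X L"
  shows "fibrewise m ` free_module {(L, b). P L \<and> b \<in> B L} =
    {x. \<forall>L. (P L \<longrightarrow> slice L x \<in> X L) \<and> (\<not> P L \<longrightarrow> slice L x = 0)}"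
proof safe
  fix y :: "'l \<times> 'b \<Rightarrow>\<^sub>0 'k" and L assume y: "y \<in> free_module {(L, b). P L \<and> b \<in> B L}"
  then have "slice L y \<in> free_module (B L)" by (auto simp: in_cells_iff)
  then show "slice L (fibrewise m y) \<in> X L" if "P L"
    using assms[OF that] by (auto simp: slice_fibrewise)
  show "slice L (fibrewise m y) = 0" if "\<not> P L"
    using y that by (simp add: in_cells_iff slice_fibrewise)
next
  fix x :: "'l \<times> 'c \<Rightarrow>\<^sub>0 'k" assume x: "\<forall>L. (P L \<longrightarrow> slice L x \<in> X L) \<and> (\<not> P L \<longrightarrow> slice L x = 0)"
  have "\<exists>y\<in>free_module (B L). P L \<longrightarrow> slice L x = lin_ext (m L) y" for L
    using x assms[of L] free_module_zero by blast
  then obtain y where y: "\<And>L. y L \<in> free_module (B L)" "\<And>L. P L \<Longrightarrow> slice L x = lin_ext (m L) (y L)"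
    by metis
  define z where "z = (\<Sum>L\<in>{L. P L}. emb L (y L))"
  have z: "slice L z = (if P L then y L else 0)" for L
    by (rule poly_mapping_eqI) (auto simp: z_def lookup_slice lookup_sum lookup_emb when_def)
  have "z \<in> free_module {(L, b). P L \<and> b \<in> B L}"
    unfolding in_cells_iff z using y(1) by (auto simp: free_module_zero)
  moreover have "x = fibrewise m z"
    by (rule slice_eqI) (use x y(2) in \<open>auto simp: slice_fibrewise z\<close>)
  ultimately show "x \<in> fibrewise m ` free_module {(L, b). P L \<and> b \<in> B L}" by blast
qed

lemma fibrewise_kernel:
  fixes m :: "'l::finite \<Rightarrow> 'b \<Rightarrow> ('c \<Rightarrow>\<^sub>0 'k::comm_ring_1)"
  shows "{x \<in> free_module {(L, b). P L \<and> b \<in> B L}. fibrewise m x = 0} =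
    {x. \<forall>L. (P L \<longrightarrow> slice L x \<in> {x \<in> free_module (B L). lin_ext (m L) x = 0}) \<and> (\<not> P L \<longrightarrow> slice L x = 0)}"
proof -
  have *: "fibrewise m x = 0 \<longleftrightarrow> (\<forall>L. lin_ext (m L) (slice L x) = 0)" for x
    by (metis slice_eqI slice_fibrewise slice_0)
  have "(\<forall>L. slice L x \<in> free_module (B L) \<and> (\<not> P L \<longrightarrow> slice L x = 0)) \<and> (\<forall>L. lin_ext (m L) (slice L x) = 0) \<longleftrightarrow>
      (\<forall>L. (P L \<longrightarrow> slice L x \<in> {x \<in> free_module (B L). lin_ext (m L) x = 0}) \<and> (\<not> P L \<longrightarrow> slice L x = 0))" for x
    by (auto simp: free_module_zero) (metis free_module_zero lin_ext_zero)+
  then show ?thesis unfolding in_cells_iff * by blast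
qed

lemma linear_fibrewise: "linear_map (fibrewise m :: ('l \<times> 'b \<Rightarrow>\<^sub>0 'k::field) \<Rightarrow> _)"
  unfolding fibrewise_def by (rule linear_lin_ext)

text \<open>The Koszul differential without its factors \<open>x_w\<close>: in coordinates
  multiplication by \<open>x_w\<close> is the identity, and degrees only constrain which pairs
  \<open>(L, b)\<close> may occur.\<close>

definition kos :: "('n::{finite,linorder} set \<times> 'b \<Rightarrow>\<^sub>0 'k::field) \<Rightarrow> ('n set \<times> 'b \<Rightarrow>\<^sub>0 'k)" where
  "kos = lin_ext (\<lambda>(L, b). \<Sum>w\<in>L. sng (L - {w}, b) (ksgn L w))"

lemma linear_kos: "linear_map kos"
  unfolding kos_def by (rule linear_lin_ext)

lemma kos_single: "kos (sng (L, b) c) = fscale c (\<Sum>w\<in>L. sng (L - {w}, b) (ksgn L w))"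
  by (simp add: kos_def)

lemma kos_emb: "kos (emb L y) = (\<Sum>w\<in>L. fscale (ksgn L w) (emb (L - {w}) y))"
proof -
  have "kos (emb L y) = lin_ext (\<lambda>b. \<Sum>w\<in>L. sng (L - {w}, b) (ksgn L w)) y"
    unfolding emb_def kos_def lin_ext_lin_ext by simp
  also have "\<dots> = (\<Sum>w\<in>L. fscale (ksgn L w) (emb (L - {w}) y))"
    unfolding emb_def lin_ext_def fscale_sum fscale_distrib fscale_single
    by (subst sum.swap) (simp add: mult.commute)
  finally show ?thesis .
qed

lemma kos_fibrewise:
  fixes x :: "'n::{finite,linorder} set \<times> 'b \<Rightarrow>\<^sub>0 'k::field"
  shows "kos (fibrewise (\<lambda>_. m) x) = fibrewise (\<lambda>_. m) (kos x)"
  unfolding fibrewise_def kos_def lin_ext_lin_ext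
proof (intro lin_ext_cong, clarify)
  fix L :: "'n set" and b
  have "lin_ext (\<lambda>(L, b). \<Sum>w\<in>L. sng (L - {w}, b) (ksgn L w)) (emb L (m b)) = kos (emb L (m b))"
    by (simp add: kos_def)
  then show "lin_ext (\<lambda>(L, b). \<Sum>w\<in>L. sng (L - {w}, b) (ksgn L w)) (emb L (m b)) =
      lin_ext (\<lambda>(L, b). emb L (m b)) (\<Sum>w\<in>L. sng (L - {w}, b) (ksgn L w))"
    by (simp add: kos_emb lin_ext_sum)
qed

lemma kos_kos: "kos (kos x) = (0 :: 'n::{finite,linorder} set \<times> 'b \<Rightarrow>\<^sub>0 'k::field_char_0)"
proof -
  have *: "kos (\<Sum>w\<in>L. sng (L - {w}, b) (ksgn L w)) = (0 :: 'n set \<times> 'b \<Rightarrow>\<^sub>0 'k)" for L b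
  proof -
    let ?t = "\<lambda>w w'. sng (L - {w} - {w'}, b) (ksgn L w * ksgn (L - {w}) w') :: 'n set \<times> 'b \<Rightarrow>\<^sub>0 'k"
    \<comment> \<open>Letting \<open>w'\<close> range over all of L, with a zero diagonal, makes the
      summand antisymmetric on a square, so that swapping the sums yields \<open>?S = - ?S\<close>.
      Characteristic 0 then gives 0.\<close>
    let ?S = "\<Sum>w\<in>L. \<Sum>w'\<in>L. (?t w w' when w' \<noteq> w)"
    have fin: "finite L" by simp
    have anti: "(?t w w' when w' \<noteq> w) = - (?t w' w when w \<noteq> w')" if "w \<in> L" "w' \<in> L" for w w'
    proof (cases "w = w'")
      case False
      have "L - {w} - {w'} = L - {w'} - {w}" by auto
      moreover have "ksgn L w * ksgn (L - {w}) w' = - (ksgn L w' * ksgn (L - {w'}) w :: 'k)"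
        using False that ksgn_remove[OF fin that(1), of w', where 'k = 'k]
          ksgn_remove[OF fin that(2), of w, where 'k = 'k]
        by (cases "w < w'") auto
      ultimately show ?thesis using False by (simp add: single_uminus)
    qed simp
    have "?S = (\<Sum>w\<in>L. \<Sum>w'\<in>L. (?t w' w when w \<noteq> w'))" by (rule sum.swap)
    also have "\<dots> = (\<Sum>w\<in>L. \<Sum>w'\<in>L. - (?t w w' when w' \<noteq> w))"
      by (intro sum.cong refl anti)
    also have "\<dots> = - ?S" by (simp add: sum_negf)
    finally have "?S = - ?S" .
    have S0: "y = 0" if "y = - y" for y :: "'n set \<times> 'b \<Rightarrow>\<^sub>0 'k"
    proof (rule poly_mapping_eqI)
      fix z
      have "lkp y z = - lkp y z" using arg_cong[OF that, of "\<lambda>y. lkp y z"] by simp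
      then have "2 * lkp y z = 0" by (metis add.right_inverse mult_2)
      then show "lkp y z = lkp 0 z" by simp
    qed
    have "kos (\<Sum>w\<in>L. sng (L - {w}, b) (ksgn L w)) = (\<Sum>w\<in>L. \<Sum>w'\<in>L - {w}. ?t w w')"
      by (simp add: kos_def lin_ext_sum fscale_sum fscale_single)
    also have "\<dots> = ?S"
      by (intro sum.cong refl sum.mono_neutral_cong_left) (auto simp: when_def)
    finally show ?thesis using S0[OF \<open>?S = - ?S\<close>] by simp
  qed
  have "kos (kos x) = lin_ext (\<lambda>z. kos (case z of (L, b) \<Rightarrow> \<Sum>w\<in>L. sng (L - {w}, b) (ksgn L w))) x"
    unfolding kos_def by (rule lin_ext_lin_ext)
  also have "\<dots> = lin_ext (\<lambda>_. 0) x" using * by (intro lin_ext_cong) auto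
  finally show ?thesis by (simp add: lin_ext_def)
qed

text \<open>Exterior multiplication by \<open>e_{k b}\<close>. The chosen variable may vary with
  \<open>b\<close>, because \<open>kos\<close> leaves \<open>b\<close> unchanged; \<open>k\<close>
  is chosen later so that the result stays within the degree bounds.\<close>

definition contr :: "('b \<Rightarrow> 'n) \<Rightarrow> ('n::{finite,linorder} set \<times> 'b \<Rightarrow>\<^sub>0 'k::field) \<Rightarrow> ('n set \<times> 'b \<Rightarrow>\<^sub>0 'k)" where
  "contr k = lin_ext (\<lambda>(L, b). if k b \<in> L then 0 else sng (insert (k b) L, b) (ksgn (insert (k b) L) (k b)))"

text \<open>For fixed \<open>b\<close> this is the cone contraction of a full simplex: taking
  \<open>k b\<close> out and putting it back returns the cell, and the terms removing another w
  cancel, as their signs differ by the order of the two operations.\<close>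

lemma contr_homotopy:
  fixes x :: "'n::{finite,linorder} set \<times> 'b \<Rightarrow>\<^sub>0 'k::field"
  shows "kos (contr k x) + contr k (kos x) = x"
proof -
  have *: "kos (contr k (sng (L, b) 1)) + contr k (kos (sng (L, b) 1)) = sng (L, b) (1 :: 'k)" for L b
  proof (cases "k b \<in> L")
    case True
    have "contr k (kos (sng (L, b) 1)) = (\<Sum>w\<in>L. contr k (sng (L - {w}, b) (ksgn L w :: 'k)))"
      unfolding kos_single contr_def by (simp add: lin_ext_sum)
    also have "\<dots> = (\<Sum>w\<in>L. if w = k b then sng (L, b) 1 else 0)"
    proof (intro sum.cong refl)
      fix w assume "w \<in> L"
      show "contr k (sng (L - {w}, b) (ksgn L w)) = (if w = k b then sng (L, b) (1 :: 'k) else 0)"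
        using True by (auto simp: contr_def fscale_single insert_absorb)
    qed
    also have "\<dots> = sng (L, b) 1" using True by simp
    finally show ?thesis using True by (simp add: contr_def kos_def)
  next
    case False
    let ?L = "insert (k b) L"
    have 1: "kos (contr k (sng (L, b) 1)) =
        sng (L, b) 1 + (\<Sum>w\<in>L. sng (?L - {w}, b) (ksgn ?L (k b) * ksgn ?L w :: 'k))"
      using False by (simp add: contr_def kos_single fscale_sum fscale_single fscale_distrib)
    have "contr k (kos (sng (L, b) 1)) = (\<Sum>w\<in>L. contr k (sng (L - {w}, b) (ksgn L w :: 'k)))"
      unfolding kos_single contr_def by (simp add: lin_ext_sum)
    also have "\<dots> = (\<Sum>w\<in>L. - sng (?L - {w}, b) (ksgn ?L (k b) * ksgn ?L w))"
    proof (intro sum.cong refl)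
      fix w assume w: "w \<in> L"
      then have "w \<noteq> k b" using False by auto
      then have ins: "insert (k b) (L - {w}) = ?L - {w}" by auto
      have "ksgn (?L - {w}) (k b) * ksgn L w = - (ksgn ?L (k b) * ksgn ?L w :: 'k)"
        using False w \<open>w \<noteq> k b\<close> ksgn_remove[of ?L w "k b", where 'k = 'k] ksgn_insert[of L "k b" w, where 'k = 'k]
        by (cases "w < k b") auto
      then show "contr k (sng (L - {w}, b) (ksgn L w)) = - sng (?L - {w}, b) (ksgn ?L (k b) * ksgn ?L w :: 'k)"
        using False by (simp add: contr_def fscale_single ins mult.commute single_uminus)
    qed
    finally show ?thesis unfolding 1 by (simp add: sum_negf)
  qed
  have "kos (contr k x) + contr k (kos x) =
      lin_ext (\<lambda>z. kos (contr k (sng z 1)) + contr k (kos (sng z 1))) x"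
    unfolding kos_def contr_def lin_ext_lin_ext
    by (simp add: lin_ext_def fscale_distrib sum.distrib)
  also have "\<dots> = lin_ext (\<lambda>z. sng z 1) x" using * by (intro lin_ext_cong) (metis surj_pair)
  finally show ?thesis by (simp add: lin_ext_single_id)
qed

lemma lookup_ind_vec: "lkp (ind_vec L) i = (if i \<in> (L :: 'n::finite set) then 1 else 0)"
  by (auto simp: ind_vec_def lookup_sum lookup_single when_def)

lemma vle_diff_ind: "L' \<subseteq> L \<Longrightarrow> vle (\<alpha> - ind_vec L) (\<alpha> - ind_vec L')" for L :: "'n::finite set"
  by (auto simp: vle_iff lookup_minus lookup_ind_vec)

lemma nonneg_vec_0 [simp]: "nonneg_vec 0"
  by (simp add: nonneg_vec_def)

lemma ind_vec_empty [simp]: "ind_vec {} = 0"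
  by (simp add: ind_vec_def)

section \<open>Koszul complexes of the quotients, in coordinates of standard elements\<close>

locale koszul_relations = graded_relations J \<beta> N
  for J and \<beta> :: "nat \<Rightarrow> 'n::{finite,linorder} mdeg" and N :: "'n mdeg \<Rightarrow> (nat \<Rightarrow>\<^sub>0 'k::field_char_0) set"
begin

definition nf_kos :: "'n mdeg \<Rightarrow> nat \<Rightarrow> ('n set \<times> nat \<Rightarrow>\<^sub>0 'k) set" where
  "nf_kos \<alpha> p = free_module {(L, j). card L = p \<and> j \<in> std (\<alpha> - ind_vec L)}"

text \<open>Multiplying by \<open>x_w\<close> is the identity on coordinates, but the element may
  stop being standard in the larger degree; hence the reduction in degree
  \<open>\<alpha> - ind_vec (L - {w})\<close>.\<close>

definition nf_kos_diff :: "'n mdeg \<Rightarrow> ('n set \<times> nat \<Rightarrow>\<^sub>0 'k) \<Rightarrow> ('n set \<times> nat \<Rightarrow>\<^sub>0 'k)" where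
  "nf_kos_diff \<alpha> = lin_ext (\<lambda>(L, j). \<Sum>w\<in>L. fscale (ksgn L w) (emb (L - {w}) (nf (\<alpha> - ind_vec (L - {w})) (sng j 1))))"

end

text \<open>A free resolution seen degree by degree: \<open>\<mu>\<close> holds the scalar matrices
  of the boundary maps and \<open>\<nu>\<close> lifts the augmentation to the free module on
  \<open>J\<close>. The last two conditions are therefore stated modulo \<open>N a\<close>.\<close>

locale scalar_resolution = koszul_relations J \<beta> N
  for J and \<beta> :: "nat \<Rightarrow> 'n::{finite,linorder} mdeg" and N :: "'n mdeg \<Rightarrow> (nat \<Rightarrow>\<^sub>0 'k::field_char_0) set" +
  fixes B :: "nat \<Rightarrow> nat set" and g :: "nat \<Rightarrow> nat \<Rightarrow> 'n mdeg"
    and \<mu> :: "nat \<Rightarrow> nat \<Rightarrow> (nat \<Rightarrow>\<^sub>0 'k)" and \<nu> :: "nat \<Rightarrow> (nat \<Rightarrow>\<^sub>0 'k)"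
  assumes finite_B: "\<And>q. finite (B q)"
    and \<mu>_in: "\<And>q b. b \<in> B (Suc q) \<Longrightarrow> \<mu> q b \<in> free_module {c \<in> B q. vle (g q c) (g (Suc q) b)}"
    and \<nu>_in: "\<And>b. b \<in> B 0 \<Longrightarrow> \<nu> b \<in> free_module {i \<in> J. vle (\<beta> i) (g 0 b)}"
    and exact: "\<And>q a. {x \<in> free_module {b \<in> B (Suc q). vle (g (Suc q) b) a}. lin_ext (\<mu> q) x = 0} =
      lin_ext (\<mu> (Suc q)) ` free_module {b \<in> B (Suc (Suc q)). vle (g (Suc (Suc q)) b) a}"
    and exact0: "\<And>a. {x \<in> free_module {b \<in> B 0. vle (g 0 b) a}. lin_ext \<nu> x \<in> N a} =
      lin_ext (\<mu> 0) ` free_module {b \<in> B (Suc 0). vle (g (Suc 0) b) a}"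
    and onto: "\<And>a z. z \<in> free_module {i \<in> J. vle (\<beta> i) a} \<Longrightarrow>
      \<exists>x \<in> free_module {b \<in> B 0. vle (g 0 b) a}. z - lin_ext \<nu> x \<in> N a"
begin

context
  fixes \<alpha> :: "'n mdeg"
begin

definition Bd :: "nat \<Rightarrow> 'n set \<Rightarrow> nat set" where
  "Bd q L = {b \<in> B q. vle (g q b) (\<alpha> - ind_vec L)}"

text \<open>The degree \<alpha> part of the p-th Koszul module tensored with the q-th module of the
  resolution.\<close>

definition dbl :: "nat \<Rightarrow> nat \<Rightarrow> ('n set \<times> nat \<Rightarrow>\<^sub>0 'k) set" where
  "dbl p q = free_module {(L, b). card L = p \<and> b \<in> Bd q L}"

text \<open>Tensoring with the residue field in degree \<alpha>: a basis element of another degree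
  appears there only with a nonconstant monomial, which becomes 0.\<close>

definition restr :: "nat \<Rightarrow> (nat \<Rightarrow>\<^sub>0 'k) \<Rightarrow> (nat \<Rightarrow>\<^sub>0 'k)" where
  "restr q = lin_ext (\<lambda>b. if g q b = \<alpha> then sng b 1 else 0)"

definition edge :: "nat \<Rightarrow> ('n set \<times> nat \<Rightarrow>\<^sub>0 'k) \<Rightarrow> (nat \<Rightarrow>\<^sub>0 'k)" where
  "edge q = lin_ext (\<lambda>(L, b). if L = {} \<and> g q b = \<alpha> then sng b 1 else 0)"

definition const_part :: "nat \<Rightarrow> (nat \<Rightarrow>\<^sub>0 'k) set" where
  "const_part q = free_module {b \<in> B q. g q b = \<alpha>}"

definition const_diff :: "nat \<Rightarrow> (nat \<Rightarrow>\<^sub>0 'k) \<Rightarrow> (nat \<Rightarrow>\<^sub>0 'k)" where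
  "const_diff q = (case q of 0 \<Rightarrow> (\<lambda>_. 0) | Suc q' \<Rightarrow> lin_ext (\<lambda>b. restr q' (\<mu> q' b)))"

text \<open>The augmentation of the resolution tensored with the Koszul complex, its values being
  represented by normal forms.\<close>

definition \<theta> :: "('n set \<times> nat \<Rightarrow>\<^sub>0 'k) \<Rightarrow> ('n set \<times> nat \<Rightarrow>\<^sub>0 'k)" where
  "\<theta> = fibrewise (\<lambda>L b. nf (\<alpha> - ind_vec L) (\<nu> b))"

lemma \<mu>_maps:
  assumes "x \<in> free_module (Bd (Suc q) L)"
  shows "lin_ext (\<mu> q) x \<in> free_module (Bd q L)"
proof (rule lin_ext_in_free_module)
  fix b assume "b \<in> supp x"
  then have b: "b \<in> B (Suc q)" "vle (g (Suc q) b) (\<alpha> - ind_vec L)"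
    using assms by (auto simp: free_module_def Bd_def)
  have "{c \<in> B q. vle (g q c) (g (Suc q) b)} \<subseteq> Bd q L"
    using vle_trans[OF _ b(2)] by (auto simp: Bd_def)
  then show "\<mu> q b \<in> free_module (Bd q L)" using \<mu>_in[OF b(1)] free_module_mono by blast
qed

lemma \<nu>_V:
  assumes "b \<in> Bd 0 L"
  shows "\<nu> b \<in> V (\<alpha> - ind_vec L)"
proof -
  have b: "b \<in> B 0" "vle (g 0 b) (\<alpha> - ind_vec L)" using assms by (auto simp: Bd_def)
  have "{i \<in> J. vle (\<beta> i) (g 0 b)} \<subseteq> {i \<in> J. vle (\<beta> i) (\<alpha> - ind_vec L)}"
    using vle_trans[OF _ b(2)] by auto
  then show ?thesis using \<nu>_in[OF b(1)] free_module_mono unfolding V_def by blast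
qed

lemma nf_\<nu>:
  assumes "x \<in> free_module (Bd 0 L)"
  shows "lin_ext (\<lambda>b. nf (\<alpha> - ind_vec L) (\<nu> b)) x = nf (\<alpha> - ind_vec L) (lin_ext \<nu> x)"
    "lin_ext \<nu> x \<in> V (\<alpha> - ind_vec L)"
proof -
  have *: "\<nu> b \<in> V (\<alpha> - ind_vec L)" if "b \<in> supp x" for b
    using that assms by (intro \<nu>_V) (auto simp: free_module_def)
  then show "lin_ext (\<lambda>b. nf (\<alpha> - ind_vec L) (\<nu> b)) x = nf (\<alpha> - ind_vec L) (lin_ext \<nu> x)"
    by (simp add: nf_lin_ext)
  show "lin_ext \<nu> x \<in> V (\<alpha> - ind_vec L)" using * by (intro lin_ext_in[OF subspace_V])
qed

lemma restr_edge: "edge q (emb {} y) = restr q y"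
  unfolding edge_def emb_def restr_def lin_ext_lin_ext by simp

lemma nf_kos_diff_emb:
  assumes "y \<in> V (\<alpha> - ind_vec L)"
  shows "nf_kos_diff \<alpha> (emb L y) = (\<Sum>w\<in>L. fscale (ksgn L w) (emb (L - {w}) (nf (\<alpha> - ind_vec (L - {w})) y)))"
proof -
  have "nf_kos_diff \<alpha> (emb L y) =
      lin_ext (\<lambda>j. \<Sum>w\<in>L. fscale (ksgn L w) (emb (L - {w}) (nf (\<alpha> - ind_vec (L - {w})) (sng j 1)))) y"
    unfolding emb_def[of L] nf_kos_diff_def lin_ext_lin_ext by simp
  also have "\<dots> = (\<Sum>w\<in>L. fscale (ksgn L w)
      (lin_ext (\<lambda>j. emb (L - {w}) (nf (\<alpha> - ind_vec (L - {w})) (sng j 1))) y))"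
    unfolding lin_ext_def fscale_sum fscale_distrib by (subst sum.swap) (simp add: mult.commute)
  also have "\<dots> = (\<Sum>w\<in>L. fscale (ksgn L w) (emb (L - {w}) (nf (\<alpha> - ind_vec (L - {w})) y)))"
  proof (intro sum.cong refl)
    fix w
    have "y \<in> V (\<alpha> - ind_vec (L - {w}))" using assms V_mono[OF vle_diff_ind[of "L - {w}" L]] by blast
    then have *: "nf (\<alpha> - ind_vec (L - {w})) y = lin_ext (\<lambda>j. nf (\<alpha> - ind_vec (L - {w})) (sng j 1)) y"
      by (rule nf_basis)
    show "fscale (ksgn L w) (lin_ext (\<lambda>j. emb (L - {w}) (nf (\<alpha> - ind_vec (L - {w})) (sng j 1))) y) =
        fscale (ksgn L w) (emb (L - {w}) (nf (\<alpha> - ind_vec (L - {w})) y))"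
      unfolding * by (simp add: emb_def lin_ext_lin_ext)
  qed
  finally show ?thesis .
qed

lemma finite_cells: "finite {(L, b). card L = p \<and> b \<in> Bd q L}"
  by (rule finite_subset[of _ "UNIV \<times> B q"]) (auto simp: finite_B Bd_def)

lemma keys_dbl: "x \<in> dbl p q \<Longrightarrow> (L, b) \<in> supp x \<Longrightarrow> card L = p \<and> b \<in> B q \<and> vle (g q b) (\<alpha> - ind_vec L)"
  by (auto simp: dbl_def free_module_def Bd_def)

lemma kos_in:
  assumes "x \<in> dbl (Suc p) q"
  shows "kos x \<in> dbl p q"
  unfolding kos_def dbl_def
proof (rule lin_ext_in_free_module, clarify)
  fix L b assume "(L, b) \<in> supp x"
  then have *: "card L = Suc p" "b \<in> B q" "vle (g q b) (\<alpha> - ind_vec L)" using keys_dbl[OF assms] by auto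
  have "b \<in> Bd q (L - {w})" for w
    using vle_trans[OF *(3) vle_diff_ind[of "L - {w}" L]] *(2) by (auto simp: Bd_def)
  then show "(\<Sum>w\<in>L. sng (L - {w}, b) (ksgn L w)) \<in> free_module {(L, b). card L = p \<and> b \<in> Bd q L}"
    using *(1) by (intro free_module_sum single_in_free_module) auto
qed

text \<open>At \<open>k b\<close> the degree of \<open>b\<close> lies strictly below \<alpha>, so
  there is room to add \<open>k b\<close> to L and still stay above the degree of
  \<open>b\<close>.\<close>

lemma contr_in:
  assumes x: "x \<in> dbl p q" and ne: "\<And>L b. (L, b) \<in> supp x \<Longrightarrow> g q b \<noteq> \<alpha>"
    and k: "\<And>b. vle (g q b) \<alpha> \<Longrightarrow> g q b \<noteq> \<alpha> \<Longrightarrow> lkp (g q b) (k b) < lkp \<alpha> (k b)"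
  shows "contr k x \<in> dbl (Suc p) q"
  unfolding contr_def dbl_def
proof (rule lin_ext_in_free_module, clarify)
  fix L b assume *: "(L, b) \<in> supp x"
  then have "card L = p" "b \<in> B q" and v: "vle (g q b) (\<alpha> - ind_vec L)" using keys_dbl[OF x] by auto
  have "vle (\<alpha> - ind_vec L) \<alpha>" using vle_diff_ind[of "{}" L \<alpha>] by (simp add: ind_vec_def)
  then have lt: "lkp (g q b) (k b) < lkp \<alpha> (k b)" using k ne[OF *] vle_trans[OF v] by blast
  have "vle (g q b) (\<alpha> - ind_vec (insert (k b) L))"
    using v lt by (auto simp: vle_iff lookup_minus lookup_ind_vec split: if_splits)
  then show "(if k b \<in> L then 0 else sng (insert (k b) L, b) (ksgn (insert (k b) L) (k b)))
      \<in> free_module {(L, b). card L = Suc p \<and> b \<in> Bd q L}"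
    using \<open>card L = p\<close> \<open>b \<in> B q\<close>
    by (auto simp: free_module_zero Bd_def intro!: single_in_free_module)
qed

lemma contr_vertex: "\<exists>k. \<forall>b. vle (g q b) \<alpha> \<longrightarrow> g q b \<noteq> \<alpha> \<longrightarrow> lkp (g q b) (k b) < lkp \<alpha> (k b)"
proof -
  have "\<exists>i. lkp (g q b) i < lkp \<alpha> i" if "vle (g q b) \<alpha>" "g q b \<noteq> \<alpha>" for b
    using that vle_antisym[OF that(1)] unfolding vle_iff by (meson not_le)
  then show ?thesis by metis
qed

text \<open>A nonempty L excludes basis elements of degree exactly \<alpha>. All remaining ones have
  a coordinate with room, so the cone contraction applies.\<close>

lemma row_exact: "{x \<in> dbl (Suc p) q. kos x = 0} = kos ` dbl (Suc (Suc p)) q"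
proof safe
  fix x assume x: "x \<in> dbl (Suc p) q" "kos x = 0"
  obtain k where k: "\<And>b. vle (g q b) \<alpha> \<Longrightarrow> g q b \<noteq> \<alpha> \<Longrightarrow> lkp (g q b) (k b) < lkp \<alpha> (k b)"
    using contr_vertex[of q] by blast
  have ne: "g q b \<noteq> \<alpha>" if "(L, b) \<in> supp x" for L b
  proof
    assume eq: "g q b = \<alpha>"
    have *: "card L = Suc p" "vle \<alpha> (\<alpha> - ind_vec L)" using keys_dbl[OF x(1) that] eq by auto
    then obtain w where "w \<in> L" by (metis card.empty all_not_in_conv nat.distinct(1))
    moreover have "lkp \<alpha> w \<le> lkp (\<alpha> - ind_vec L) w" using *(2) unfolding vle_iff by blast
    ultimately show False by (simp add: lookup_minus lookup_ind_vec)
  qed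
  have "x = kos (contr k x)" using contr_homotopy[of k x] x(2) by (simp add: contr_def)
  moreover have "contr k x \<in> dbl (Suc (Suc p)) q" by (rule contr_in[OF x(1)]) (use ne k in blast)+
  ultimately show "x \<in> kos ` dbl (Suc (Suc p)) q" by blast
qed (auto simp: kos_kos intro: kos_in)

text \<open>With L empty, basis elements of degree \<alpha> do occur; they are precisely what
  \<open>edge\<close> detects, and on its kernel the contraction works as before. They are never hit
  from one-element sets L, for degree reasons.\<close>

lemma row0_exact: "{x \<in> dbl 0 q. edge q x = 0} = kos ` dbl (Suc 0) q"
proof safe
  fix x assume x: "x \<in> dbl 0 q" "edge q x = 0"
  obtain k where k: "\<And>b. vle (g q b) \<alpha> \<Longrightarrow> g q b \<noteq> \<alpha> \<Longrightarrow> lkp (g q b) (k b) < lkp \<alpha> (k b)"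
    using contr_vertex[of q] by blast
  have empty: "L = {}" if "(L, b) \<in> supp x" for L b
    using keys_dbl[OF x(1) that] by (simp add: card_eq_0_iff)
  have ne: "g q b \<noteq> \<alpha>" if L: "(L, b) \<in> supp x" for L b
  proof
    assume eq: "g q b = \<alpha>"
    have "lkp (edge q x) b = (\<Sum>z\<in>supp x. if z = ({}, b) then lkp x ({}, b) else 0)"
      unfolding edge_def lookup_lin_ext[OF finite_keys order_refl] using eq empty
      by (intro sum.cong) (auto simp: lookup_single when_def split: prod.splits)
    then have "lkp (edge q x) b = lkp x ({}, b)" by (auto simp: in_keys_iff)
    then show False using x(2) L empty[OF L] by (simp add: in_keys_iff)
  qed
  have "kos x = lin_ext (\<lambda>_. 0) x"
    unfolding kos_def by (intro lin_ext_cong) (auto dest: empty)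
  then have "kos x = 0" by (simp add: lin_ext_def)
  then have "x = kos (contr k x)" using contr_homotopy[of k x] by (simp add: contr_def)
  moreover have "contr k x \<in> dbl (Suc 0) q" by (rule contr_in[OF x(1)]) (use ne k in blast)+
  ultimately show "x \<in> kos ` dbl (Suc 0) q" by blast
next
  fix y assume y: "y \<in> dbl (Suc 0) q"
  show "kos y \<in> dbl 0 q" using y by (rule kos_in)
  have "edge q (kos y) = lin_ext (\<lambda>_. 0) y"
    unfolding edge_def kos_def lin_ext_lin_ext
  proof (intro lin_ext_cong, clarify)
    fix L b assume "(L, b) \<in> supp y"
    then have *: "card L = Suc 0" "vle (g q b) (\<alpha> - ind_vec L)" using keys_dbl[OF y] by auto
    then obtain w where w: "L = {w}" by (metis One_nat_def card_1_singletonE)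
    have "g q b \<noteq> \<alpha>"
      using *(2) unfolding w by (auto simp: vle_iff lookup_minus lookup_ind_vec dest: spec[of _ w])
    then show "lin_ext (\<lambda>(L, b). if L = {} \<and> g q b = \<alpha> then sng b 1 else 0) (\<Sum>w\<in>L. sng (L - {w}, b) (ksgn L w)) = 0"
      by (simp add: w)
  qed
  then show "edge q (kos y) = 0" by (simp add: lin_ext_def)
qed

lemma edge_onto: "edge q ` dbl 0 q = const_part q"
proof safe
  fix x assume x: "x \<in> dbl 0 q"
  show "edge q x \<in> const_part q"
    unfolding edge_def const_part_def using keys_dbl[OF x]
    by (intro lin_ext_in_free_module) (auto simp: free_module_zero intro!: single_in_free_module split: prod.splits)
next
  fix y assume y: "y \<in> const_part q"
  have "restr q y = lin_ext (\<lambda>b. sng b 1) y"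
    unfolding restr_def using y by (intro lin_ext_cong) (auto simp: const_part_def free_module_def)
  then have "y = edge q (emb {} y)" by (simp add: restr_edge lin_ext_single_id)
  moreover have "emb {} y \<in> dbl 0 q"
  proof -
    have "emb {} y \<in> free_module ({{}} \<times> {b \<in> B q. g q b = \<alpha>})"
      by (rule emb_in_free_module) (use y in \<open>simp add: const_part_def\<close>)
    moreover have "{{}} \<times> {b \<in> B q. g q b = \<alpha>} \<subseteq> {(L, b). card L = 0 \<and> b \<in> Bd q L}"
      by (auto simp: Bd_def)
    ultimately show ?thesis unfolding dbl_def using free_module_mono by blast
  qed
  ultimately show "y \<in> edge q ` dbl 0 q" by blast
qed

lemma col_exact: "{x \<in> dbl p (Suc q). fibrewise (\<lambda>_. \<mu> q) x = 0} = fibrewise (\<lambda>_. \<mu> (Suc q)) ` dbl p (Suc (Suc q))"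
proof -
  have *: "lin_ext (\<mu> (Suc q)) ` free_module (Bd (Suc (Suc q)) L) =
      {x \<in> free_module (Bd (Suc q) L). lin_ext (\<mu> q) x = 0}" for L
    unfolding Bd_def by (rule exact[symmetric])
  show ?thesis unfolding dbl_def
    by (subst fibrewise_image[where X = "\<lambda>L. {x \<in> free_module (Bd (Suc q) L). lin_ext (\<mu> q) x = 0}"])
      (simp_all only: * fibrewise_kernel)
qed

lemma v_in:
  assumes "x \<in> dbl p (Suc q)"
  shows "fibrewise (\<lambda>_. \<mu> q) x \<in> dbl p q"
  using assms unfolding dbl_def in_cells_iff slice_fibrewise by (auto intro: \<mu>_maps)

lemma col0_exact: "{x \<in> dbl p 0. \<theta> x = 0} = fibrewise (\<lambda>_. \<mu> 0) ` dbl p (Suc 0)"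
proof -
  let ?X = "\<lambda>L. {x \<in> free_module (Bd 0 L). lin_ext (\<lambda>b. nf (\<alpha> - ind_vec L) (\<nu> b)) x = 0}"
  have *: "lin_ext (\<mu> 0) ` free_module (Bd (Suc 0) L) = ?X L" for L
  proof -
    have "?X L = {x \<in> free_module (Bd 0 L). lin_ext \<nu> x \<in> N (\<alpha> - ind_vec L)}"
      using nf_\<nu>[of _ L] nf_eq_0_iff by auto
    then show ?thesis unfolding Bd_def exact0 by simp
  qed
  show ?thesis unfolding dbl_def \<theta>_def
    by (subst fibrewise_image[where X = ?X]) (simp_all only: * fibrewise_kernel)
qed

lemma \<theta>_onto: "\<theta> ` dbl p 0 = nf_kos \<alpha> p"
proof -
  have *: "lin_ext (\<lambda>b. nf (\<alpha> - ind_vec L) (\<nu> b)) ` free_module (Bd 0 L) = free_module (std (\<alpha> - ind_vec L))" for L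
  proof safe
    fix x :: "nat \<Rightarrow>\<^sub>0 'k" assume "x \<in> free_module (Bd 0 L)"
    then show "lin_ext (\<lambda>b. nf (\<alpha> - ind_vec L) (\<nu> b)) x \<in> free_module (std (\<alpha> - ind_vec L))"
      using nf_props(1) by (simp add: nf_\<nu>)
  next
    fix y :: "nat \<Rightarrow>\<^sub>0 'k" assume y: "y \<in> free_module (std (\<alpha> - ind_vec L))"
    then have "y \<in> V (\<alpha> - ind_vec L)" using std_V by blast
    then obtain x where x: "x \<in> free_module (Bd 0 L)" "y - lin_ext \<nu> x \<in> N (\<alpha> - ind_vec L)"
      using onto unfolding V_def Bd_def by blast
    have "lin_ext \<nu> x - y \<in> N (\<alpha> - ind_vec L)"
      using fs.subspace_neg[OF subspace_N x(2)] by simp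
    then have "y = lin_ext (\<lambda>b. nf (\<alpha> - ind_vec L) (\<nu> b)) x"
      using nf_eqI[OF y] nf_\<nu>[OF x(1)] by simp
    then show "y \<in> lin_ext (\<lambda>b. nf (\<alpha> - ind_vec L) (\<nu> b)) ` free_module (Bd 0 L)" using x(1) by blast
  qed
  show ?thesis
    unfolding dbl_def \<theta>_def nf_kos_def
    unfolding fibrewise_image[where P = "\<lambda>L. card L = p" and B = "Bd 0", OF *] set_eq_iff in_cells_iff mem_Collect_eq
    by (metis free_module_zero)
qed

text \<open>The composite through \<open>\<theta>\<close> reduces before and after multiplying by
  \<open>x_w\<close>; by \<open>nf_nf\<close> the first reduction makes no difference.\<close>

lemma nf_kos_diff_\<theta>:
  assumes "x \<in> dbl p 0"
  shows "\<theta> (kos x) = nf_kos_diff \<alpha> (\<theta> x)"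
proof -
  have "\<theta> (kos x) = lin_ext (\<lambda>(L, b). \<theta> (\<Sum>w\<in>L. sng (L - {w}, b) (ksgn L w))) x"
    unfolding \<theta>_def kos_def fibrewise_def lin_ext_lin_ext by (intro lin_ext_cong) auto
  also have "\<dots> = lin_ext (\<lambda>(L, b). nf_kos_diff \<alpha> (emb L (nf (\<alpha> - ind_vec L) (\<nu> b)))) x"
  proof (intro lin_ext_cong, clarify)
    fix L b assume "(L, b) \<in> supp x"
    then have b: "b \<in> Bd 0 L" using keys_dbl[OF assms] by (auto simp: Bd_def)
    have "nf_kos_diff \<alpha> (emb L (nf (\<alpha> - ind_vec L) (\<nu> b))) =
        (\<Sum>w\<in>L. fscale (ksgn L w) (emb (L - {w}) (nf (\<alpha> - ind_vec (L - {w})) (\<nu> b))))"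
      using nf_props(1)[OF \<nu>_V[OF b]] std_V nf_nf[OF vle_diff_ind \<nu>_V[OF b]]
      by (subst nf_kos_diff_emb) (blast, intro sum.cong, auto)
    then show "\<theta> (\<Sum>w\<in>L. sng (L - {w}, b) (ksgn L w)) = nf_kos_diff \<alpha> (emb L (nf (\<alpha> - ind_vec L) (\<nu> b)))"
      by (simp add: \<theta>_def fibrewise_def lin_ext_sum)
  qed
  also have "\<dots> = nf_kos_diff \<alpha> (\<theta> x)"
    unfolding \<theta>_def fibrewise_def nf_kos_diff_def lin_ext_lin_ext by (intro lin_ext_cong) auto
  finally show ?thesis .
qed

lemma const_diff_edge:
  assumes "x \<in> dbl 0 (Suc q)"
  shows "edge q (fibrewise (\<lambda>_. \<mu> q) x) = const_diff (Suc q) (edge (Suc q) x)"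
proof -
  have "edge q (fibrewise (\<lambda>_. \<mu> q) x) = lin_ext (\<lambda>(L, b). edge q (emb L (\<mu> q b))) x"
    unfolding edge_def fibrewise_def lin_ext_lin_ext by (intro lin_ext_cong) auto
  also have "\<dots> = lin_ext (\<lambda>(L, b). const_diff (Suc q) (if L = {} \<and> g (Suc q) b = \<alpha> then sng b 1 else 0)) x"
  proof (intro lin_ext_cong, clarify)
    fix L b assume "(L, b) \<in> supp x"
    then have L: "L = {}" and b: "b \<in> B (Suc q)" "vle (g (Suc q) b) (\<alpha> - ind_vec L)"
      using keys_dbl[OF assms] by (auto simp: card_eq_0_iff)
    \<comment> \<open>A target \<open>c\<close> of degree \<alpha> would squeeze the degree of
      \<open>b\<close> between \<alpha> and \<alpha>.\<close>
    have "restr q (\<mu> q b) = 0" if "g (Suc q) b \<noteq> \<alpha>"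
    proof -
      have "g q c \<noteq> \<alpha>" if "c \<in> supp (\<mu> q b)" for c
      proof
        assume "g q c = \<alpha>"
        moreover have "vle (g q c) (g (Suc q) b)" using \<mu>_in[OF b(1)] that by (auto simp: free_module_def)
        ultimately show False using b(2) L \<open>g (Suc q) b \<noteq> \<alpha>\<close> vle_antisym by (auto simp: ind_vec_def)
      qed
      then have "restr q (\<mu> q b) = lin_ext (\<lambda>_. 0) (\<mu> q b)"
        unfolding restr_def by (intro lin_ext_cong) auto
      then show ?thesis by (simp add: lin_ext_def)
    qed
    then show "edge q (emb L (\<mu> q b)) = const_diff (Suc q) (if L = {} \<and> g (Suc q) b = \<alpha> then sng b 1 else 0)"
      using L by (auto simp: restr_edge const_diff_def)
  qed
  also have "\<dots> = const_diff (Suc q) (edge (Suc q) x)"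
    unfolding edge_def const_diff_def by (simp add: lin_ext_lin_ext) (intro lin_ext_cong, auto)
  finally show ?thesis .
qed

lemma nf_kos_diff_0: "y \<in> nf_kos \<alpha> 0 \<Longrightarrow> nf_kos_diff \<alpha> y = 0"
proof -
  assume "y \<in> nf_kos \<alpha> 0"
  then have "nf_kos_diff \<alpha> y = lin_ext (\<lambda>_. 0) y"
    unfolding nf_kos_diff_def by (intro lin_ext_cong) (auto simp: nf_kos_def free_module_def card_eq_0_iff)
  then show ?thesis by (simp add: lin_ext_def)
qed

text \<open>The right-hand side does not mention the resolution, so every resolution in this scalar
  form gives the same numbers.\<close>

theorem tor_eq_koszul:
  "homology_dim (const_part i) (const_diff i) (const_part (Suc i)) (const_diff (Suc i)) = homology_dim (nf_kos \<alpha> i) (nf_kos_diff \<alpha>) (nf_kos \<alpha> (Suc i)) (nf_kos_diff \<alpha>)"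
proof -
  interpret dc: double_complex dbl kos "\<lambda>q. fibrewise (\<lambda>_. \<mu> q)" edge const_part const_diff \<theta> "nf_kos \<alpha>" "nf_kos_diff \<alpha>"
  proof (rule double_complex.intro)
    show "fin_sub (dbl p q)" for p q
      unfolding dbl_def by (intro fin_sub_free_module finite_cells)
    show "linear_map (edge q)" for q
      unfolding edge_def by (rule linear_lin_ext)
    show "linear_map \<theta>"
      unfolding \<theta>_def by (rule linear_fibrewise)
    show "fibrewise (\<lambda>_. \<mu> q) (kos x) = kos (fibrewise (\<lambda>_. \<mu> q) x)" for q x
      by (rule kos_fibrewise[symmetric])
    show "const_diff 0 y = 0" for y by (simp add: const_diff_def)
  qed (fact linear_kos linear_fibrewise kos_in v_in row_exact col_exact row0_exact col0_exact
      edge_onto \<theta>_onto const_diff_edge nf_kos_diff_\<theta> nf_kos_diff_0)+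
  show ?thesis unfolding homology_dim_def by (rule dc.edges_homology_eq)
qed

end

end

section \<open>The cokernel of a squarefree matrix\<close>

locale squarefree_presentation =
  fixes A :: "('n::{finite,linorder}, 'k::field_char_0) term_matrix" and \<gamma> \<beta> :: "nat \<Rightarrow> 'n mdeg"
  assumes sol: "squarefree_solution A \<gamma> \<beta>"
begin

definition scol :: "nat \<Rightarrow> (nat \<Rightarrow>\<^sub>0 'k)" where
  "scol j = (\<Sum>i=1..nrows A. sng i (coef A i j))"

definition pcol :: "nat \<Rightarrow> (nat \<Rightarrow>\<^sub>0 ('n, 'k) mpoly)" where
  "pcol j = (\<Sum>i=1..nrows A. sng i (entry A i j))"

text \<open>The degree \<open>a\<close> part of the image of \<open>phi A\<close>, in coordinates: a
  column contributes a one-dimensional multiple as soon as its degree is at most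
  \<open>a\<close>.\<close>

definition rel :: "'n mdeg \<Rightarrow> (nat \<Rightarrow>\<^sub>0 'k) set" where
  "rel a = lin_ext scol ` free_module {j \<in> {1..ncols A}. vle (\<gamma> j) a}"

lemma lookup_scol: "lkp (scol j) i = (coef A i j when i \<in> {1..nrows A})"
  by (auto simp: scol_def lookup_sum lookup_single when_def)

lemma pcol_free: "pcol j \<in> free_module {1..nrows A}"
  unfolding pcol_def by (intro free_module_sum single_in_free_module)

lemma scol_in:
  assumes "j \<in> {1..ncols A}"
  shows "scol j \<in> free_module {i \<in> {1..nrows A}. vle (\<beta> i) (\<gamma> j)}"
proof (rule in_free_moduleI)
  fix i assume "lkp (scol j) i \<noteq> 0"
  then have i: "i \<in> {1..nrows A}" "coef A i j \<noteq> 0" by (auto simp: lookup_scol)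
  then have "\<gamma> j - \<beta> i = int_vec (expn A i j)"
    using sol assms by (auto simp: squarefree_solution_def is_solution_def)
  then show "i \<in> {i \<in> {1..nrows A}. vle (\<beta> i) (\<gamma> j)}" using i by simp
qed

lemma pcol_eq:
  assumes "j \<in> {1..ncols A}"
  shows "pcol j = homog \<beta> (\<gamma> j) (scol j)"
  unfolding pcol_def scol_def homog_sum homog_single
proof (intro sum.cong refl)
  fix i assume i: "i \<in> {1..nrows A}"
  show "sng i (entry A i j) = sng i (sng (nat_vec (\<gamma> j - \<beta> i)) (coef A i j))"
  proof (cases "coef A i j = 0")
    case False
    then have "\<gamma> j - \<beta> i = int_vec (expn A i j)"
      using sol assms i by (auto simp: squarefree_solution_def is_solution_def)
    then show ?thesis by (simp add: entry_def)
  qed (simp add: entry_def)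
qed

lemma encodes_col: "encodes {1..ncols A} \<gamma> \<beta> scol pcol"
  unfolding encodes_def
proof (intro ballI conjI)
  fix j assume j: "j \<in> {1..ncols A}"
  show "pcol j = homog \<beta> (\<gamma> j) (scol j)" by (rule pcol_eq[OF j])
  show "scol j \<in> free_module {i. vle (\<beta> i) (\<gamma> j)}"
    using scol_in[OF j] free_module_mono[of "{i \<in> {1..nrows A}. vle (\<beta> i) (\<gamma> j)}" "{i. vle (\<beta> i) (\<gamma> j)}"]
    by blast
qed

lemma im_phi_eq: "im_phi A = lin_ext pcol ` free_module {1..ncols A}"
  by (simp add: im_phi_def phi_def pcol_def[abs_def])

lemma im_phi_0: "0 \<in> im_phi A"
  unfolding im_phi_eq by (rule image_eqI[of _ _ 0]) (simp_all add: free_module_zero)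

lemma im_phi_add: "f \<in> im_phi A \<Longrightarrow> g \<in> im_phi A \<Longrightarrow> f + g \<in> im_phi A"
  unfolding im_phi_eq by (auto simp: free_module_add simp flip: lin_ext_add)

lemma im_phi_diff: "f \<in> im_phi A \<Longrightarrow> g \<in> im_phi A \<Longrightarrow> f - g \<in> im_phi A"
  unfolding im_phi_eq by (auto simp: free_module_diff simp flip: lin_ext_diff)

lemma im_phi_fscale: "f \<in> im_phi A \<Longrightarrow> fscale p f \<in> im_phi A"
  unfolding im_phi_eq by (auto simp: free_module_scale simp flip: lin_ext_fscale)

lemma gcomp_im_phi: "f \<in> im_phi A \<Longrightarrow> gcomp \<beta> a f \<in> rel a"
  unfolding im_phi_eq rel_def using encodes_gcomp[OF encodes_col] gcomp_in by blast

lemma homog_rel: "y \<in> rel a \<Longrightarrow> homog \<beta> a y \<in> im_phi A"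
proof -
  assume "y \<in> rel a"
  then obtain x where x: "x \<in> free_module {j \<in> {1..ncols A}. vle (\<gamma> j) a}" "y = lin_ext scol x"
    by (auto simp: rel_def)
  have "homog \<gamma> a x \<in> free_module {1..ncols A}"
    using homog_in_free_comp[OF x(1)] by (simp add: free_comp_def)
  then show ?thesis
    unfolding im_phi_eq x(2) encodes_homog[OF encodes_col x(1), symmetric] by (rule imageI)
qed

lemma homog_in_im_phi_iff:
  assumes "x \<in> free_module {i. vle (\<beta> i) a}"
  shows "homog \<beta> a x \<in> im_phi A \<longleftrightarrow> x \<in> rel a"
  using gcomp_im_phi[of "homog \<beta> a x" a] homog_rel[of x a] gcomp_homog[OF assms, of a] by auto

sublocale koszul_relations "{1..nrows A}" \<beta> rel
proof
  show "finite {1..nrows A}" by simp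
  show "fs.subspace (rel a)" for a
    unfolding rel_def by (intro subspace_image_lin linear_lin_ext subspace_free_module)
  show "rel a \<subseteq> free_module {i \<in> {1..nrows A}. vle (\<beta> i) a}" for a
  proof safe
    fix y assume "y \<in> rel a"
    then obtain x where x: "x \<in> free_module {j \<in> {1..ncols A}. vle (\<gamma> j) a}" "y = lin_ext scol x"
      by (auto simp: rel_def)
    show "y \<in> free_module {i \<in> {1..nrows A}. vle (\<beta> i) a}"
      unfolding x(2)
    proof (rule lin_ext_in_free_module)
      fix j assume "j \<in> supp x"
      then have j: "j \<in> {1..ncols A}" "vle (\<gamma> j) a" using x(1) by (auto simp: free_module_def)
      have "{i \<in> {1..nrows A}. vle (\<beta> i) (\<gamma> j)} \<subseteq> {i \<in> {1..nrows A}. vle (\<beta> i) a}"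
        using vle_trans[OF _ j(2)] by auto
      then show "scol j \<in> free_module {i \<in> {1..nrows A}. vle (\<beta> i) a}"
        using scol_in[OF j(1)] free_module_mono by blast
    qed
  qed
  show "rel a \<subseteq> rel b" if "vle a b" for a b
    unfolding rel_def by (intro image_mono free_module_mono) (use vle_trans[OF _ that] in auto)
qed

lemma coset_eq_iff: "coset (im_phi A) f = coset (im_phi A) g \<longleftrightarrow> f - g \<in> im_phi A"
proof
  assume "coset (im_phi A) f = coset (im_phi A) g"
  moreover have "f \<in> coset (im_phi A) f" unfolding coset_def by (rule image_eqI[OF _ im_phi_0]) simp
  ultimately obtain v where "v \<in> im_phi A" "f = g + v" by (auto simp: coset_def)
  then show "f - g \<in> im_phi A" by simp
next
  assume fg: "f - g \<in> im_phi A"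
  show "coset (im_phi A) f = coset (im_phi A) g"
    unfolding coset_def
  proof (intro subset_antisym image_subsetI)
    fix v assume v: "v \<in> im_phi A"
    show "f + v \<in> (+) g ` im_phi A"
      by (rule image_eqI[OF _ im_phi_add[OF fg v]]) simp
    show "g + v \<in> (+) f ` im_phi A"
      by (rule image_eqI[OF _ im_phi_diff[OF v fg]]) simp
  qed
qed

lemma coset_0: "coset (im_phi A) 0 = im_phi A"
  by (simp add: coset_def)

lemma coset_add: "coset (im_phi A) f \<oplus>\<^bsub>coker_module A \<beta>\<^esub> coset (im_phi A) g = coset (im_phi A) (f + g)"
proof -
  have "{x + y |x y. x \<in> coset (im_phi A) f \<and> y \<in> coset (im_phi A) g} = coset (im_phi A) (f + g)"
  proof safe
    fix x y assume "x \<in> coset (im_phi A) f" "y \<in> coset (im_phi A) g"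
    then obtain v w where "v \<in> im_phi A" "w \<in> im_phi A" "x = f + v" "y = g + w"
      by (auto simp: coset_def)
    then have "x + y = f + g + (v + w)" "v + w \<in> im_phi A" by (simp_all add: im_phi_add)
    then show "x + y \<in> coset (im_phi A) (f + g)" unfolding coset_def by blast
  next
    fix z assume "z \<in> coset (im_phi A) (f + g)"
    then obtain v where v: "v \<in> im_phi A" "z = f + g + v" by (auto simp: coset_def)
    then have "z = (f + 0) + (g + v)" by simp
    then show "\<exists>x y. z = x + y \<and> x \<in> coset (im_phi A) f \<and> y \<in> coset (im_phi A) g"
      using v(1) im_phi_0 unfolding coset_def by blast
  qed
  then show ?thesis by (simp add: coker_module_def)
qed

lemma coset_smult: "p \<odot>\<^bsub>coker_module A \<beta>\<^esub> coset (im_phi A) f = coset (im_phi A) (fscale p f)"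
proof -
  have "{fscale p x + v |x v. x \<in> coset (im_phi A) f \<and> v \<in> im_phi A} = coset (im_phi A) (fscale p f)"
  proof safe
    fix x v assume "x \<in> coset (im_phi A) f" and v: "v \<in> im_phi A"
    then obtain w where w: "w \<in> im_phi A" "x = f + w" by (auto simp: coset_def)
    have "fscale p x + v = fscale p f + (fscale p w + v)" by (simp add: w fscale_distrib)
    moreover have "fscale p w + v \<in> im_phi A" using w v by (simp add: im_phi_add im_phi_fscale)
    ultimately show "fscale p x + v \<in> coset (im_phi A) (fscale p f)" unfolding coset_def by blast
  next
    fix z assume "z \<in> coset (im_phi A) (fscale p f)"
    then obtain v where v: "v \<in> im_phi A" "z = fscale p f + v" by (auto simp: coset_def)
    moreover have "f \<in> coset (im_phi A) f" unfolding coset_def by (rule image_eqI[OF _ im_phi_0]) simp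
    ultimately show "\<exists>x v. z = fscale p x + v \<and> x \<in> coset (im_phi A) f \<and> v \<in> im_phi A" by blast
  qed
  then show ?thesis by (simp add: coker_module_def)
qed

lemma homology_dim_cong:
  assumes "\<And>x. x \<in> C \<Longrightarrow> f x = f' x" "\<And>x. x \<in> C' \<Longrightarrow> g x = g' x"
  shows "homology_dim C f C' g = homology_dim C f' C' g'"
proof -
  have "{x \<in> C. f x = 0} = {x \<in> C. f' x = 0}" "g ` C' = g' ` C'" using assms by auto
  then show ?thesis by (simp add: homology_dim_def)
qed

text \<open>A resolution is turned into scalar matrices by lifting its augmentation to the free module
  on the rows.\<close>

lemma resolution_homology:
  assumes F: "is_free_resolution (coker_module A \<beta>) F"
  shows "homology_dim (tensor_term F i \<alpha>) (tensor_diff F i) (tensor_term F (Suc i) \<alpha>) (tensor_diff F (Suc i)) =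
    homology_dim (nf_kos \<alpha> i) (nf_kos_diff \<alpha>) (nf_kos \<alpha> (Suc i)) (nf_kos_diff \<alpha>)"
proof -
  let ?N = "im_phi A" and ?s = "{1..nrows A}"
  have bdry: "\<And>q b. b < rk F (Suc q) \<Longrightarrow> bdry F q b \<in> free_comp {..<rk F q} (bdeg F q) (bdeg F (Suc q) b)"
    and aug_add: "\<And>f g. f \<in> fterm F 0 \<Longrightarrow> g \<in> fterm F 0 \<Longrightarrow> aug F (f + g) = aug F f \<oplus>\<^bsub>coker_module A \<beta>\<^esub> aug F g"
    and aug_smult: "\<And>p f. f \<in> fterm F 0 \<Longrightarrow> aug F (fscale p f) = p \<odot>\<^bsub>coker_module A \<beta>\<^esub> aug F f"
    and aug_deg: "\<And>a. aug F ` free_comp {..<rk F 0} (bdeg F 0) a \<subseteq> coset ?N ` free_comp ?s \<beta> a"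
    and aug_onto: "aug F ` fterm F 0 = coset ?N ` free_module ?s"
    and aug_ker: "{f \<in> fterm F 0. aug F f = ?N} = lin_ext (bdry F 0) ` fterm F 1"
    and F_exact: "\<And>q. {f \<in> fterm F (Suc q). lin_ext (bdry F q) f = 0} = lin_ext (bdry F (Suc q)) ` fterm F (Suc (Suc q))"
    using F unfolding is_free_resolution_def by (auto simp: coker_module_def)
  have "\<exists>h. h \<in> free_comp ?s \<beta> (bdeg F 0 b) \<and> aug F (sng b 1) = coset ?N h" if "b < rk F 0" for b
  proof -
    have "homog (bdeg F 0) (bdeg F 0 b) (sng b (1 :: 'k)) \<in> free_comp {..<rk F 0} (bdeg F 0) (bdeg F 0 b)"
      using that by (intro homog_in_free_comp single_in_free_module) simp
    then have "(sng b 1 :: nat \<Rightarrow>\<^sub>0 ('n, 'k) mpoly) \<in> free_comp {..<rk F 0} (bdeg F 0) (bdeg F 0 b)" by (simp add: homog_single)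
    then show ?thesis using aug_deg by blast
  qed
  then obtain G where G: "\<And>b. b < rk F 0 \<Longrightarrow> G b \<in> free_comp ?s \<beta> (bdeg F 0 b)"
      "\<And>b. b < rk F 0 \<Longrightarrow> aug F (sng b 1) = coset ?N (G b)"
    by metis
  have aug_G: "aug F f = coset ?N (lin_ext G f)" if "f \<in> fterm F 0" for f
  proof -
    have "f \<in> fterm F 0 \<and> aug F f = coset ?N (lin_ext G f)"
      using that
    proof (induction f rule: poly_vector_induct)
      case zero
      have "0 \<in> fterm F 0" by (rule free_module_zero)
      moreover from this obtain x where "aug F 0 = coset ?N x" using aug_onto by blast
      \<comment> \<open>The value at 0 is obtained from 0 as a scalar multiple of itself, using the
        concrete scalar multiplication on cosets.\<close>
      moreover have "aug F (fscale 0 0) = 0 \<odot>\<^bsub>coker_module A \<beta>\<^esub> aug F 0" using calculation(1) by (rule aug_smult)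
      ultimately show ?case by (simp add: coset_smult)
    next
      case (add x y)
      then show ?case by (simp add: aug_add coset_add lin_ext_add free_module_add)
    next
      case (single b u c)
      have b: "sng b 1 \<in> fterm F 0" using single by (intro single_in_free_module)
      have "aug F (fscale (sng u c) (sng b 1)) = coset ?N (fscale (sng u c) (G b))"
        using single by (simp add: aug_smult[OF b] G coset_smult)
      moreover have "sng b (sng u c) \<in> fterm F 0" using single by (intro single_in_free_module)
      ultimately show ?case by (simp add: fscale_single)
    qed
    then show ?thesis by simp
  qed
  define \<mu> where "\<mu> q b = gcomp (bdeg F q) (bdeg F (Suc q) b) (bdry F q b)" for q b
  define \<nu> where "\<nu> b = gcomp \<beta> (bdeg F 0 b) (G b)" for b
  have enc: "encodes {..<rk F (Suc q)} (bdeg F (Suc q)) (bdeg F q) (\<mu> q) (bdry F q)" for q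
    unfolding \<mu>_def using bdry by (intro encodes_free_comp) auto
  have \<mu>_in: "\<mu> q b \<in> free_module {c \<in> {..<rk F q}. vle (bdeg F q c) (bdeg F (Suc q) b)}" if "b \<in> {..<rk F (Suc q)}" for q b
    unfolding \<mu>_def using bdry that by (intro encodes_free_comp(2)[where B = "{..<rk F (Suc q)}"]) auto
  have encG: "encodes {..<rk F 0} (bdeg F 0) \<beta> \<nu> G"
    unfolding \<nu>_def using G by (intro encodes_free_comp) auto
  have \<nu>_in: "\<nu> b \<in> free_module {i \<in> ?s. vle (\<beta> i) (bdeg F 0 b)}" if "b \<in> {..<rk F 0}" for b
    unfolding \<nu>_def using G that by (intro encodes_free_comp(2)[where B = "{..<rk F 0}"]) auto
  have bdry_free: "bdry F q b \<in> fterm F q" if "b \<in> {..<rk F (Suc q)}" for q b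
    using bdry that by (auto simp: free_comp_def)
  have \<mu>_free: "\<mu> q b \<in> free_module {..<rk F q}" if "b \<in> {..<rk F (Suc q)}" for q b
    using \<mu>_in[OF that] free_module_mono[of "{c \<in> {..<rk F q}. vle (bdeg F q c) (bdeg F (Suc q) b)}" "{..<rk F q}"]
    by blast
  have homog_in: "homog (bdeg F q) a x \<in> fterm F q" if "x \<in> free_module {b \<in> {..<rk F q}. vle (bdeg F q b) a}" for q a x
    using homog_in_free_comp[OF that] by (simp add: free_comp_def)
  have gcomp_homog': "gcomp (bdeg F q) a (homog (bdeg F q) a x) = x"
    if "x \<in> free_module {b \<in> {..<rk F q}. vle (bdeg F q b) a}" for q a and x :: "nat \<Rightarrow>\<^sub>0 'k"
    using that free_module_mono[of "{b \<in> {..<rk F q}. vle (bdeg F q b) a}" "{b. vle (bdeg F q b) a}"]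
    by (subst gcomp_homog) auto
  have rel_iff: "lin_ext \<nu> x \<in> rel a \<longleftrightarrow> aug F (homog (bdeg F 0) a x) = ?N"
    if x: "x \<in> free_module {b \<in> {..<rk F 0}. vle (bdeg F 0 b) a}" for x a
  proof -
    have "aug F (homog (bdeg F 0) a x) = ?N \<longleftrightarrow> homog \<beta> a (lin_ext \<nu> x) \<in> ?N"
      unfolding aug_G[OF homog_in[OF x]] encodes_homog[OF encG x]
      using coset_eq_iff[of "homog \<beta> a (lin_ext \<nu> x)" 0] by (simp add: coset_0)
    then show ?thesis using homog_in_im_phi_iff[OF lin_ext_matrix_in[OF encG x]] by simp
  qed
  interpret sr: scalar_resolution "{1..nrows A}" \<beta> rel "\<lambda>q. {..<rk F q}" "bdeg F" \<mu> \<nu>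
  proof
    show "finite {..<rk F q}" for q by simp
    show "{x \<in> free_module {b \<in> {..<rk F (Suc q)}. vle (bdeg F (Suc q) b) a}. lin_ext (\<mu> q) x = 0} =
        lin_ext (\<mu> (Suc q)) ` free_module {b \<in> {..<rk F (Suc (Suc q))}. vle (bdeg F (Suc (Suc q)) b) a}" for q a
      using exact_iff_degreewise[OF enc enc bdry_free \<mu>_free, of q] F_exact[of q] by blast
    show "{x \<in> free_module {b \<in> {..<rk F 0}. vle (bdeg F 0 b) a}. lin_ext \<nu> x \<in> rel a} =
        lin_ext (\<mu> 0) ` free_module {b \<in> {..<rk F (Suc 0)}. vle (bdeg F (Suc 0) b) a}" for a
    proof safe
      fix x :: "nat \<Rightarrow>\<^sub>0 'k" assume x: "x \<in> free_module {b \<in> {..<rk F 0}. vle (bdeg F 0 b) a}" "lin_ext \<nu> x \<in> rel a"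
      then obtain z where z: "z \<in> fterm F 1" "homog (bdeg F 0) a x = lin_ext (bdry F 0) z"
        using rel_iff[OF x(1)] aug_ker homog_in[OF x(1)] by blast
      have "x = lin_ext (\<mu> 0) (gcomp (bdeg F (Suc 0)) a z)"
        using gcomp_homog'[OF x(1)] encodes_gcomp[OF enc[of 0], of z a] z by simp
      then show "x \<in> lin_ext (\<mu> 0) ` free_module {b \<in> {..<rk F (Suc 0)}. vle (bdeg F (Suc 0) b) a}"
        using gcomp_in[of z "{..<rk F (Suc 0)}" "bdeg F (Suc 0)" a] z(1) by auto
    next
      fix y :: "nat \<Rightarrow>\<^sub>0 'k" assume y: "y \<in> free_module {b \<in> {..<rk F (Suc 0)}. vle (bdeg F (Suc 0) b) a}"
      have "lin_ext (\<mu> 0) y \<in> free_module {..<rk F 0}"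
        using y by (intro lin_ext_in_free_module \<mu>_free) (auto simp: free_module_def)
      then show x: "lin_ext (\<mu> 0) y \<in> free_module {b \<in> {..<rk F 0}. vle (bdeg F 0 b) a}"
        using lin_ext_matrix_in[OF enc y] by (auto simp: free_module_def)
      have "homog (bdeg F 0) a (lin_ext (\<mu> 0) y) = lin_ext (bdry F 0) (homog (bdeg F (Suc 0)) a y)"
        using encodes_homog[OF enc y] by simp
      then have "aug F (homog (bdeg F 0) a (lin_ext (\<mu> 0) y)) = ?N"
        using aug_ker homog_in[OF y] by auto
      then show "lin_ext \<nu> (lin_ext (\<mu> 0) y) \<in> rel a" using rel_iff[OF x] by simp
    qed
    show "\<exists>x\<in>free_module {b \<in> {..<rk F 0}. vle (bdeg F 0 b) a}. z - lin_ext \<nu> x \<in> rel a"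
      if z: "z \<in> free_module {i \<in> ?s. vle (\<beta> i) a}" for a z
    proof -
      have "homog \<beta> a z \<in> free_module ?s" using homog_in_free_comp[OF z] by (simp add: free_comp_def)
      then have "coset ?N (homog \<beta> a z) \<in> aug F ` fterm F 0" unfolding aug_onto by (rule imageI)
      then obtain f where f: "f \<in> fterm F 0" "coset ?N (homog \<beta> a z) = aug F f" by blast
      then have "homog \<beta> a z - lin_ext G f \<in> ?N" by (simp add: aug_G coset_eq_iff)
      then have "gcomp \<beta> a (homog \<beta> a z) - gcomp \<beta> a (lin_ext G f) \<in> rel a"
        using gcomp_im_phi by (simp flip: gcomp_diff)
      moreover have "gcomp \<beta> a (homog \<beta> a z) = z"
        using z free_module_mono[of "{i \<in> ?s. vle (\<beta> i) a}" "{i. vle (\<beta> i) a}"]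
        by (subst gcomp_homog) auto
      ultimately have "z - lin_ext \<nu> (gcomp (bdeg F 0) a f) \<in> rel a"
        using encodes_gcomp[OF encG f(1)] by simp
      then show ?thesis using gcomp_in[OF f(1)] by blast
    qed
  qed (fact \<mu>_in \<nu>_in)+
  have terms: "tensor_term F q \<alpha> = sr.const_part \<alpha> q" for q
    by (simp add: tensor_term_def sr.const_part_def)
  have diff: "tensor_diff F q x = sr.const_diff \<alpha> q x" if x: "x \<in> sr.const_part \<alpha> q" for q x
  proof (cases q)
    case 0
    then show ?thesis by (simp add: tensor_diff_def sr.const_diff_def)
  next
    case (Suc q')
    have "Poly_Mapping.map (\<lambda>p. lkp p 0) (bdry F q' b) = sr.restr \<alpha> q' (\<mu> q' b)" if "b \<in> supp x" for b
    proof (rule poly_mapping_eqI)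
      fix c
      have b: "b < rk F (Suc q')" "bdeg F (Suc q') b = \<alpha>"
        using x that by (auto simp: sr.const_part_def free_module_def Suc)
      have "lkp (sr.restr \<alpha> q' (\<mu> q' b)) c = (\<Sum>d\<in>supp (\<mu> q' b). if d = c then (lkp (\<mu> q' b) c when bdeg F q' c = \<alpha>) else 0)"
        unfolding sr.restr_def lookup_lin_ext[OF finite_keys order_refl]
        by (intro sum.cong) (auto simp: lookup_single when_def)
      then have "lkp (sr.restr \<alpha> q' (\<mu> q' b)) c = (lkp (\<mu> q' b) c when bdeg F q' c = \<alpha>)"
        by (auto simp: in_keys_iff)
      also have "\<dots> = lkp (lkp (bdry F q' b) c) 0"
      proof (cases "bdeg F q' c = \<alpha>")
        case True
        then show ?thesis by (simp add: \<mu>_def lookup_gcomp b(2))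
      next
        case False
        \<comment> \<open>A nonzero constant term is possible only between basis elements of equal
          degree, so \<open>restr\<close> loses nothing.\<close>
        have "lkp (lkp (bdry F q' b) c) 0 \<noteq> 0 \<longrightarrow> int_vec 0 + bdeg F q' c = \<alpha>"
          using bdry[OF b(1)] b(2) unfolding free_comp_def by blast
        then show ?thesis using False by auto
      qed
      finally show "lkp (Poly_Mapping.map (\<lambda>p. lkp p 0) (bdry F q' b)) c = lkp (sr.restr \<alpha> q' (\<mu> q' b)) c"
        by (simp add: map.rep_eq when_def)
    qed
    then show ?thesis unfolding Suc tensor_diff_def sr.const_diff_def by (auto intro: lin_ext_cong)
  qed
  show ?thesis
    unfolding terms sr.tor_eq_koszul[symmetric] by (rule homology_dim_cong) (rule diff, assumption)+
qed

end

section \<open>Existence of resolutions\<close>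

text \<open>For integer entries, exceeding a 1 means being nonnegative and nonzero. This is the
  source of all statements that only the support of a degree matters.\<close>

lemma vle_squarefree_iff:
  assumes "squarefree_vec g"
  shows "vle g a \<longleftrightarrow> nonneg_vec a \<and> supp g \<subseteq> supp a"
proof -
  have g: "lkp g i = 0 \<or> lkp g i = 1" for i using assms by (auto simp: squarefree_vec_def)
  have *: "lkp g i \<le> lkp a i \<longleftrightarrow> 0 \<le> lkp a i \<and> (lkp g i \<noteq> 0 \<longrightarrow> lkp a i \<noteq> 0)" for i
    using g[of i] by auto
  have "vle g a \<longleftrightarrow> (\<forall>i. 0 \<le> lkp a i \<and> (lkp g i \<noteq> 0 \<longrightarrow> lkp a i \<noteq> 0))"
    unfolding vle_iff * ..
  then show ?thesis by (auto simp: nonneg_vec_def in_keys_iff)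
qed

lemma squarefree_ind_vec: "squarefree_vec (ind_vec (L :: 'n::finite set))"
  by (simp add: squarefree_vec_def lookup_ind_vec)

lemma keys_ind_vec: "supp (ind_vec L) = (L :: 'n::finite set)"
  by (auto simp: in_keys_iff lookup_ind_vec split: if_splits)

lemma nonneg_ind_vec: "nonneg_vec (ind_vec (L :: 'n::finite set))"
  by (simp add: nonneg_vec_def lookup_ind_vec)

text \<open>For squarefree \<open>g\<close> the condition \<open>g \<le> a\<close> only depends on the support of \<open>a \<ge> 0\<close>.  Hence a
  kernel is generated by its components in squarefree degrees, which are finitely many
  finite-dimensional spaces.\<close>

lemma kernel_generators:
  fixes g :: "nat \<Rightarrow> 'n::finite mdeg" and m :: "nat \<Rightarrow> (nat \<Rightarrow>\<^sub>0 'k::field)"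
  assumes B: "finite B" "\<And>b. b \<in> B \<Longrightarrow> squarefree_vec (g b)"
  shows "\<exists>r g' m'. (\<forall>c<r. squarefree_vec (g' c)) \<and>
    (\<forall>c<r. m' c \<in> free_module {b \<in> B. vle (g b) (g' c)}) \<and>
    (\<forall>a. {x \<in> free_module {b \<in> B. vle (g b) a}. lin_ext m x = 0} =
        lin_ext m' ` free_module {c \<in> {..<r :: nat}. vle (g' c) a})"
proof -
  let ?Z = "\<lambda>a. {x \<in> free_module {b \<in> B. vle (g b) a}. lin_ext m x = 0}"
  have sub: "fs.subspace (?Z a)" for a
    by (intro subspace_ker_lin linear_lin_ext subspace_free_module)
  have fin: "fin_sub (?Z a)" for a
    using B(1) by (intro fin_sub_ker linear_lin_ext fin_sub_free_module) auto
  have "\<exists>W. finite W \<and> W \<subseteq> ?Z (ind_vec X) \<and> ?Z (ind_vec X) = fs.span W" for X :: "'n set"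
  proof -
    from fin[of "ind_vec X"] obtain b where "finite b" "b \<subseteq> ?Z (ind_vec X)" "fs.independent b"
      "?Z (ind_vec X) = fs.span b" "card b = fs.dim (?Z (ind_vec X))"
      by (rule fin_sub_basis)
    then show ?thesis by blast
  qed
  then obtain W where W: "\<And>X. finite (W X)" "\<And>X. W X \<subseteq> ?Z (ind_vec X)" "\<And>X. ?Z (ind_vec X) = fs.span (W X)"
    by metis
  \<comment> \<open>One generator for each pair of a support X and a vector of \<open>W X\<close>,
    placed in degree \<open>ind_vec X\<close>; keeping X separates equal vectors that come from
    different degrees.\<close>
  define S where "S = (SIGMA X:UNIV. W X)"
  have "finite S" using W(1) by (auto simp: S_def)
  then obtain r h where h: "bij_betw h {..<r :: nat} S"
    using ex_bij_betw_nat_finite[of S] by (auto simp: atLeast0LessThan)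
  define g' where "g' c = ind_vec (fst (h c))" for c
  define m' where "m' c = snd (h c)" for c
  have hS: "m' c \<in> W (fst (h c))" if "c < r" for c
    using h that unfolding bij_betw_def S_def m'_def by fastforce
  show ?thesis
  proof (intro exI[of _ r] exI[of _ g'] exI[of _ m'] conjI allI impI)
    show "squarefree_vec (g' c)" for c unfolding g'_def by (rule squarefree_ind_vec)
    show "m' c \<in> free_module {b \<in> B. vle (g b) (g' c)}" if "c < r" for c
      using hS[OF that] W(2) unfolding g'_def by blast
    show "?Z a = lin_ext m' ` free_module {c \<in> {..<r}. vle (g' c) a}" for a
    proof (cases "nonneg_vec a")
      case True
      have Zmono: "?Z (ind_vec X) \<subseteq> ?Z a" if "X \<subseteq> supp a" for X
      proof -
        have "vle (ind_vec X) a" using that True by (simp add: vle_squarefree_iff squarefree_ind_vec keys_ind_vec)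
        then have "{b \<in> B. vle (g b) (ind_vec X)} \<subseteq> {b \<in> B. vle (g b) a}" using vle_trans by blast
        then show ?thesis using free_module_mono by blast
      qed
      have Z_eq: "?Z a = ?Z (ind_vec (supp a))"
      proof -
        have "vle (g b) a \<longleftrightarrow> vle (g b) (ind_vec (supp a))" if "b \<in> B" for b
          using True by (simp add: vle_squarefree_iff[OF B(2)[OF that]] keys_ind_vec nonneg_ind_vec)
        then have "{b \<in> B. vle (g b) a} = {b \<in> B. vle (g b) (ind_vec (supp a))}" by auto
        then show ?thesis by simp
      qed
      show ?thesis
      proof (intro subset_antisym)
        let ?I = "lin_ext m' ` free_module {c \<in> {..<r}. vle (g' c) a}"
        have "W (supp a) \<subseteq> ?I"
        proof
          fix z assume "z \<in> W (supp a)"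
          then have "(supp a, z) \<in> S" by (simp add: S_def)
          then obtain c where c: "c < r" "h c = (supp a, z)"
            using h unfolding bij_betw_def by (metis imageE lessThan_iff)
          have "vle (g' c) a"
            using True by (simp add: g'_def c vle_squarefree_iff squarefree_ind_vec keys_ind_vec)
          then have "sng c 1 \<in> free_module {c \<in> {..<r}. vle (g' c) a}"
            using c(1) by (intro single_in_free_module) simp
          moreover have "lin_ext m' (sng c 1) = z" by (simp add: m'_def c)
          ultimately show "z \<in> ?I" by blast
        qed
        then have "fs.span (W (supp a)) \<subseteq> ?I"
          by (intro fs.span_minimal subspace_image_lin linear_lin_ext subspace_free_module)
        then show "?Z a \<subseteq> ?I" unfolding Z_eq W(3) .
        show "?I \<subseteq> ?Z a"
        proof safe
          fix y :: "nat \<Rightarrow>\<^sub>0 'k" assume y: "y \<in> free_module {c \<in> {..<r}. vle (g' c) a}"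
          have "lin_ext m' y \<in> ?Z a"
          proof (rule lin_ext_in[OF sub])
            fix c assume "c \<in> supp y"
            then have c: "c < r" "vle (g' c) a" using y by (auto simp: free_module_def)
            have "fst (h c) \<subseteq> supp a"
              using c(2) by (simp add: g'_def vle_squarefree_iff squarefree_ind_vec keys_ind_vec)
            then show "m' c \<in> ?Z a" using hS[OF c(1)] W(2) Zmono by blast
          qed
          then show "lin_ext m' y \<in> free_module {b \<in> B. vle (g b) a}" "lin_ext m (lin_ext m' y) = 0" by auto
        qed
      qed
    next
      case False
      have e: "{b \<in> B. vle (g b) a} = {}" "{c \<in> {..<r}. vle (g' c) a} = {}"
        using False B(2) by (auto simp: vle_squarefree_iff g'_def squarefree_ind_vec)
      have z: "free_module {} = {0 :: nat \<Rightarrow>\<^sub>0 'k}" by (auto simp: free_module_def)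
      show ?thesis unfolding e z by auto
    qed
  qed
qed

text \<open>Rows and columns of the matrix are numbered from 1, the basis elements of a resolution
  from 0; these maps translate between the two numberings.\<close>

definition unshift :: "(nat \<Rightarrow>\<^sub>0 'r::zero) \<Rightarrow> (nat \<Rightarrow>\<^sub>0 'r)" where
  "unshift = Poly_Mapping.map_key Suc"

definition shift :: "(nat \<Rightarrow>\<^sub>0 'r::comm_ring_1) \<Rightarrow> (nat \<Rightarrow>\<^sub>0 'r)" where
  "shift = lin_ext (\<lambda>b. sng (Suc b) 1)"

lemma lookup_unshift [simp]: "lkp (unshift x) b = lkp x (Suc b)"
  by (simp add: unshift_def map_key.rep_eq)

lemma lookup_shift: "lkp (shift x) i = (case i of 0 \<Rightarrow> 0 | Suc b \<Rightarrow> lkp x b)"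
proof -
  have "lkp (shift x) i = (\<Sum>b\<in>supp x. if i = Suc b then lkp x b else 0)"
    unfolding shift_def lookup_lin_ext[OF finite_keys order_refl]
    by (intro sum.cong) (auto simp: lookup_single when_def)
  then show ?thesis by (cases i) (auto simp: in_keys_iff)
qed

lemma shift_unshift: "x \<in> free_module {1..r} \<Longrightarrow> shift (unshift x) = x"
proof -
  assume "x \<in> free_module {1..r}"
  then have "lkp x 0 = 0" using in_free_moduleD by fastforce
  then show ?thesis by (intro poly_mapping_eqI) (auto simp: lookup_shift split: nat.split)
qed

lemma unshift_shift [simp]: "unshift (shift x) = x"
  by (rule poly_mapping_eqI) (simp add: lookup_shift)

lemma unshift_in: "x \<in> free_module B \<Longrightarrow> unshift x \<in> free_module {b. Suc b \<in> B}"
  using in_free_moduleD by (intro in_free_moduleI) fastforce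

lemma shift_in: "x \<in> free_module B \<Longrightarrow> shift x \<in> free_module (Suc ` B)"
  by (intro in_free_moduleI) (auto simp: lookup_shift dest: in_free_moduleD split: nat.splits)

lemma Suc_image_lessThan: "Suc ` {..<r} = {1..r}"
  using image_Suc_lessThan by blast

lemma shift_image: "shift ` free_module {..<r} = free_module {1..r}"
proof safe
  show "shift x \<in> free_module {1..r}" if "x \<in> free_module {..<r}" for x :: "nat \<Rightarrow>\<^sub>0 'a"
    using shift_in[OF that] by (simp add: Suc_image_lessThan)
  fix y :: "nat \<Rightarrow>\<^sub>0 'a" assume y: "y \<in> free_module {1..r}"
  have "{b. Suc b \<in> {1..r}} = {..<r}" by auto
  then have "unshift y \<in> free_module {..<r}" using unshift_in[OF y] by simp
  then show "y \<in> shift ` free_module {..<r}" using shift_unshift[OF y] by force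
qed

section \<open>The resolution that starts with the given matrix\<close>

context squarefree_presentation
begin

text \<open>A stage consists of the rank of a module, the degrees of its basis and the scalar matrix
  of its map to the preceding module. This one is the given matrix, from the free module on the
  columns to that on the rows.\<close>

definition start :: "nat \<times> (nat \<Rightarrow> 'n mdeg) \<times> (nat \<Rightarrow> (nat \<Rightarrow>\<^sub>0 'k))" where
  "start = (ncols A, \<lambda>b. \<gamma> (Suc b), \<lambda>b. unshift (scol (Suc b)))"

text \<open>\<open>kernel_generators\<close> returns squarefree degrees again, so it can be iterated
  by dependent choice.\<close>

lemma resolution_steps:
  "\<exists>s. s 0 = start \<and> (\<forall>q.
    (\<forall>c<fst (s (Suc q)). snd (snd (s (Suc q))) c \<in>
       free_module {b \<in> {..<fst (s q)}. vle (fst (snd (s q)) b) (fst (snd (s (Suc q))) c)}) \<and>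
    (\<forall>a. {x \<in> free_module {b \<in> {..<fst (s q)}. vle (fst (snd (s q)) b) a}. lin_ext (snd (snd (s q))) x = 0} =
      lin_ext (snd (snd (s (Suc q)))) ` free_module {c \<in> {..<fst (s (Suc q))}. vle (fst (snd (s (Suc q))) c) a}))"
proof -
  \<comment> \<open>Dependent choice yields only some initial stage with property
    \<open>P 0\<close>; the second conjunct forces it to be \<open>start\<close>.\<close>
  define P :: "nat \<Rightarrow> nat \<times> (nat \<Rightarrow> 'n mdeg) \<times> (nat \<Rightarrow> (nat \<Rightarrow>\<^sub>0 'k)) \<Rightarrow> bool"
    where "P q x \<longleftrightarrow> (\<forall>c<fst x. squarefree_vec (fst (snd x) c)) \<and> (q = 0 \<longrightarrow> x = start)" for q x
  define Q :: "nat \<Rightarrow> nat \<times> (nat \<Rightarrow> 'n mdeg) \<times> (nat \<Rightarrow> (nat \<Rightarrow>\<^sub>0 'k)) \<Rightarrow>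
      nat \<times> (nat \<Rightarrow> 'n mdeg) \<times> (nat \<Rightarrow> (nat \<Rightarrow>\<^sub>0 'k)) \<Rightarrow> bool"
    where "Q q x y \<longleftrightarrow>
      (\<forall>c<fst y. snd (snd y) c \<in> free_module {b \<in> {..<fst x}. vle (fst (snd x) b) (fst (snd y) c)}) \<and>
      (\<forall>a. {z \<in> free_module {b \<in> {..<fst x}. vle (fst (snd x) b) a}. lin_ext (snd (snd x)) z = 0} =
        lin_ext (snd (snd y)) ` free_module {c \<in> {..<fst y}. vle (fst (snd y) c) a})" for q x y
  have "P 0 start"
    using sol by (auto simp: P_def start_def squarefree_solution_def)
  moreover have "\<exists>y. P (Suc q) y \<and> Q q x y" if x: "P q x" for q x
  proof -
    have "finite {..<fst x}" "\<And>b. b \<in> {..<fst x} \<Longrightarrow> squarefree_vec (fst (snd x) b)"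
      using x by (auto simp: P_def)
    from kernel_generators[of "{..<fst x}" "fst (snd x)" "snd (snd x)", OF this] obtain r g' m' where
      "\<forall>c<r. squarefree_vec (g' c)"
      "\<forall>c<r. m' c \<in> free_module {b \<in> {..<fst x}. vle (fst (snd x) b) (g' c)}"
      "\<forall>a. {z \<in> free_module {b \<in> {..<fst x}. vle (fst (snd x) b) a}. lin_ext (snd (snd x)) z = 0} =
        lin_ext m' ` free_module {c \<in> {..<r :: nat}. vle (g' c) a}"
      by blast
    then have "P (Suc q) (r, g', m') \<and> Q q x (r, g', m')" by (simp add: P_def Q_def)
    then show ?thesis by blast
  qed
  ultimately obtain s where s: "\<And>q. P q (s q) \<and> Q q (s q) (s (Suc q))"
    using dependent_nat_choice[of P Q] by metis
  show ?thesis
    using s[of 0] s by (intro exI[of _ s]) (simp add: P_def Q_def)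
qed

theorem resolution_exists: "\<exists>F. is_free_resolution (coker_module A \<beta>) F"
proof -
  let ?N = "im_phi A"
  obtain s where s0: "s 0 = start"
    and s_in: "\<And>q c. c < fst (s (Suc q)) \<Longrightarrow>
      snd (snd (s (Suc q))) c \<in> free_module {b \<in> {..<fst (s q)}. vle (fst (snd (s q)) b) (fst (snd (s (Suc q))) c)}"
    and s_exact: "\<And>q a. {x \<in> free_module {b \<in> {..<fst (s q)}. vle (fst (snd (s q)) b) a}. lin_ext (snd (snd (s q))) x = 0} =
      lin_ext (snd (snd (s (Suc q)))) ` free_module {c \<in> {..<fst (s (Suc q))}. vle (fst (snd (s (Suc q))) c) a}"
    using resolution_steps by blast
  \<comment> \<open>Stage \<open>s q\<close> describes the module at position \<open>q + 1\<close>
    and its map to position \<open>q\<close>; position 0 is the free module on the rows.\<close>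
  define R where "R q = (case q of 0 \<Rightarrow> nrows A | Suc q \<Rightarrow> fst (s q))" for q
  define g where "g q = (case q of 0 \<Rightarrow> (\<lambda>b. \<beta> (Suc b)) | Suc q \<Rightarrow> fst (snd (s q)))" for q
  define m where "m q = snd (snd (s q))" for q
  define D where "D q b = homog (g q) (g (Suc q) b) (m q b)" for q b
  define F where "F = \<lparr>rk = R, bdeg = g, bdry = D, aug = (\<lambda>f. coset ?N (shift f))\<rparr>"
  have m_in: "m q b \<in> free_module {c \<in> {..<R q}. vle (g q c) (g (Suc q) b)}" if "b < R (Suc q)" for q b
  proof (cases q)
    case 0
    have b: "Suc b \<in> {1..ncols A}" using that by (simp add: R_def s0 start_def 0)
    have "unshift (scol (Suc b)) \<in> free_module {c. Suc c \<in> {i \<in> {1..nrows A}. vle (\<beta> i) (\<gamma> (Suc b))}}"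
      by (rule unshift_in[OF scol_in[OF b]])
    moreover have "{c. Suc c \<in> {i \<in> {1..nrows A}. vle (\<beta> i) (\<gamma> (Suc b))}} = {c \<in> {..<R 0}. vle (g 0 c) (g (Suc 0) b)}"
      by (auto simp: R_def g_def s0 start_def)
    ultimately show ?thesis by (simp add: 0 m_def s0 start_def)
  next
    case (Suc q')
    then show ?thesis using s_in[of b q'] that by (simp add: R_def g_def m_def)
  qed
  have D_in: "D q b \<in> free_comp {..<R q} (g q) (g (Suc q) b)" if "b < R (Suc q)" for q b
    unfolding D_def by (rule homog_in_free_comp[OF m_in[OF that]])
  have enc: "encodes {..<R (Suc q)} (g (Suc q)) (g q) (m q) (D q)" for q
    unfolding encodes_def
  proof (intro ballI conjI)
    fix b assume "b \<in> {..<R (Suc q)}"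
    then show "m q b \<in> free_module {c. vle (g q c) (g (Suc q) b)}"
      using m_in[of b q] free_module_mono[of "{c \<in> {..<R q}. vle (g q c) (g (Suc q) b)}" "{c. vle (g q c) (g (Suc q) b)}"]
      by blast
  qed (simp add: D_def)
  have shift_D: "shift (D 0 b) = pcol (Suc b)" if "b < ncols A" for b
  proof -
    have "D 0 b = unshift (pcol (Suc b))"
      using that by (intro poly_mapping_eqI)
        (simp add: pcol_eq D_def lookup_homog g_def m_def s0 start_def)
    then show ?thesis using shift_unshift[OF pcol_free] by simp
  qed
  have shift_lin: "shift (lin_ext (D 0) f) = lin_ext pcol (shift f)" if "f \<in> free_module {..<ncols A}" for f
    unfolding shift_def lin_ext_lin_ext
    using that shift_D unfolding shift_def by (intro lin_ext_cong) (auto simp: free_module_def)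
  have "is_free_resolution (coker_module A \<beta>) F"
    unfolding is_free_resolution_def
  proof (intro conjI allI impI ballI)
    show "bdry F q b \<in> free_comp {..<rk F q} (bdeg F q) (bdeg F (Suc q) b)" if "b < rk F (Suc q)" for q b
      using D_in that by (simp add: F_def)
    show "aug F (f + h) = aug F f \<oplus>\<^bsub>coker_module A \<beta>\<^esub> aug F h" for f h
      by (simp add: F_def coset_add shift_def lin_ext_add)
    show "aug F (fscale p f) = p \<odot>\<^bsub>coker_module A \<beta>\<^esub> aug F f" for p f
      by (simp add: F_def coset_smult shift_def lin_ext_fscale)
    show "aug F ` free_comp {..<rk F 0} (bdeg F 0) a \<subseteq> hcomp (coker_module A \<beta>) a" for a
    proof safe
      fix f :: "nat \<Rightarrow>\<^sub>0 ('n, 'k) mpoly" assume f: "f \<in> free_comp {..<rk F 0} (bdeg F 0) a"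
      have "shift f \<in> free_module {1..nrows A}"
        using f shift_image by (auto simp: free_comp_def F_def R_def)
      moreover have "int_vec u + \<beta> i = a" if "lkp (lkp (shift f) i) u \<noteq> 0" for i u
        using that f by (auto simp: lookup_shift free_comp_def F_def g_def split: nat.splits)
      ultimately show "aug F f \<in> hcomp (coker_module A \<beta>) a"
        by (auto simp: F_def coker_module_def free_comp_def)
    qed
    show "aug F ` fterm F 0 = carrier (coker_module A \<beta>)"
      by (simp add: F_def R_def coker_module_def shift_image flip: image_image)
    have "{f \<in> free_module {..<nrows A}. shift f \<in> ?N} = lin_ext (D 0) ` free_module {..<ncols A}"
    proof safe
      fix f assume f: "f \<in> free_module {..<nrows A}" "shift f \<in> ?N"
      then obtain h where h: "h \<in> free_module {..<ncols A}" "shift f = lin_ext pcol (shift h)"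
        unfolding im_phi_eq shift_image[symmetric] by blast
      then have "shift f = shift (lin_ext (D 0) h)" by (simp add: shift_lin)
      then have "f = lin_ext (D 0) h" by (metis unshift_shift)
      then show "f \<in> lin_ext (D 0) ` free_module {..<ncols A}" using h(1) by blast
    next
      fix h :: "nat \<Rightarrow>\<^sub>0 ('n, 'k) mpoly" assume h: "h \<in> free_module {..<ncols A}"
      have "D 0 b \<in> free_module {..<nrows A}" if "b < ncols A" for b
        using D_in[of b 0] that by (simp add: free_comp_def R_def s0 start_def)
      then show "lin_ext (D 0) h \<in> free_module {..<nrows A}"
        using h by (intro lin_ext_in_free_module) (auto simp: free_module_def)
      show "shift (lin_ext (D 0) h) \<in> ?N"
        unfolding shift_lin[OF h] im_phi_eq shift_image[symmetric] using h by blast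
    qed
    moreover have "coset ?N (shift f) = ?N \<longleftrightarrow> shift f \<in> ?N" for f
      using coset_eq_iff[of "shift f" 0] by (simp add: coset_0)
    ultimately show "{f \<in> fterm F 0. aug F f = \<zero>\<^bsub>coker_module A \<beta>\<^esub>} = lin_ext (bdry F 0) ` fterm F 1"
      by (simp add: F_def R_def coker_module_def s0 start_def)
    show "{f \<in> fterm F (Suc q). lin_ext (bdry F q) f = 0} = lin_ext (bdry F (Suc q)) ` fterm F (Suc (Suc q))" for q
    proof -
      have "D (Suc q) b \<in> free_module {..<R (Suc q)}" "m (Suc q) b \<in> free_module {..<R (Suc q)}"
        if "b \<in> {..<R (Suc (Suc q))}" for b
        using that D_in[of b "Suc q"] m_in[of b "Suc q"]
          free_module_mono[of "{c \<in> {..<R (Suc q)}. vle (g (Suc q) c) (g (Suc (Suc q)) b)}" "{..<R (Suc q)}"]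
        by (auto simp: free_comp_def)
      moreover have "{x \<in> free_module {b \<in> {..<R (Suc q)}. vle (g (Suc q) b) a}. lin_ext (m q) x = 0} =
          lin_ext (m (Suc q)) ` free_module {c \<in> {..<R (Suc (Suc q))}. vle (g (Suc (Suc q)) c) a}" for a
        using s_exact[of q a] by (simp add: R_def g_def m_def)
      ultimately have "{f \<in> free_module {..<R (Suc q)}. lin_ext (D q) f = 0} =
          lin_ext (D (Suc q)) ` free_module {..<R (Suc (Suc q))}"
        using exact_iff_degreewise[OF enc enc, of q] by blast
      then show ?thesis by (simp add: F_def)
    qed
  qed
  then show ?thesis by blast
qed

text \<open>Existence makes the \<open>SOME\<close> in \<open>betti\<close> a genuine resolution,
  and \<open>resolution_homology\<close> applies to whichever one it is.\<close>

theorem betti_eq_koszul: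
  "betti (coker_module A \<beta>) i \<alpha> = homology_dim (nf_kos \<alpha> i) (nf_kos_diff \<alpha>) (nf_kos \<alpha> (Suc i)) (nf_kos_diff \<alpha>)"
proof -
  have "is_free_resolution (coker_module A \<beta>) (SOME F. is_free_resolution (coker_module A \<beta>) F)"
    using resolution_exists by (rule someI_ex)
  then show ?thesis unfolding betti_def Let_def by (rule resolution_homology)
qed

end

text \<open>The interval \<open>{1..nrows A}\<close> is a parameter of the constants of the locale
  \<open>graded_relations\<close>; once simp turns it into \<open>{Suc 0..nrows A}\<close> there, lemmas about them no longer match.\<close>

declare One_nat_def [simp del]

section \<open>Signs\<close>

lemma elt_sign_square [simp]: "elt_sign w S * elt_sign w S = (1 :: 'k::field)"
  by (simp add: elt_sign_def flip: power_mult_distrib)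

lemma set_sign_square [simp]: "set_sign W L * set_sign W L = (1 :: 'k::field)"
  by (simp add: set_sign_def flip: prod.distrib)

lemma set_sign_nonzero [simp]: "set_sign W L \<noteq> (0 :: 'k::field)"
  using set_sign_square[of W L, where 'k = 'k] by force

lemma divide_set_sign: "x / set_sign W L = x * (set_sign W L :: 'k::field)"
  using set_sign_square[of W L, where 'k = 'k] by (simp add: divide_eq_eq mult.assoc)

text \<open>The elements of S up to w are those of \<open>insert w (S - L)\<close> together with
  those of L below w. This turns a Koszul sign into a simplicial one; the extra factor
  \<open>elt_sign w S\<close> is the change of \<open>set_sign\<close> when w joins the
  face.\<close>

lemma elt_sign_ksgn:
  fixes L S :: "'n::{finite,linorder} set"
  assumes "w \<in> L" "L \<subseteq> S"
  shows "elt_sign w (insert w (S - L)) = ksgn L w * (elt_sign w S :: 'k::field)"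
proof -
  let ?X = "{v \<in> insert w (S - L). v \<le> w}" and ?Y = "{v \<in> L. v < w}"
  have "{v \<in> S. v \<le> w} = ?X \<union> ?Y" using assms by auto
  moreover have "card (?X \<union> ?Y) = card ?X + card ?Y"
    by (rule card_Un_disjoint) auto
  ultimately have "card {v \<in> S. v \<le> w} = card ?X + card ?Y" by simp
  then have "ksgn L w * elt_sign w S = (ksgn L w * ksgn L w) * (elt_sign w (insert w (S - L)) :: 'k)"
    by (simp add: elt_sign_def ksgn_def power_add)
  then show ?thesis by simp
qed

lemma set_sign_insert:
  "w \<notin> W \<Longrightarrow> set_sign (insert w W) S = elt_sign w S * (set_sign W S :: 'k::field)" for W :: "'n::{finite,linorder} set"
  by (simp add: set_sign_def)

section \<open>Initial ideals and reduction coefficients\<close>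

context squarefree_presentation
begin

lemma sf_\<gamma>: "j \<in> {1..ncols A} \<Longrightarrow> squarefree_vec (\<gamma> j)" and sf_\<beta>: "i \<in> {1..nrows A} \<Longrightarrow> squarefree_vec (\<beta> i)"
  using sol by (auto simp: squarefree_solution_def)

lemma leads_mono: "vle a b \<Longrightarrow> leads a \<subseteq> leads b"
proof -
  assume "vle a b"
  then have "rel a \<subseteq> rel b" by (rule N_mono)
  then show ?thesis unfolding leads_def by blast
qed

lemma leads_std_cong:
  assumes "nonneg_vec a \<longleftrightarrow> nonneg_vec b" "supp a = supp b"
  shows "leads a = leads b" "std a = std b"
proof -
  have "{j \<in> {1..ncols A}. vle (\<gamma> j) a} = {j \<in> {1..ncols A}. vle (\<gamma> j) b}"
    using vle_squarefree_iff[OF sf_\<gamma>] assms by auto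
  then have "rel a = rel b" by (simp add: rel_def)
  then show "leads a = leads b" by (simp add: leads_def)
  moreover have "{i \<in> {1..nrows A}. vle (\<beta> i) a} = {i \<in> {1..nrows A}. vle (\<beta> i) b}"
    using vle_squarefree_iff[OF sf_\<beta>] assms by auto
  ultimately show "std a = std b" by (simp add: std_def)
qed

lemma std_D: "j \<in> std a \<Longrightarrow> j \<in> {1..nrows A} \<and> vle (\<beta> j) a"
  by (simp add: std_def)

lemma lookup_mono_vec: "lkp (lkp (mono_vec j u :: nat \<Rightarrow>\<^sub>0 ('n, 'k) mpoly) i) v = (1 when i = j \<and> v = u)"
  by (auto simp: mono_vec_def lookup_single when_def)

end

locale ordered_presentation = squarefree_presentation A \<gamma> \<beta>
  for A :: "('n::{finite,linorder}, 'k::field_char_0) term_matrix" and \<gamma> \<beta> :: "nat \<Rightarrow> 'n mdeg" +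
  fixes mle :: "'n expo \<Rightarrow> 'n expo \<Rightarrow> bool" and \<alpha> :: "'n mdeg"
  assumes mle: "monomial_order mle"
begin

text \<open>Leading terms of homogeneous relations suffice: a homogeneous component of an element of the
  image is again in the image, and in a fixed degree only the position of the basis element matters.\<close>

lemma mono_in_initial_iff:
  "mono_vec j u \<in> initial_module mle (im_phi A) \<longleftrightarrow> j \<in> leads (int_vec u + \<beta> j)"
proof
  assume "j \<in> leads (int_vec u + \<beta> j)"
  then obtain y where y: "y \<in> rel (int_vec u + \<beta> j)" "lkp y j \<noteq> 0" "\<And>i. i > j \<Longrightarrow> lkp y i = 0"
    by (auto simp: leads_def)
  let ?f = "homog \<beta> (int_vec u + \<beta> j) y"
  have "is_leading mle ?f u j"
    unfolding is_leading_def
  proof (intro conjI allI impI)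
    show "lkp (lkp ?f j) u \<noteq> 0" using y(2) by (simp add: lookup_homog)
    fix i v assume *: "lkp (lkp ?f i) v \<noteq> 0"
    then have "lkp y i \<noteq> 0" by (auto simp: lookup_homog)
    then have "i \<le> j" using y(3) by (meson not_le)
    moreover have "mle u u" using mle by (auto simp: monomial_order_def reflp_def)
    moreover have "v = u" if "i = j"
      using * that by (auto simp: lookup_homog lookup_single when_def split: if_splits)
    ultimately show "i < j \<or> i = j \<and> mle v u" by auto
  qed
  then show "mono_vec j u \<in> initial_module mle (im_phi A)"
    unfolding initial_module_def using homog_rel[OF y(1)]
    by (intro Modules.module.span_base[OF module_fscale]) blast
next
  let ?T = "{p :: nat \<Rightarrow>\<^sub>0 ('n, 'k) mpoly. \<forall>i v. lkp (lkp p i) v \<noteq> 0 \<longrightarrow> i \<in> leads (int_vec v + \<beta> i)}"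
  have "initial_module mle (im_phi A) \<subseteq> ?T"
    unfolding initial_module_def
  proof (rule Modules.module.span_minimal[OF module_fscale])
    show "Modules.module.subspace fscale ?T"
    proof (rule Modules.module.subspaceI[OF module_fscale])
      fix x y assume "x \<in> ?T" "y \<in> ?T"
      then show "x + y \<in> ?T" by (auto simp: lookup_add) (metis add.right_neutral)
    next
      fix p and x :: "nat \<Rightarrow>\<^sub>0 ('n, 'k) mpoly" assume x: "x \<in> ?T"
      show "fscale p x \<in> ?T"
      proof safe
        fix i v assume "lkp (lkp (fscale p x) i) v \<noteq> 0"
        then have "v \<in> supp (p * lkp x i)" by (simp add: lookup_fscale in_keys_iff)
        then obtain c d where cd: "v = c + d" "d \<in> supp (lkp x i)"
          using keys_mult[of p "lkp x i"] by blast
        then have "i \<in> leads (int_vec d + \<beta> i)" using x by (auto simp: in_keys_iff)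
        moreover have "vle (int_vec d + \<beta> i) (int_vec v + \<beta> i)" by (simp add: cd int_vec_add)
        ultimately show "i \<in> leads (int_vec v + \<beta> i)" using leads_mono by blast
      qed
    qed auto
    show "{mono_vec j u |j u. \<exists>f\<in>im_phi A. is_leading mle f u j} \<subseteq> ?T"
    proof safe
      fix j u f i v
      assume f: "f \<in> im_phi A" "is_leading mle f u j" "lkp (lkp (mono_vec j u :: nat \<Rightarrow>\<^sub>0 ('n, 'k) mpoly) i) v \<noteq> 0"
      then have [simp]: "i = j" "v = u" by (auto simp: lookup_mono_vec)
      have "lkp (gcomp \<beta> (int_vec u + \<beta> j) f) j \<noteq> 0"
        using f(2) by (simp add: lookup_gcomp is_leading_def)
      moreover have "lkp (gcomp \<beta> (int_vec u + \<beta> j) f) i = 0" if "i > j" for i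
      proof (rule ccontr)
        assume "lkp (gcomp \<beta> (int_vec u + \<beta> j) f) i \<noteq> 0"
        then have "lkp (lkp f i) (nat_vec (int_vec u + \<beta> j - \<beta> i)) \<noteq> 0" by (auto simp: lookup_gcomp)
        then have "i < j \<or> i = j" using f(2) unfolding is_leading_def by blast
        then show False using that by simp
      qed
      ultimately show "i \<in> leads (int_vec v + \<beta> i)"
        using gcomp_im_phi[OF f(1)] by (auto simp: leads_def)
    qed
  qed
  moreover assume "mono_vec j u \<in> initial_module mle (im_phi A)"
  ultimately have "mono_vec j u \<in> ?T" by blast
  then show "j \<in> leads (int_vec u + \<beta> j)" by (simp add: lookup_mono_vec)
qed

lemma ideal_complex_iff: "\<sigma> \<in> ideal_complex (initial_ideal mle A j) \<longleftrightarrow> j \<notin> leads (ind_vec \<sigma> + \<beta> j)"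
proof -
  have prod: "(\<Prod>i\<in>\<sigma>. sng (sng i 1) 1) = sng (\<Sum>i\<in>\<sigma>. sng i 1) (1 :: 'k)"
    by (induction \<sigma> rule: infinite_finite_induct) (auto simp: mult_single)
  have "int_vec (\<Sum>i\<in>\<sigma>. sng i 1) = ind_vec \<sigma>"
    by (rule poly_mapping_eqI) (auto simp: lookup_int_vec lookup_ind_vec lookup_sum lookup_single when_def)
  then show ?thesis
    using mono_in_initial_iff[of j "\<Sum>i\<in>\<sigma>. sng i 1"]
    by (simp add: ideal_complex_def initial_ideal_def prod mono_vec_def)
qed

lemma keys_add_nonneg:
  "nonneg_vec a \<Longrightarrow> nonneg_vec b \<Longrightarrow> supp (a + b) = supp a \<union> supp b"
  by (auto simp: nonneg_vec_def in_keys_iff lookup_add add_nonneg_eq_0_iff)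

lemma nonneg_\<beta>: "j \<in> {1..nrows A} \<Longrightarrow> nonneg_vec (\<beta> j)"
  using sf_\<beta>[of j] vle_squarefree_iff[of "\<beta> j" "\<beta> j"] by simp

text \<open>The degree \<open>a\<close> and the squarefree exponent on the support of
  \<open>a - \<beta> j\<close>, raised by \<open>\<beta> j\<close>, have the same support, hence the
  same leads. So standardness can be read from the complexes of the initial ideals.\<close>

lemma in_std_iff:
  assumes "j \<in> {1..nrows A}" "vle (\<beta> j) a"
  shows "j \<in> std a \<longleftrightarrow> supp (a - \<beta> j) \<in> ideal_complex (initial_ideal mle A j)"
proof -
  let ?S = "supp (a - \<beta> j)"
  have add: "nonneg_vec (u + \<beta> j)" if "nonneg_vec u" for u
    using that nonneg_\<beta>[OF assms(1)] by (simp add: nonneg_vec_def lookup_add)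
  have "leads (ind_vec ?S + \<beta> j) = leads ((a - \<beta> j) + \<beta> j)"
    by (rule leads_std_cong(1))
      (simp_all only: keys_add_nonneg[OF nonneg_ind_vec nonneg_\<beta>[OF assms(1)]]
        keys_add_nonneg[OF assms(2) nonneg_\<beta>[OF assms(1)]] keys_ind_vec add[OF nonneg_ind_vec] add[OF assms(2)])
  then show ?thesis using assms by (simp add: ideal_complex_iff std_def)
qed

text \<open>Subtracting a relation normalised to have coefficient 1 at its lead j leaves a vector
  supported below j, and normal forms preserve that bound.\<close>

lemma nf_lead:
  assumes j: "j \<in> {1..nrows A}" "vle (\<beta> j) a" "j \<in> leads a"
  shows "nf a (sng j 1) \<in> free_module (std a \<inter> {1..<j})" "sng j 1 - nf a (sng j 1) \<in> rel a"
proof -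
  have e: "sng j 1 \<in> V a" using j by (simp add: V_def single_in_free_module)
  then show "sng j 1 - nf a (sng j 1) \<in> rel a" by (rule nf_props)
  obtain z where z: "z \<in> rel a" "lkp z j \<noteq> 0" "\<And>i. i > j \<Longrightarrow> lkp z i = 0"
    using j(3) by (auto simp: leads_def)
  define z' where "z' = fscale (1 / lkp z j) z"
  have z': "z' \<in> rel a" unfolding z'_def by (rule fs.subspace_scale[OF subspace_N z(1)])
  then have "z' \<in> V a" using N_sub by (auto simp: V_def)
  then have V: "sng j 1 - z' \<in> V a" using e fs.subspace_diff[OF subspace_V] by blast
  have "lkp (sng j 1 - z') i = 0" if "i \<ge> j" for i
    using that z(2,3) by (cases "i = j") (auto simp: z'_def lookup_minus lookup_fscale lookup_single)
  then have y: "nf a (sng j 1 - z') \<in> free_module (std a \<inter> {..<j})" by (rule nf_less[OF V])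
  have "sng j 1 - nf a (sng j 1 - z') = (sng j 1 - z' - nf a (sng j 1 - z')) + z'" by simp
  then have "sng j 1 - nf a (sng j 1 - z') \<in> rel a"
    using fs.subspace_add[OF subspace_N nf_props(2)[OF V] z'] by simp
  then have "nf a (sng j 1) = nf a (sng j 1 - z')" by (intro nf_eqI nf_props(1)[OF V])
  moreover have "std a \<inter> {..<j} \<subseteq> std a \<inter> {1..<j}"
  proof
    fix i assume "i \<in> std a \<inter> {..<j}"
    then show "i \<in> std a \<inter> {1..<j}" using std_D[of i a] by simp
  qed
  ultimately show "nf a (sng j 1) \<in> free_module (std a \<inter> {1..<j})"
    using subsetD[OF free_module_mono y] by simp
qed

text \<open>With \<open>b = a - \<beta> j\<close>, the conditions under \<open>THE\<close> say that
  the vector with entries \<open>r i\<close> is supported on standard positions and congruent to the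
  j-th basis vector in degree \<open>a\<close>. This characterises its normal form.\<close>

lemma red_coeff_eq:
  assumes j: "j \<in> {1..nrows A}" "vle (\<beta> j) a" "j \<in> leads a"
  shows "red_coeff mle A \<beta> j (a - \<beta> j) = lkp (nf a (sng j 1))"
proof -
  let ?y = "nf a (sng j 1)"
  let ?v = "\<lambda>r. \<Sum>i\<in>{1..<j}. sng i (sng (nat_vec (a - \<beta> i)) (r i))"
  have v: "?v r = homog \<beta> a (\<Sum>i\<in>{1..<j}. sng i (r i))" for r :: "nat \<Rightarrow> 'k"
    by (simp add: homog_sum homog_single)
  have m: "mono_vec j (nat_vec (a - \<beta> j)) = homog \<beta> a (sng j (1 :: 'k))"
    by (simp add: mono_vec_def homog_single)
  have std: "i \<in> std a \<longleftrightarrow> vle (\<beta> i) a \<and> supp (a - \<beta> i) \<in> ideal_complex (initial_ideal mle A i)"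
    if "i \<in> {1..<j}" for i
  proof (cases "vle (\<beta> i) a")
    case True
    have "i \<in> {1..nrows A}" using that j(1) by simp
    then show ?thesis using in_std_iff True by blast
  next
    case False
    then show ?thesis using std_D by blast
  qed
  have eq: "coset (im_phi A) (mono_vec j (nat_vec (a - \<beta> j))) = coset (im_phi A) (?v r) \<longleftrightarrow>
      sng j 1 - (\<Sum>i\<in>{1..<j}. sng i (r i)) \<in> rel a"
    if "\<And>i. r i \<noteq> 0 \<Longrightarrow> vle (\<beta> i) a" for r
  proof -
    have "sng j 1 - (\<Sum>i\<in>{1..<j}. sng i (r i)) \<in> free_module {i. vle (\<beta> i) a}"
    proof (intro free_module_diff free_module_sum)
      show "sng j 1 \<in> free_module {i. vle (\<beta> i) a}" using j(2) by (intro single_in_free_module) simp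
      fix i
      show "sng i (r i) \<in> free_module {i. vle (\<beta> i) a}"
        using that[of i] by (cases "r i = 0") (auto simp: free_module_zero intro: single_in_free_module)
    qed
    then show ?thesis
      unfolding v m coset_eq_iff homog_diff[symmetric] by (rule homog_in_im_phi_iff)
  qed
  have "(THE r. (\<forall>i. r i \<noteq> 0 \<longrightarrow> i \<in> {1..<j} \<and> vle (\<beta> i) a \<and>
                 supp (a - \<beta> i) \<in> ideal_complex (initial_ideal mle A i)) \<and>
             coset (im_phi A) (mono_vec j (nat_vec (a - \<beta> j))) = coset (im_phi A) (?v r)) = lkp ?y"
  proof (rule the_equality)
    have y: "i \<in> {1..<j}" "i \<in> std a" if "lkp ?y i \<noteq> 0" for i
      using in_free_moduleD[OF nf_lead(1)[OF j] that] by auto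
    have "(\<Sum>i\<in>{1..<j}. sng i (lkp ?y i)) = ?y"
      using y by (intro sum_single_superset) (auto simp: in_keys_iff)
    then have "coset (im_phi A) (mono_vec j (nat_vec (a - \<beta> j))) = coset (im_phi A) (?v (lkp ?y))"
      using nf_lead(2)[OF j] y std by (subst eq) auto
    then show "(\<forall>i. lkp ?y i \<noteq> 0 \<longrightarrow> i \<in> {1..<j} \<and> vle (\<beta> i) a \<and>
                 supp (a - \<beta> i) \<in> ideal_complex (initial_ideal mle A i)) \<and>
             coset (im_phi A) (mono_vec j (nat_vec (a - \<beta> j))) = coset (im_phi A) (?v (lkp ?y))"
      using y std by blast
  next
    fix r assume r: "(\<forall>i. r i \<noteq> 0 \<longrightarrow> i \<in> {1..<j} \<and> vle (\<beta> i) a \<and>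
                 supp (a - \<beta> i) \<in> ideal_complex (initial_ideal mle A i)) \<and>
             coset (im_phi A) (mono_vec j (nat_vec (a - \<beta> j))) = coset (im_phi A) (?v r)"
    let ?z = "\<Sum>i\<in>{1..<j}. sng i (r i)"
    have z: "lkp ?z i = r i" for i
      using r by (auto simp: lookup_sum lookup_single when_def)
    have "?z \<in> free_module (std a)"
      using r std by (intro in_free_moduleI) (auto simp only: z)
    moreover have "sng j 1 - ?z \<in> rel a" using r eq[of r] by blast
    ultimately have "?y = ?z" by (rule nf_eqI)
    then show "r = lkp ?y" using z by auto
  qed
  then show ?thesis by (simp add: red_coeff_def)
qed

section \<open>Comparison of the Koszul complex with the cochain complex\<close>

abbreviation faces :: "nat \<Rightarrow> 'n set set" where
  "faces \<equiv> delta_complex mle A \<beta> \<alpha>"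

definition verts :: "nat \<Rightarrow> 'n set" where
  "verts j = supp (\<alpha> - \<beta> j)"

lemma vle_verts: "vle (\<beta> j) (\<alpha> - ind_vec L) \<longleftrightarrow> vle (\<beta> j) \<alpha> \<and> L \<subseteq> verts j"
proof -
  have "lkp (\<beta> j) i \<le> lkp (\<alpha> - ind_vec L) i \<longleftrightarrow>
      lkp (\<beta> j) i \<le> lkp \<alpha> i \<and> (i \<in> L \<longrightarrow> lkp (\<alpha> - \<beta> j) i \<noteq> 0)" for i
    by (auto simp: lookup_minus lookup_ind_vec)
  then show ?thesis unfolding vle_iff verts_def subset_iff in_keys_iff by blast
qed

text \<open>Put \<open>L = verts j - \<tau>\<close>. When \<open>\<beta> j \<le> \<alpha>\<close>,
  the exponent \<open>\<alpha> - \<beta> j - L\<close> is nonzero on \<tau> and at the vertices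
  where \<open>\<alpha> - \<beta> j\<close> is at least 2, which is the set tested in
  \<open>delta_complex\<close>.\<close>

lemma in_delta_iff:
  assumes "j \<in> {1..nrows A}"
  shows "\<tau> \<in> faces j \<longleftrightarrow> \<tau> \<subseteq> verts j \<and> j \<in> std (\<alpha> - ind_vec (verts j - \<tau>))"
proof (cases "vle (\<beta> j) \<alpha> \<and> \<tau> \<subseteq> verts j")
  case True
  have v: "vle (\<beta> j) (\<alpha> - ind_vec (verts j - \<tau>))" using True by (auto simp: vle_verts)
  have "\<tau> \<union> supp (\<alpha> - \<beta> j - ind_vec (verts j)) = supp (\<alpha> - ind_vec (verts j - \<tau>) - \<beta> j)"
  proof (rule Set.set_eqI)
    fix i
    show "i \<in> \<tau> \<union> supp (\<alpha> - \<beta> j - ind_vec (verts j)) \<longleftrightarrow>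
        i \<in> supp (\<alpha> - ind_vec (verts j - \<tau>) - \<beta> j)"
      using True by (cases "i \<in> verts j"; cases "i \<in> \<tau>")
        (auto simp: in_keys_iff lookup_minus lookup_ind_vec verts_def)
  qed
  then show ?thesis
    using True in_std_iff[OF assms v] by (simp add: delta_complex_def verts_def)
next
  case False
  then show ?thesis
    using std_D[of j "\<alpha> - ind_vec (verts j - \<tau>)"] by (auto simp: delta_complex_def verts_def vle_verts)
qed

definition cells :: "('n set \<times> nat) set" where
  "cells = {(L, j). j \<in> std (\<alpha> - ind_vec L)}"

lemma cellsD:
  assumes "(L, j) \<in> cells"
  shows "j \<in> {1..nrows A}" "vle (\<beta> j) \<alpha>" "L \<subseteq> verts j" "verts j - L \<in> faces j"
proof -
  have j: "j \<in> std (\<alpha> - ind_vec L)" using assms by (simp add: cells_def)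
  then show 1: "j \<in> {1..nrows A}" and "vle (\<beta> j) \<alpha>" and L: "L \<subseteq> verts j" using std_D vle_verts by blast+
  have "verts j - (verts j - L) = L" using L by auto
  then show "verts j - L \<in> faces j" using j by (simp add: in_delta_iff[OF 1])
qed

lemma finite_cells: "finite cells"
  by (rule finite_subset[of _ "UNIV \<times> {1..nrows A}"]) (auto simp: cells_def dest: std_D)

lemma delta_cell: "j \<in> {1..nrows A} \<Longrightarrow> \<tau> \<in> faces j \<Longrightarrow> (verts j - \<tau>, j) \<in> cells"
  by (simp add: cells_def in_delta_iff)

lemma delta_verts: "j \<in> {1..nrows A} \<Longrightarrow> \<tau> \<in> faces j \<Longrightarrow> \<tau> \<subseteq> verts j"
  by (simp add: in_delta_iff)

text \<open>The comparison map. The sign \<open>set_sign\<close> of the face is what converts the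
  Koszul signs into simplicial ones, and it explains the quotient of two \<open>set_sign\<close>
  values in \<open>chi_at\<close>.\<close>

definition \<psi> :: "('n set \<times> nat \<Rightarrow>\<^sub>0 'k) \<Rightarrow> (nat \<times> 'n set \<Rightarrow>\<^sub>0 'k)" where
  "\<psi> = lin_ext (\<lambda>(L, j). sng (j, verts j - L) (set_sign (verts j - L) (verts j)))"

lemma lookup_\<psi>:
  assumes "x \<in> free_module cells" "(L, j) \<in> cells"
  shows "lkp (\<psi> x) (j, verts j - L) = lkp x (L, j) * set_sign (verts j - L) (verts j)"
proof -
  have "lkp (\<psi> x) (j, verts j - L) =
      (\<Sum>z\<in>supp x. if z = (L, j) then lkp x (L, j) * set_sign (verts j - L) (verts j) else 0)"
    unfolding \<psi>_def lookup_lin_ext[OF finite_keys order_refl]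
  proof (intro sum.cong refl)
    fix z assume z: "z \<in> supp x"
    obtain L' j' where [simp]: "z = (L', j')" by (cases z)
    have "(L', j') \<in> cells" using z assms(1) by (auto simp: free_module_def)
    then have "L' \<subseteq> verts j'" "L \<subseteq> verts j" using cellsD(3) assms(2) by blast+
    then have "j' = j \<Longrightarrow> verts j' - L' = verts j - L \<longleftrightarrow> L' = L" by blast
    then show "lkp x z * lkp (case z of (L, j) \<Rightarrow> sng (j, verts j - L) (set_sign (verts j - L) (verts j))) (j, verts j - L) =
        (if z = (L, j) then lkp x (L, j) * set_sign (verts j - L) (verts j) else 0)"
      by (auto simp: lookup_single when_def)
  qed
  then show ?thesis by (auto simp: in_keys_iff)
qed

lemma \<psi>_inj:
  assumes "x \<in> free_module cells" "\<psi> x = 0"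
  shows "x = 0"
proof (rule poly_mapping_eqI)
  fix z :: "'n set \<times> nat" obtain L j where [simp]: "z = (L, j)" by (cases z)
  show "lkp x z = lkp 0 z"
  proof (cases "(L, j) \<in> cells")
    case True
    then show ?thesis using lookup_\<psi>[OF assms(1) True] assms(2) by simp
  next
    case False
    then show ?thesis using in_free_moduleD[OF assms(1)] by auto
  qed
qed

lemma nf_kos_cells: "nf_kos \<alpha> p = free_module {(L, j) \<in> cells. card L = p}"
  unfolding nf_kos_def cells_def by (rule arg_cong[where f = free_module]) auto

lemma nf_kos_sub: "nf_kos \<alpha> p \<subseteq> free_module cells"
  unfolding nf_kos_cells by (rule free_module_mono) auto

text \<open>A face complementary to a set L of size p has \<open>card (verts j) - p\<close>
  elements. The shift \<open>shift_len\<close> absorbs the dependence on j, so the cochain degree is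
  determined by p alone.\<close>

lemma \<psi>_image:
  "\<psi> ` nf_kos \<alpha> p = cochains mle A \<beta> \<alpha> (int (card (verts 1)) - int p - 1)"
proof -
  have card: "int (card \<tau>) = int (card (verts 1)) - int p - 1 + shift_len \<beta> \<alpha> j + 1 \<longleftrightarrow> card (verts j - \<tau>) = p"
    if "\<tau> \<subseteq> verts j" for j \<tau>
  proof -
    have "card (verts j - \<tau>) = card (verts j) - card \<tau>" "card \<tau> \<le> card (verts j)"
      using that by (auto intro: card_Diff_subset card_mono)
    then show ?thesis by (auto simp: shift_len_def verts_def)
  qed
  show ?thesis
  proof safe
    fix x assume x: "x \<in> nf_kos \<alpha> p"
    show "\<psi> x \<in> cochains mle A \<beta> \<alpha> (int (card (verts 1)) - int p - 1)"
      unfolding \<psi>_def cochains_def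
    proof (rule lin_ext_in_free_module, clarify)
      fix L j assume "(L, j) \<in> supp x"
      then have c: "(L, j) \<in> cells" "card L = p" using x by (auto simp: nf_kos_cells free_module_def)
      have "verts j - (verts j - L) = L" using cellsD(3)[OF c(1)] by auto
      then show "sng (j, verts j - L) (set_sign (verts j - L) (verts j)) \<in> free_module
          {(j, \<tau>). j \<in> {1..nrows A} \<and> \<tau> \<in> faces j \<and>
            int (card \<tau>) = int (card (verts 1)) - int p - 1 + shift_len \<beta> \<alpha> j + 1}"
        using cellsD[OF c(1)] c(2) card[of "verts j - L" j] by (intro single_in_free_module) auto
    qed
  next
    fix y assume y: "y \<in> cochains mle A \<beta> \<alpha> (int (card (verts 1)) - int p - 1)"
    define x where "x = lin_ext (\<lambda>(j, \<tau>). sng (verts j - \<tau>, j) (set_sign \<tau> (verts j))) y"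
    have D: "j \<in> {1..nrows A}" "\<tau> \<in> faces j" "\<tau> \<subseteq> verts j" "card (verts j - \<tau>) = p"
      if "(j, \<tau>) \<in> supp y" for j \<tau>
    proof -
      show *: "j \<in> {1..nrows A}" "\<tau> \<in> faces j"
        using y that by (auto simp: cochains_def free_module_def)
      then show sub: "\<tau> \<subseteq> verts j" by (rule delta_verts)
      show "card (verts j - \<tau>) = p"
        using y that card[OF sub] by (auto simp: cochains_def free_module_def)
    qed
    have "x \<in> nf_kos \<alpha> p"
      unfolding x_def nf_kos_cells using D delta_cell
      by (intro lin_ext_in_free_module) (auto intro!: single_in_free_module)
    moreover have "\<psi> x = lin_ext (\<lambda>z. sng z 1) y"
      unfolding \<psi>_def x_def lin_ext_lin_ext
    proof (intro lin_ext_cong, clarify)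
      fix j \<tau> assume "(j, \<tau>) \<in> supp y"
      then have "verts j - (verts j - \<tau>) = \<tau>" using D(3) by auto
      then show "lin_ext (\<lambda>(L, j). sng (j, verts j - L) (set_sign (verts j - L) (verts j)))
          (sng (verts j - \<tau>, j) (set_sign \<tau> (verts j))) = sng (j, \<tau>) 1"
        by (simp add: fscale_single)
    qed
    ultimately show "y \<in> \<psi> ` nf_kos \<alpha> p" by (auto simp: lin_ext_single_id)
  qed
qed

end

section \<open>Compatibility of the comparison map with the differentials\<close>

context ordered_presentation
begin

text \<open>All of \<alpha>, \<open>\<beta> i\<close>, \<open>\<beta> j\<close> have entries 0 or 1
  here. Hence the support of \<open>\<beta> j\<close> and \<open>verts j - L\<close> together give
  the support of \<alpha> without L, whatever j is; deleting the support of \<open>\<beta> i\<close>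
  leaves \<open>verts i - L\<close>.\<close>

lemma face_shift_eq:
  assumes \<alpha>: "\<And>k. lkp \<alpha> k \<le> 1" and j: "j \<in> {1..nrows A}" "vle (\<beta> j) (\<alpha> - ind_vec L)"
    and i: "i \<in> {1..nrows A}" "vle (\<beta> i) (\<alpha> - ind_vec L)"
  shows "face_shift \<beta> (verts j - L) j i = verts i - L"
proof (rule Set.set_eqI)
  fix k
  have "lkp (\<beta> j) k \<le> lkp (\<alpha> - ind_vec L) k" "lkp (\<beta> i) k \<le> lkp (\<alpha> - ind_vec L) k"
    using j(2) i(2) unfolding vle_iff by blast+
  moreover have "lkp (\<beta> j) k = 0 \<or> lkp (\<beta> j) k = 1" "lkp (\<beta> i) k = 0 \<or> lkp (\<beta> i) k = 1"
    using sf_\<beta>[OF j(1)] sf_\<beta>[OF i(1)] by (auto simp: squarefree_vec_def)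
  ultimately show "k \<in> face_shift \<beta> (verts j - L) j i \<longleftrightarrow> k \<in> verts i - L"
    using \<alpha>[of k]
    by (auto simp: face_shift_def verts_def in_keys_iff lookup_minus lookup_ind_vec split: if_splits)
qed

lemma chi_at_eq:
  assumes j: "j \<in> {1..nrows A}" "vle (\<beta> j) (\<alpha> - ind_vec (L - {w}))" "j \<notin> std (\<alpha> - ind_vec (L - {w}))"
    and L: "L \<subseteq> verts j" "w \<in> L"
  shows "chi_at mle A \<beta> \<alpha> j (verts j - L) w =
    (\<Sum>i\<in>supp (nf (\<alpha> - ind_vec (L - {w})) (sng j 1)).
      sng (i, face_shift \<beta> (verts j - (L - {w})) j i)
        (elt_sign w (verts j - (L - {w})) * lkp (nf (\<alpha> - ind_vec (L - {w})) (sng j 1)) i *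
          (set_sign (verts j - (L - {w})) (verts j) / set_sign (face_shift \<beta> (verts j - (L - {w})) j i) (verts i))))"
proof -
  let ?a = "\<alpha> - ind_vec (L - {w})"
  have lead: "j \<in> leads ?a" using j by (simp add: std_def)
  have ins: "insert w (verts j - L) = verts j - (L - {w})" using L by auto
  \<comment> \<open>The exponent at which \<open>chi_at\<close> takes its coefficients is that of
    the monomial after multiplication by \<open>x_w\<close>.\<close>
  have b: "ind_vec (verts j - (L - {w})) + (\<alpha> - \<beta> j) - ind_vec (verts j) = ?a - \<beta> j"
    using L by (intro poly_mapping_eqI) (auto simp: lookup_minus lookup_add lookup_ind_vec)
  have r: "red_coeff mle A \<beta> j (ind_vec (verts j - (L - {w})) + (\<alpha> - \<beta> j) - ind_vec (verts j)) =
      lkp (nf ?a (sng j 1))"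
    unfolding b by (rule red_coeff_eq[OF j(1,2) lead])
  have "{i \<in> {1..<j}. lkp (nf ?a (sng j 1)) i \<noteq> 0} = supp (nf ?a (sng j 1))"
    using nf_lead(1)[OF j(1,2) lead] by (auto simp: free_module_def in_keys_iff)
  then show ?thesis
    unfolding chi_at_def ins verts_def[symmetric] r Let_def by simp
qed

text \<open>The summands for one w agree: either the product with \<open>x_w\<close> is still
  standard, which is the simplicial term, or its normal form spreads over smaller positions, which
  is \<open>chi_at\<close>.\<close>

lemma term_comm:
  assumes \<alpha>: "\<And>k. lkp \<alpha> k \<le> 1" and c: "(L, j) \<in> cells" and w: "w \<in> L"
  shows "fscale (set_sign (verts j - L) (verts j))
      (if insert w (verts j - L) \<in> faces j
       then sng (j, insert w (verts j - L)) (elt_sign w (insert w (verts j - L)))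
       else chi_at mle A \<beta> \<alpha> j (verts j - L) w) =
    fscale (ksgn L w) (\<psi> (emb (L - {w}) (nf (\<alpha> - ind_vec (L - {w})) (sng j 1))))"
proof -
  let ?a = "\<alpha> - ind_vec (L - {w})"
  let ?\<tau> = "verts j - L" and ?\<rho> = "verts j - (L - {w})"
  note cD = cellsD[OF c]
  have ins: "insert w ?\<tau> = ?\<rho>" using cD(3) w by auto
  have vj: "vle (\<beta> j) ?a" using cD(2,3) by (auto simp: vle_verts)
  have diff: "verts j - ?\<rho> = L - {w}" using cD(3) by auto
  have e: "elt_sign w ?\<rho> = ksgn L w * (elt_sign w (verts j) :: 'k)"
    using elt_sign_ksgn[OF w cD(3)] unfolding ins .
  have s: "set_sign ?\<rho> (verts j) = elt_sign w (verts j) * (set_sign ?\<tau> (verts j) :: 'k)"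
    using set_sign_insert[of w ?\<tau> "verts j"] w unfolding ins by simp
  \<comment> \<open>In the \<open>chi_at\<close> case the signs of w and of the old face occur
    twice, once in front and once through the sign of the enlarged face, and so disappear.\<close>
  have sq: "elt_sign w (verts j) * (elt_sign w (verts j) * x) = x" "set_sign ?\<tau> (verts j) * (set_sign ?\<tau> (verts j) * x) = x" for x :: 'k
    by (simp_all flip: mult.assoc)
  have \<psi>_emb: "\<psi> (emb (L - {w}) y) =
      (\<Sum>i\<in>supp y. sng (i, verts i - (L - {w})) (lkp y i * set_sign (verts i - (L - {w})) (verts i)))" for y
    unfolding \<psi>_def emb_def lin_ext_lin_ext by (simp add: lin_ext_def fscale_single)
  show ?thesis
  proof (cases "j \<in> std ?a")
    case True
    then have "?\<rho> \<in> faces j" using cD(1) by (auto simp: in_delta_iff diff)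
    moreover have "nf ?a (sng j 1) = sng j 1" using True by (intro nf_std single_in_free_module)
    ultimately show ?thesis
      unfolding ins by (simp add: \<psi>_def fscale_single e s mult.assoc mult.left_commute mult.commute)
  next
    case False
    then have nd: "?\<rho> \<notin> faces j" using cD(1) by (auto simp: in_delta_iff diff)
    let ?y = "nf ?a (sng j 1)"
    have lead: "j \<in> leads ?a" using False cD(1) vj by (simp add: std_def)
    have f: "face_shift \<beta> ?\<rho> j i = verts i - (L - {w})" if "i \<in> supp ?y" for i
    proof -
      have "i \<in> std ?a" using nf_lead(1)[OF cD(1) vj lead] that by (auto simp: free_module_def)
      then show ?thesis using face_shift_eq[OF \<alpha> cD(1) vj] std_D by blast
    qed
    show ?thesis
      unfolding ins if_not_P[OF nd] chi_at_eq[OF cD(1) vj False cD(3) w] \<psi>_emb fscale_sum fscale_single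
    proof (intro sum.cong refl)
      fix i assume i: "i \<in> supp ?y"
      show "sng (i, face_shift \<beta> ?\<rho> j i) (set_sign ?\<tau> (verts j) * (elt_sign w ?\<rho> * lkp ?y i *
            (set_sign ?\<rho> (verts j) / set_sign (face_shift \<beta> ?\<rho> j i) (verts i)))) =
          sng (i, verts i - (L - {w})) (ksgn L w * (lkp ?y i * set_sign (verts i - (L - {w})) (verts i)))"
        unfolding f[OF i] e s divide_set_sign by (simp add: mult.assoc mult.left_commute mult.commute sq)
    qed
  qed
qed

lemma codiff_single:
  assumes "L \<subseteq> verts j"
  shows "codiff mle A \<beta> \<alpha> (sng (j, verts j - L) c) = fscale c (\<Sum>w\<in>L.
    if insert w (verts j - L) \<in> faces j
       then sng (j, insert w (verts j - L)) (elt_sign w (insert w (verts j - L)))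
       else chi_at mle A \<beta> \<alpha> j (verts j - L) w)"
proof -
  let ?P = "\<lambda>w. insert w (verts j - L) \<in> faces j"
  have L: "supp (\<alpha> - \<beta> j) - (verts j - L) = L" using assms by (auto simp: verts_def)
  have "simp_diff mle A \<beta> \<alpha> j (verts j - L) + chi mle A \<beta> \<alpha> j (verts j - L) =
      (\<Sum>w\<in>L. if ?P w then sng (j, insert w (verts j - L)) (elt_sign w (insert w (verts j - L)))
        else chi_at mle A \<beta> \<alpha> j (verts j - L) w)"
    unfolding simp_diff_def chi_def L
    by (subst sum.If_cases) (simp_all add: Int_def)
  then show ?thesis by (simp add: codiff_def)
qed

lemma codiff_\<psi>:
  assumes \<alpha>: "\<And>k. lkp \<alpha> k \<le> 1" and x: "x \<in> free_module cells"
  shows "codiff mle A \<beta> \<alpha> (\<psi> x) = \<psi> (nf_kos_diff \<alpha> x)"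
proof -
  have "codiff mle A \<beta> \<alpha> (\<psi> x) =
      lin_ext (\<lambda>z. codiff mle A \<beta> \<alpha> (case z of (L, j) \<Rightarrow> sng (j, verts j - L) (set_sign (verts j - L) (verts j)))) x"
    unfolding \<psi>_def codiff_def by (rule lin_ext_lin_ext)
  also have "\<dots> = lin_ext (\<lambda>z. \<psi> (case z of (L, j) \<Rightarrow>
      \<Sum>w\<in>L. fscale (ksgn L w) (emb (L - {w}) (nf (\<alpha> - ind_vec (L - {w})) (sng j 1))))) x"
  proof (intro lin_ext_cong, clarify)
    fix L j assume "(L, j) \<in> supp x"
    then have c: "(L, j) \<in> cells" using x by (auto simp: free_module_def)
    have sum: "\<psi> (\<Sum>w\<in>L. fscale (ksgn L w) (emb (L - {w}) (nf (\<alpha> - ind_vec (L - {w})) (sng j 1)))) =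
        (\<Sum>w\<in>L. fscale (ksgn L w) (\<psi> (emb (L - {w}) (nf (\<alpha> - ind_vec (L - {w})) (sng j 1)))))"
      by (simp add: \<psi>_def lin_ext_sum lin_ext_fscale)
    show "codiff mle A \<beta> \<alpha> (sng (j, verts j - L) (set_sign (verts j - L) (verts j))) =
        \<psi> (\<Sum>w\<in>L. fscale (ksgn L w) (emb (L - {w}) (nf (\<alpha> - ind_vec (L - {w})) (sng j 1))))"
      unfolding codiff_single[OF cellsD(3)[OF c]] fscale_sum sum by (intro sum.cong refl term_comm[OF \<alpha> c])
  qed
  also have "\<dots> = \<psi> (nf_kos_diff \<alpha> x)"
    unfolding \<psi>_def nf_kos_diff_def by (rule lin_ext_lin_ext[symmetric])
  finally show ?thesis .
qed

lemma nf_kos_diff_cells: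
  assumes x: "x \<in> free_module cells"
  shows "nf_kos_diff \<alpha> x \<in> free_module cells"
  unfolding nf_kos_diff_def
proof (rule lin_ext_in_free_module, clarify)
  fix L j assume "(L, j) \<in> supp x"
  then have c: "(L, j) \<in> cells" using x by (auto simp: free_module_def)
  have "emb (L - {w}) (nf (\<alpha> - ind_vec (L - {w})) (sng j 1)) \<in> free_module cells" for w
  proof -
    have "j \<in> {i \<in> {1..nrows A}. vle (\<beta> i) (\<alpha> - ind_vec (L - {w}))}"
      using cellsD[OF c] by (auto simp: vle_verts)
    then have "sng j 1 \<in> V (\<alpha> - ind_vec (L - {w}))" unfolding V_def by (rule single_in_free_module)
    then have "emb (L - {w}) (nf (\<alpha> - ind_vec (L - {w})) (sng j 1)) \<in>
        free_module ({L - {w}} \<times> std (\<alpha> - ind_vec (L - {w})))"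
      by (intro emb_in_free_module nf_props)
    moreover have "{L - {w}} \<times> std (\<alpha> - ind_vec (L - {w})) \<subseteq> cells" by (auto simp: cells_def)
    ultimately show ?thesis using free_module_mono by blast
  qed
  then show "(\<Sum>w\<in>L. fscale (ksgn L w) (emb (L - {w}) (nf (\<alpha> - ind_vec (L - {w})) (sng j 1)))) \<in> free_module cells"
    by (intro free_module_sum free_module_scale)
qed

lemma linear_\<psi>: "linear_map \<psi>"
  unfolding \<psi>_def by (rule linear_lin_ext)

lemma linear_nf_kos_diff: "linear_map (nf_kos_diff \<alpha>)"
  unfolding nf_kos_diff_def by (rule linear_lin_ext)

lemma linear_codiff: "linear_map (codiff mle A \<beta> \<alpha>)"
  unfolding codiff_def by (rule linear_lin_ext)

lemma dim_\<psi>: "fs.subspace X \<Longrightarrow> X \<subseteq> free_module cells \<Longrightarrow> fs.dim (\<psi> ` X) = fs.dim X"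
  using fin_sub_subset[OF fin_sub_free_module[OF finite_cells]] \<psi>_inj
  by (intro dim_image_inj linear_\<psi>) blast+

lemma koszul_eq_cohomology:
  assumes \<alpha>: "\<And>k. lkp \<alpha> k \<le> 1"
  shows "homology_dim (nf_kos \<alpha> i) (nf_kos_diff \<alpha>) (nf_kos \<alpha> (Suc i)) (nf_kos_diff \<alpha>) =
    cohomology_dim mle A \<beta> \<alpha> (int (card (verts 1)) - int i - 1)"
proof -
  let ?t = "int (card (verts 1)) - int i - 1"
  have E0: "cochains mle A \<beta> \<alpha> ?t = \<psi> ` nf_kos \<alpha> i" by (simp add: \<psi>_image)
  have E1: "cochains mle A \<beta> \<alpha> (?t - 1) = \<psi> ` nf_kos \<alpha> (Suc i)"
    unfolding \<psi>_image by (intro arg_cong[where f = "cochains mle A \<beta> \<alpha>"]) simp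
  have 1: "{y \<in> \<psi> ` nf_kos \<alpha> i. codiff mle A \<beta> \<alpha> y = 0} = \<psi> ` {x \<in> nf_kos \<alpha> i. nf_kos_diff \<alpha> x = 0}"
  proof -
    have "codiff mle A \<beta> \<alpha> (\<psi> x) = 0 \<longleftrightarrow> nf_kos_diff \<alpha> x = 0" if "x \<in> nf_kos \<alpha> i" for x
    proof -
      have x: "x \<in> free_module cells" using that nf_kos_sub by blast
      have "\<psi> 0 = 0" by (simp add: \<psi>_def)
      then show ?thesis unfolding codiff_\<psi>[OF \<alpha> x] using \<psi>_inj[OF nf_kos_diff_cells[OF x]] by auto
    qed
    then show ?thesis by blast
  qed
  have 2: "codiff mle A \<beta> \<alpha> ` \<psi> ` nf_kos \<alpha> (Suc i) = \<psi> ` nf_kos_diff \<alpha> ` nf_kos \<alpha> (Suc i)"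
    unfolding image_image
  proof (rule image_cong[OF refl])
    fix x assume "x \<in> nf_kos \<alpha> (Suc i)"
    then have "x \<in> free_module cells" using nf_kos_sub by blast
    then show "codiff mle A \<beta> \<alpha> (\<psi> x) = \<psi> (nf_kos_diff \<alpha> x)" by (rule codiff_\<psi>[OF \<alpha>])
  qed
  have sub: "fs.subspace (nf_kos \<alpha> p)" for p unfolding nf_kos_def by (rule subspace_free_module)
  have "nf_kos_diff \<alpha> ` nf_kos \<alpha> (Suc i) \<subseteq> free_module cells" using nf_kos_diff_cells nf_kos_sub by blast
  then have 3: "fs.dim (\<psi> ` nf_kos_diff \<alpha> ` nf_kos \<alpha> (Suc i)) = fs.dim (nf_kos_diff \<alpha> ` nf_kos \<alpha> (Suc i))"
    by (intro dim_\<psi> subspace_image_lin linear_nf_kos_diff sub)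
  have "{x \<in> nf_kos \<alpha> i. nf_kos_diff \<alpha> x = 0} \<subseteq> free_module cells" using nf_kos_sub by blast
  then have 4: "fs.dim (\<psi> ` {x \<in> nf_kos \<alpha> i. nf_kos_diff \<alpha> x = 0}) = fs.dim {x \<in> nf_kos \<alpha> i. nf_kos_diff \<alpha> x = 0}"
    by (intro dim_\<psi> subspace_ker_lin linear_nf_kos_diff sub)
  show ?thesis unfolding cohomology_dim_def homology_dim_def E0 E1 1 2 3 4 ..
qed

text \<open>If \<open>\<alpha> k\<close> is at least \<open>2\<close>, then \<open>k\<close> may be added to or removed from a cell freely, and both sides
  vanish: the differentials are injective on one half of the cells, and the halves match up.\<close>

context
  fixes k :: 'n
  assumes k: "lkp \<alpha> k \<ge> 2"
begin

text \<open>The entry of the degree at k stays positive whether or not k is subtracted, so the two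
  degrees have the same support.\<close>

lemma std_insert: "std (\<alpha> - ind_vec (insert k L)) = std (\<alpha> - ind_vec (L - {k}))"
proof (rule leads_std_cong(2))
  have "0 \<le> lkp (\<alpha> - ind_vec (insert k L)) l \<longleftrightarrow> 0 \<le> lkp (\<alpha> - ind_vec (L - {k})) l" for l
    using k by (cases "l = k") (auto simp: lookup_minus lookup_ind_vec)
  then show "nonneg_vec (\<alpha> - ind_vec (insert k L)) \<longleftrightarrow> nonneg_vec (\<alpha> - ind_vec (L - {k}))"
    by (simp add: nonneg_vec_def)
  show "supp (\<alpha> - ind_vec (insert k L)) = supp (\<alpha> - ind_vec (L - {k}))"
  proof (rule Set.set_eqI)
    fix l
    show "l \<in> supp (\<alpha> - ind_vec (insert k L)) \<longleftrightarrow> l \<in> supp (\<alpha> - ind_vec (L - {k}))"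
      using k by (cases "l = k") (auto simp: in_keys_iff lookup_minus lookup_ind_vec)
  qed
qed

lemma cells_insert: "(insert k L, j) \<in> cells \<longleftrightarrow> (L - {k}, j) \<in> cells"
  by (simp add: cells_def std_insert)

lemma k_verts: "j \<in> {1..nrows A} \<Longrightarrow> k \<in> verts j"
  using sf_\<beta>[of j] k by (auto simp: verts_def in_keys_iff lookup_minus squarefree_vec_def dest: spec[of _ k])

text \<open>The half used is that of cells with k in L. Removing k gives
  \<open>(L - {k}, j)\<close>, which is standard and needs no reduction, while removing any other
  element keeps k. So the coefficients at cells without k recover the vector up to sign.\<close>

lemma koszul_vanish: "homology_dim (nf_kos \<alpha> i) (nf_kos_diff \<alpha>) (nf_kos \<alpha> (Suc i)) (nf_kos_diff \<alpha>) = 0"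
proof -
  let ?B = "\<lambda>p. {(L, j) \<in> cells. card L = p}" and ?A = "\<lambda>p. {(L, j) \<in> cells. card L = p \<and> k \<in> L}"
  have inj: "x = 0" if x: "x \<in> free_module (?A p)" "nf_kos_diff \<alpha> x = 0" for x p
  proof (rule ccontr)
    assume "x \<noteq> 0"
    then obtain z where z: "z \<in> supp x" by (metis ex_in_conv keys_eq_empty)
    obtain L0 j0 where [simp]: "z = (L0, j0)" by (cases z)
    let ?a = "\<alpha> - ind_vec (L0 - {k})"
    have A: "(L, j) \<in> cells" "k \<in> L" if "(L, j) \<in> supp x" for L j
      using x(1) that by (auto simp: free_module_def)
    have c0: "(L0, j0) \<in> cells" "k \<in> L0" using A z by auto
    have "0 = lkp (nf_kos_diff \<alpha> x) (L0 - {k}, j0)" using x(2) by simp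
    also have "\<dots> = (\<Sum>z\<in>supp x. if z = (L0, j0) then lkp x (L0, j0) * ksgn L0 k else 0)"
      unfolding nf_kos_diff_def lookup_lin_ext[OF finite_keys order_refl]
    proof (intro sum.cong refl)
      fix z' assume z': "z' \<in> supp x"
      obtain L j where [simp]: "z' = (L, j)" by (cases z')
      have c: "(L, j) \<in> cells" "k \<in> L" using A z' by auto
      have "lkp (\<Sum>w\<in>L. fscale (ksgn L w) (emb (L - {w}) (nf (\<alpha> - ind_vec (L - {w})) (sng j 1)))) (L0 - {k}, j0) =
          (\<Sum>w\<in>L. if w = k then (ksgn L k when L = L0 \<and> j = j0) else 0)"
        unfolding lookup_sum lookup_fscale lookup_emb
      proof (intro sum.cong refl)
        fix w assume w: "w \<in> L"
        show "ksgn L w * (lkp (nf (\<alpha> - ind_vec (L - {w})) (sng j 1)) j0 when L0 - {k} = L - {w}) =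
            (if w = k then (ksgn L k when L = L0 \<and> j = j0) else 0)"
        proof (cases "w = k")
          case True
          have eq: "L0 - {k} = L - {k} \<longleftrightarrow> L = L0" using c(2) c0(2) by auto
          have "insert k L = L" using c(2) by auto
          then have "j \<in> std (\<alpha> - ind_vec (L - {k}))" using c(1) std_insert[of L] by (simp add: cells_def)
          then have "nf (\<alpha> - ind_vec (L - {k})) (sng j 1) = sng j 1" by (intro nf_std single_in_free_module)
          then show ?thesis using True eq by (auto simp: lookup_single when_def)
        next
          case False
          then have "L0 - {k} \<noteq> L - {w}" using c(2) by auto
          then show ?thesis using False by simp
        qed
      qed
      then show "lkp x z' * lkp (case z' of (L, j) \<Rightarrow> \<Sum>w\<in>L. fscale (ksgn L w) (emb (L - {w}) (nf (\<alpha> - ind_vec (L - {w})) (sng j 1)))) (L0 - {k}, j0) =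
          (if z' = (L0, j0) then lkp x (L0, j0) * ksgn L0 k else 0)"
        using c(2) by (auto simp: when_def)
    qed
    also have "\<dots> = lkp x (L0, j0) * ksgn L0 k" using z by simp
    finally show False using z by (simp add: in_keys_iff)
  qed
  \<comment> \<open>Removing k lowers the size by one: it matches the chosen half in Koszul degree
    \<open>i + 1\<close> with the complementary half in degree \<open>i\<close>.\<close>
  have "bij_betw (\<lambda>(L, j). (L - {k}, j)) (?A (Suc i)) (?B i - ?A i)"
  proof (rule bij_betw_byWitness[where f' = "\<lambda>(L, j). (insert k L, j)"])
    have "(L - {k}, j) \<in> cells" if "(L, j) \<in> cells" "k \<in> L" for L j
      using that cells_insert[of L j] by (simp add: insert_absorb)
    then show "(\<lambda>(L, j). (L - {k}, j)) ` ?A (Suc i) \<subseteq> ?B i - ?A i" by auto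
    have "(insert k L, j) \<in> cells" if "(L, j) \<in> cells" "k \<notin> L" for L j
      using that cells_insert[of L j] by simp
    then show "(\<lambda>(L, j). (insert k L, j)) ` (?B i - ?A i) \<subseteq> ?A (Suc i)" by auto
  qed auto
  then have card: "card (?A (Suc i)) = card (?B i - ?A i)" by (rule bij_betw_same_card)
  have fin: "finite (?B p)" for p by (rule finite_subset[OF _ finite_cells]) auto
  have sub: "?A p \<subseteq> ?B p" for p by auto
  show ?thesis
    unfolding nf_kos_cells
    by (rule homology_dim_eq_0[OF fin fin sub sub card linear_nf_kos_diff linear_nf_kos_diff]) (rule inj, assumption+)+
qed

lemma delta_insert:
  assumes "j \<in> {1..nrows A}"
  shows "insert k \<tau> \<in> faces j \<longleftrightarrow> \<tau> - {k} \<in> faces j"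
proof -
  have "verts j - insert k \<tau> = (verts j - \<tau>) - {k}" "verts j - (\<tau> - {k}) = insert k (verts j - \<tau>)"
    using k_verts[OF assms] by auto
  moreover have "insert k \<tau> \<subseteq> verts j \<longleftrightarrow> \<tau> - {k} \<subseteq> verts j" using k_verts[OF assms] by auto
  ultimately show ?thesis by (simp add: in_delta_iff[OF assms] std_insert)
qed

text \<open>The targets of \<open>chi\<close> are not under control here, but they always have
  smaller index j. In the component of the largest j that occurs only the simplicial part remains,
  and on faces without k it is injective because adding k can be read off.\<close>

lemma cohomology_vanish: "cohomology_dim mle A \<beta> \<alpha> t = 0"
proof -
  let ?B = "\<lambda>t. {(j, \<tau>). j \<in> {1..nrows A} \<and> \<tau> \<in> faces j \<and>
                          int (card \<tau>) = (t + shift_len \<beta> \<alpha> j) + 1}"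
  let ?A = "\<lambda>t. {(j, \<tau>). (j, \<tau>) \<in> ?B t \<and> k \<notin> \<tau>}"
  have fin: "finite (?B t)" for t
    by (rule finite_subset[of _ "{1..nrows A} \<times> UNIV"]) auto
  have inj: "x = 0" if x: "x \<in> free_module (?A t)" "codiff mle A \<beta> \<alpha> x = 0" for x t
  proof (rule ccontr)
    assume "x \<noteq> 0"
    then have ne: "fst ` supp x \<noteq> {}" by (metis image_is_empty keys_eq_empty)
    \<comment> \<open>The largest index in the support: contributions of \<open>chi\<close> from
      indices at most \<open>j0\<close> land strictly below it.\<close>
    define j0 where "j0 = Max (fst ` supp x)"
    have "j0 \<in> fst ` supp x" unfolding j0_def using ne by (intro Max_in) auto
    then obtain \<tau>0 where z: "(j0, \<tau>0) \<in> supp x" by auto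
    have le: "j \<le> j0" if "(j, \<tau>) \<in> supp x" for j \<tau>
      unfolding j0_def using that by (intro Max_ge) force+
    have A: "j \<in> {1..nrows A}" "\<tau> \<in> faces j" "k \<notin> \<tau>" if "(j, \<tau>) \<in> supp x" for j \<tau>
      using x(1) that by (auto simp: free_module_def)
    have chi0: "lkp (chi mle A \<beta> \<alpha> j \<tau>) (j0, \<rho>) = 0" if "j \<le> j0" for j \<tau> \<rho>
      unfolding chi_def chi_at_def Let_def lookup_sum using that
      by (intro sum.neutral ballI) (auto simp: lookup_single when_def)
    have simp0: "lkp (simp_diff mle A \<beta> \<alpha> j \<tau>) (j0, insert k \<tau>0) =
        (elt_sign k (insert k \<tau>0) when (j, \<tau>) = (j0, \<tau>0))" if "(j, \<tau>) \<in> supp x" for j \<tau>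
    proof -
      let ?T = "{t \<in> supp (\<alpha> - \<beta> j) - \<tau>. insert t \<tau> \<in> faces j}"
      have kT: "k \<in> ?T"
      proof -
        have "\<tau> - {k} = \<tau>" using A(3)[OF that] by (rule Diff_insert0[of _ _ "{}", simplified])
        then have "insert k \<tau> \<in> faces j"
          unfolding delta_insert[OF A(1)[OF that]] using A(2)[OF that] by (rule ssubst)
        moreover have "k \<in> supp (\<alpha> - \<beta> j)"
          using k_verts[OF A(1)[OF that]] unfolding verts_def .
        ultimately show ?thesis using A(3)[OF that] by (intro CollectI conjI DiffI)
      qed
      have "lkp (simp_diff mle A \<beta> \<alpha> j \<tau>) (j0, insert k \<tau>0) =
          (\<Sum>t\<in>?T. if t = k then (elt_sign k (insert k \<tau>0) when (j, \<tau>) = (j0, \<tau>0)) else 0)"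
        unfolding simp_diff_def lookup_sum
      proof (intro sum.cong refl)
        fix t
        have "t = k" if eq: "insert t \<tau> = insert k \<tau>0"
        proof -
          have "k \<in> insert t \<tau>" unfolding eq by simp
          then show ?thesis using A(3)[OF \<open>(j, \<tau>) \<in> supp x\<close>] by simp
        qed
        moreover have "insert k \<tau> = insert k \<tau>0 \<longleftrightarrow> \<tau> = \<tau>0"
          by (rule insert_ident[OF A(3)[OF that] A(3)[OF z]])
        ultimately show "lkp (sng (j, insert t \<tau>) (elt_sign t (insert t \<tau>))) (j0, insert k \<tau>0) =
            (if t = k then (elt_sign k (insert k \<tau>0) when (j, \<tau>) = (j0, \<tau>0)) else (0 :: 'k))"
          by (auto simp: lookup_single when_def)
      qed
      then show ?thesis using kT by simp
    qed
    have "0 = lkp (codiff mle A \<beta> \<alpha> x) (j0, insert k \<tau>0)" using x(2) by simp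
    also have "\<dots> = (\<Sum>z\<in>supp x. if z = (j0, \<tau>0) then lkp x z * elt_sign k (insert k \<tau>0) else 0)"
      unfolding codiff_def lookup_lin_ext[OF finite_keys order_refl]
    proof (intro sum.cong refl)
      fix z assume z: "z \<in> supp x"
      obtain j \<tau> where [simp]: "z = (j, \<tau>)" by (cases z)
      have "(j, \<tau>) \<in> supp x" using z by simp
      then show "lkp x z * lkp (case z of (j, \<tau>) \<Rightarrow> simp_diff mle A \<beta> \<alpha> j \<tau> + chi mle A \<beta> \<alpha> j \<tau>) (j0, insert k \<tau>0) =
          (if z = (j0, \<tau>0) then lkp x z * elt_sign k (insert k \<tau>0) else 0)"
        by (simp add: lookup_add simp0 chi0[OF le] when_def)
    qed
    also have "\<dots> = lkp x (j0, \<tau>0) * elt_sign k (insert k \<tau>0)" using z by simp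
    finally show False using z by (simp add: in_keys_iff elt_sign_def)
  qed
  \<comment> \<open>Adding k raises the cochain degree by one: faces without k in degree
    \<open>t - 1\<close> match faces with k in degree \<open>t\<close>.\<close>
  have "bij_betw (\<lambda>(j, \<tau>). (j, insert k \<tau>)) (?A (t - 1)) (?B t - ?A t)"
  proof (rule bij_betw_byWitness[where f' = "\<lambda>(j, \<tau>). (j, \<tau> - {k})"])
    show "(\<lambda>(j, \<tau>). (j, insert k \<tau>)) ` ?A (t - 1) \<subseteq> ?B t - ?A t"
    proof (rule image_subsetI)
      fix z assume z: "z \<in> ?A (t - 1)"
      obtain j \<tau> where [simp]: "z = (j, \<tau>)" by (cases z)
      have *: "j \<in> {1..nrows A}" "\<tau> \<in> faces j" "k \<notin> \<tau>"
        "int (card \<tau>) = t - 1 + shift_len \<beta> \<alpha> j + 1"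
        using z by simp_all
      have "\<tau> - {k} = \<tau>" using *(3) by (rule Diff_insert0[of _ _ "{}", simplified])
      then have "insert k \<tau> \<in> faces j"
        unfolding delta_insert[OF *(1)] using *(2) by (rule ssubst)
      then show "(case z of (j, \<tau>) \<Rightarrow> (j, insert k \<tau>)) \<in> ?B t - ?A t" using * by simp
    qed
    show "(\<lambda>(j, \<tau>). (j, \<tau> - {k})) ` (?B t - ?A t) \<subseteq> ?A (t - 1)"
    proof (rule image_subsetI)
      fix z assume z: "z \<in> ?B t - ?A t"
      obtain j \<tau> where [simp]: "z = (j, \<tau>)" by (cases z)
      have *: "j \<in> {1..nrows A}" "\<tau> \<in> faces j" "k \<in> \<tau>"
        "int (card \<tau>) = t + shift_len \<beta> \<alpha> j + 1"
        using z by simp_all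
      have "\<tau> - {k} \<in> faces j"
        using *(2) delta_insert[OF *(1), of \<tau>] unfolding insert_absorb[OF *(3)] by (rule iffD1[rotated])
      moreover have "card \<tau> = Suc (card (\<tau> - {k}))" by (rule card.remove[OF finite *(3)])
      ultimately show "(case z of (j, \<tau>) \<Rightarrow> (j, \<tau> - {k})) \<in> ?A (t - 1)" using * by simp
    qed
  qed auto
  then have card: "card (?A (t - 1)) = card (?B t - ?A t)" by (rule bij_betw_same_card)
  have sub: "?A t \<subseteq> ?B t" for t by auto
  show ?thesis
    unfolding cohomology_dim_def cochains_def
    by (rule homology_dim_eq_0[OF fin fin sub sub card linear_codiff linear_codiff]) (rule inj, assumption+)+
qed

end

theorem betti_eq_cohomology:
  "betti (coker_module A \<beta>) i \<alpha> = cohomology_dim mle A \<beta> \<alpha> (int (card (verts 1)) - int i - 1)"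
proof (cases "\<forall>k. lkp \<alpha> k \<le> 1")
  case True
  then show ?thesis by (simp add: betti_eq_koszul koszul_eq_cohomology)
next
  case False
  then obtain k where "\<not> lkp \<alpha> k \<le> 1" by blast
  then have "lkp \<alpha> k \<ge> 2" by simp
  then show ?thesis by (simp add: betti_eq_koszul koszul_vanish cohomology_vanish)
qed

end

theorem corollary4p7:
  fixes A :: "('n::{finite,linorder}, 'k::field_char_0) term_matrix"
    and \<gamma> \<beta> :: "nat \<Rightarrow> 'n mdeg"
    and mle :: "'n expo \<Rightarrow> 'n expo \<Rightarrow> bool"
    and \<alpha> :: "'n mdeg"
    and i :: nat
  assumes "nrows A \<ge> 1"
    and "multigraded A"
    and "squarefree_matrix A"
    and "squarefree_solution A \<gamma> \<beta>"
    and "monomial_order mle"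
  shows "betti (coker_module A \<beta>) i \<alpha> =
         cohomology_dim mle A \<beta> \<alpha> (int (card (Poly_Mapping.keys (\<alpha> - \<beta> 1))) - int i - 1)"
proof -
  interpret ordered_presentation A \<gamma> \<beta> mle \<alpha>
    by unfold_locales fact+
  show ?thesis using betti_eq_cohomology[of i] by (simp add: verts_def)
qed

end
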